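(* For a hereditary class $\mathcal C$ of graphs, the following are equivalent: (1) $\mathcal C$ has almost bounded merge-width; (2) $\mathcal C$ has almost bounded transient merge-width; (3) $\mathcal C$ has almost bounded partition merge-width; (4) $\mathcal C$ has almost bounded definable merge-width.
   Context: All graphs are finite, simple and undirected; a class is hereditary if closed under induced subgraphs. For a partition $\mathcal P$ of $V(G)$ and $X\subseteq V(G)$, $X/\mathcal P$ denotes the set of parts of $\mathcal P$ intersecting $X$. For $R\subseteq\binom{V(G)}2$, $\mathrm{Ball}^r_R(v)$ is the radius-$r$ ball around $v$ in $(V(G),R)$; similarly for a graph $H$. $\mathcal P$ is homogeneous modulo $R$ if for all parts $X,Y$ (possibly equal), the pairs $\{x,y\}$, $x\in X,y\in Y,x\neq y$, not in $R$, are all edges of $G$ or all non-edges. A merge sequence for $G$ is $(\mathcal P_1,R_1),\dots,(\mathcal P_m,R_m)$ with $\mathcal P_1\preceq\dots\preceq\mathcal P_m$ partitions of $V(G)$, $\mathcal P_1$ into singletons, $\mathcal P_m=\{V(G)\}$, $R_1\subseteq\dots\subseteq R_m$, $\mathcal P_t$ homogeneous modulo $R_t$; radius-$r$ width $\max_{t<m}\max_v|\mathrm{Ball}^r_{R_{t+1}}(v)/\mathcal P_t|$; $\mathrm{mw}_r(G)$ the minimum. A $\mathcal P$-flip of $G$ complements the adjacency between all pairs of distinct vertices in $X\times Y$ for some chosen pairs of parts $(X,Y)$ (possibly $X=Y$). $\mathrm{dist}_{\mathcal P}(x,y)$ is the maximum of $\mathrm{dist}_{G'}(x,y)$ over $\mathcal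 P$-flips $G'$; $\mathrm{Ball}^r_{\mathcal P}$ accordingly. $\mathcal N_S$: elements of $S$ singletons, $u,v\notin S$ together iff $N(u)\cap S=N(v)\cap S$. $\mathrm{tmw}_r(G)$: least $k$ with a sequence $(\mathcal P_1,G_1),\dots,(\mathcal P_m,G_m)$, $\mathcal P_1\preceq\dots\preceq\mathcal P_m$ from singletons to $\{V(G)\}$, $G_i$ a $\mathcal P_i$-flip of $G$, $|\mathrm{Ball}^r_{G_{i+1}}(v)/\mathcal P_i|\le k$ for all $i<m$, $v$. $\mathrm{pmw}_r(G)$: minimum over such chains of $\max_{i<m}\max_v|\mathrm{Ball}^r_{\mathcal P_{i+1}}(v)/\mathcal P_i|$. $\mathrm{dmw}_r(G)$: minimum over orders $v_1<\dots<v_n$ of $\max_{i\le n}\max_v|\mathrm{Ball}^r_{\mathcal P_i}(v)/\mathcal P_i|$ with $\mathcal P_i=\mathcal N_{\{v_1,\dots,v_{n-i}\}}$. A class $\mathcal C$ has almost bounded merge-width if for every $r\in\mathbb N$ and $\varepsilon>0$ there is $n_0$ such that $\mathrm{mw}_r(G)\le n^\varepsilon$ for every $G\in\mathcal C$ with $n\ge n_0$ vertices; almost bounded transient, partition and definable merge-width are defined the same way with $\mathrm{tmw}_r$, $\mathrm{pmw}_r$, $\mathrm{dmw}_r$. *)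

theory Defs
  imports Complex_Main "HOL-Library.Extended_Nat" "HOL-Library.Disjoint_Sets" "HOL-Library.Ramsey"
begin

subsection \<open>Graphs, distances and balls\<close>

record 'a graph =
  verts :: "'a set"
  edges :: "'a set set"

definition simple_graph :: "'a graph \<Rightarrow> bool" where
  "simple_graph G \<longleftrightarrow> finite (verts G) \<and> edges G \<subseteq> [verts G]\<^bsup>2\<^esup>"

definition induced_subgraph :: "'a graph \<Rightarrow> 'a set \<Rightarrow> 'a graph" where
  "induced_subgraph G S = \<lparr>verts = S, edges = {e \<in> edges G. e \<subseteq> S}\<rparr>"

definition hereditary :: "'a graph set \<Rightarrow> bool" where
  "hereditary C \<longleftrightarrow> (\<forall>G\<in>C. \<forall>S. S \<subseteq> verts G \<longrightarrow> induced_subgraph G S \<in> C)"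

definition adj :: "'a graph \<Rightarrow> ('a \<times> 'a) set" where
  "adj G = {(x, y). {x, y} \<in> edges G}"

definition nbhd :: "'a graph \<Rightarrow> 'a \<Rightarrow> 'a set" where
  "nbhd G v = {u. {v, u} \<in> edges G}"

text \<open>Length of a shortest walk; the infimum of the empty set is \<open>\<infinity>\<close>.\<close>

definition gdist :: "'a graph \<Rightarrow> 'a \<Rightarrow> 'a \<Rightarrow> enat" where
  "gdist G x y = Inf {enat k | k. (x, y) \<in> adj G ^^ k}"

definition gball :: "nat \<Rightarrow> 'a graph \<Rightarrow> 'a \<Rightarrow> 'a set" where
  "gball r G v = {u \<in> verts G. gdist G v u \<le> enat r}"


subsection \<open>Partitions and flips\<close>

definition parts_meeting :: "'a set \<Rightarrow> 'a set set \<Rightarrow> 'a set set" where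
  "parts_meeting X P = {A \<in> P. A \<inter> X \<noteq> {}}"

definition partition_chain :: "'a set \<Rightarrow> nat \<Rightarrow> (nat \<Rightarrow> 'a set set) \<Rightarrow> bool" where
  "partition_chain V m P \<longleftrightarrow>
     1 \<le> m \<and>
     (\<forall>t\<in>{1..m}. partition_on V (P t)) \<and>
     (\<forall>t\<in>{1..<m}. refines V (P t) (P (t + 1))) \<and>
     P 1 = (\<lambda>v. {v}) ` V \<and>
     P m = {V}"

text \<open>\<open>F\<close> is the set of chosen pairs of parts. A pair of parts is chosen as an unordered pair:
  having both \<open>(X, Y)\<close> and \<open>(Y, X)\<close> in \<open>F\<close> still complements only once.\<close>

definition flip :: "('a set \<times> 'a set) set \<Rightarrow> 'a graph \<Rightarrow> 'a graph" where
  "flip F G = \<lparr>verts = verts G,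
     edges = {e \<in> [verts G]\<^bsup>2\<^esup>.
       (e \<in> edges G) \<noteq> (\<exists>(X, Y)\<in>F. \<exists>x\<in>X. \<exists>y\<in>Y. e = {x, y})}\<rparr>"

definition flips :: "'a set set \<Rightarrow> 'a graph \<Rightarrow> 'a graph set" where
  "flips P G = {flip F G | F. F \<subseteq> P \<times> P}"

text \<open>A finite graph has finitely many flips, so the supremum is a maximum.\<close>

definition pdist :: "'a graph \<Rightarrow> 'a set set \<Rightarrow> 'a \<Rightarrow> 'a \<Rightarrow> enat" where
  "pdist G P x y = (SUP G'\<in>flips P G. gdist G' x y)"

definition pball :: "nat \<Rightarrow> 'a graph \<Rightarrow> 'a set set \<Rightarrow> 'a \<Rightarrow> 'a set" where
  "pball r G P v = {u \<in> verts G. pdist G P v u \<le> enat r}"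

definition nbhd_partition :: "'a graph \<Rightarrow> 'a set \<Rightarrow> 'a set set" where
  "nbhd_partition G S =
     (\<lambda>s. {s}) ` S \<union>
     (\<lambda>u. {v \<in> verts G - S. nbhd G v \<inter> S = nbhd G u \<inter> S}) ` (verts G - S)"


subsection \<open>Width parameters\<close>

text \<open>
  All sequences are indexed by \<open>1, \<dots>, m\<close>. On natural numbers \<open>Sup\<close> of a finite set is its maximum,
  with \<open>Sup {} = 0\<close> (this occurs for one-vertex graphs and \<open>m = 1\<close>), and \<open>Inf\<close> of a
  nonempty set is its minimum. A graph without vertices has no partition chain, because \<open>{{}}\<close> is
  not a partition; the values of the parameters on it are irrelevant below.
\<close>

definition homogeneous_mod :: "'a graph \<Rightarrow> 'a set set \<Rightarrow> 'a set set \<Rightarrow> bool" where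
  "homogeneous_mod G P R \<longleftrightarrow>
     (\<forall>X\<in>P. \<forall>Y\<in>P.
        (\<forall>x\<in>X. \<forall>y\<in>Y. x \<noteq> y \<and> {x, y} \<notin> R \<longrightarrow> {x, y} \<in> edges G) \<or>
        (\<forall>x\<in>X. \<forall>y\<in>Y. x \<noteq> y \<and> {x, y} \<notin> R \<longrightarrow> {x, y} \<notin> edges G))"

definition merge_sequence ::
    "'a graph \<Rightarrow> nat \<Rightarrow> (nat \<Rightarrow> 'a set set) \<Rightarrow> (nat \<Rightarrow> 'a set set) \<Rightarrow> bool" where
  "merge_sequence G m P R \<longleftrightarrow>
     partition_chain (verts G) m P \<and>
     (\<forall>t\<in>{1..m}. R t \<subseteq> [verts G]\<^bsup>2\<^esup>) \<and>
     (\<forall>t\<in>{1..<m}. R t \<subseteq> R (t + 1)) \<and>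
     (\<forall>t\<in>{1..m}. homogeneous_mod G (P t) (R t))"

definition merge_sequence_width ::
    "nat \<Rightarrow> 'a graph \<Rightarrow> nat \<Rightarrow> (nat \<Rightarrow> 'a set set) \<Rightarrow> (nat \<Rightarrow> 'a set set) \<Rightarrow> nat" where
  "merge_sequence_width r G m P R =
     (SUP (t, v)\<in>{1..<m} \<times> verts G.
        card (parts_meeting (gball r \<lparr>verts = verts G, edges = R (t + 1)\<rparr> v) (P t)))"

definition mw :: "nat \<Rightarrow> 'a graph \<Rightarrow> nat" where
  "mw r G = Inf {merge_sequence_width r G m P R | m P R. merge_sequence G m P R}"

definition tmw :: "nat \<Rightarrow> 'a graph \<Rightarrow> nat" where
  "tmw r G = (LEAST k. \<exists>m P H.
     partition_chain (verts G) m P \<and>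
     (\<forall>i\<in>{1..m}. H i \<in> flips (P i) G) \<and>
     (\<forall>i\<in>{1..<m}. \<forall>v\<in>verts G. card (parts_meeting (gball r (H (i + 1)) v) (P i)) \<le> k))"

definition chain_width :: "nat \<Rightarrow> 'a graph \<Rightarrow> nat \<Rightarrow> (nat \<Rightarrow> 'a set set) \<Rightarrow> nat" where
  "chain_width r G m P =
     (SUP (i, v)\<in>{1..<m} \<times> verts G. card (parts_meeting (pball r G (P (i + 1)) v) (P i)))"

definition pmw :: "nat \<Rightarrow> 'a graph \<Rightarrow> nat" where
  "pmw r G = Inf {chain_width r G m P | m P. partition_chain (verts G) m P}"

text \<open>The list \<open>xs\<close> enumerates the vertices as \<open>v\<^sub>1 < \<dots> < v\<^sub>n\<close>.\<close>

definition order_partition :: "'a graph \<Rightarrow> 'a list \<Rightarrow> nat \<Rightarrow> 'a set set" where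
  "order_partition G xs i = nbhd_partition G (set (take (length xs - i) xs))"

definition order_width :: "nat \<Rightarrow> 'a graph \<Rightarrow> 'a list \<Rightarrow> nat" where
  "order_width r G xs =
     (SUP (i, v)\<in>{1..length xs} \<times> verts G.
        card (parts_meeting (pball r G (order_partition G xs i) v) (order_partition G xs i)))"

definition dmw :: "nat \<Rightarrow> 'a graph \<Rightarrow> nat" where
  "dmw r G = Inf {order_width r G xs | xs. distinct xs \<and> set xs = verts G}"

definition almost_bounded :: "(nat \<Rightarrow> 'a graph \<Rightarrow> nat) \<Rightarrow> 'a graph set \<Rightarrow> bool" where
  "almost_bounded width C \<longleftrightarrow>
     (\<forall>r. \<forall>\<epsilon>::real. \<epsilon> > 0 \<longrightarrow> (\<exists>n\<^sub>0. \<forall>G\<in>C. card (verts G) \<ge> n\<^sub>0 \<longrightarrow>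
        real (width r G) \<le> real (card (verts G)) powr \<epsilon>))"

end

theory Submission
  imports Defs
begin

text \<open>
  Choosing flips gives \<open>pmw \<le> tmw \<le> mw\<close>, and adding one vertex to a set splits each class of its
  neighbourhood partition into at most three, so \<open>pmw \<le> 3 dmw\<close>. For the converses the class has to
  have bounded VC dimension: otherwise, by heredity, it contains the inner product graphs over the
  two-element field (up to edges inside the two sides), whose partition merge-width is polynomial.
  By the Sauer--Shelah lemma, the number of traces of neighbourhoods on a set of \<open>k\<close> vertices is then
  polynomial in \<open>k\<close>.

  From a chain of partitions one obtains a merge sequence by refining every partition by the
  adjacencies to one representative of each part, and resolving the pairs at flip distance at most 3.
  From a merge sequence one obtains a vertex order by listing the vertices so that every partition
  has up to three far apart representatives of each part as an initial segment. The
  neighbourhood partition of such a segment is almost homogeneous modulo the short pairs: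
  exceptional pairs of classes live near two vertices only, so balls in a suitable flip are covered
  by few balls of the merge sequence.
\<close>


section \<open>Distances\<close>

text \<open>The implications proved are (1) to (2) to (3) to (1) and (1) to (4) to (3). Each is a
  polynomial bound in the other parameter at a possibly larger radius; both losses are harmless,
  since almost boundedness concerns every radius and every exponent. The obstacle in (3) to (1) and
  (1) to (4) is that refining by adjacency to \<open>k\<close> nearby representatives can create
  \<open>2 ^ k\<close> classes; bounded VC dimension replaces this by \<open>(k + 1) ^ d\<close>.
  Counting stays local because a representative that distinguishes two vertices of one part inside a
  ball lies in a slightly larger ball. The representatives have to be nested along the chain: for
  (1) the refined partitions must still coarsen, for (4) one vertex order must serve all steps.
  Inner product graphs are suitable because two vertices on one side differ on exactly half of the
  other side, while any two large sets, one on each side, contain a pattern that forces short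
  distances in every flip. Only pairs across the two sides enter that argument, so the edges inside
  the sides may be arbitrary.\<close>

lemma gdist_le_iff: "gdist G x y \<le> enat r \<longleftrightarrow> (\<exists>k\<le>r. (x, y) \<in> adj G ^^ k)"
proof
  assume le: "gdist G x y \<le> enat r"
  let ?D = "{enat k | k. (x, y) \<in> adj G ^^ k}"
  have "?D \<noteq> {}"
  proof
    assume "?D = {}"
    then have "gdist G x y = \<infinity>"
      unfolding gdist_def by (simp only: Inf_enat_def simp_thms if_True)
    then show False using le by simp
  qed
  then have "Inf ?D \<in> ?D"
    unfolding Inf_enat_def by (metis (no_types, lifting) LeastI_ex all_not_in_conv)
  then obtain k where "gdist G x y = enat k" "(x, y) \<in> adj G ^^ k"
    unfolding gdist_def by auto
  then show "\<exists>k\<le>r. (x, y) \<in> adj G ^^ k"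
    using le by auto
next
  assume "\<exists>k\<le>r. (x, y) \<in> adj G ^^ k"
  then obtain k where k: "k \<le> r" "(x, y) \<in> adj G ^^ k" by blast
  then have "gdist G x y \<le> enat k"
    unfolding gdist_def by (auto intro!: Inf_lower)
  then show "gdist G x y \<le> enat r"
    using k(1) by (metis enat_ord_simps(1) order_trans)
qed

lemma gdist_self [simp]: "gdist G x x = 0"
  using gdist_le_iff[of G x x 0] by (auto simp: zero_enat_def[symmetric])

lemma sym_adj: "sym (adj G)"
  by (auto simp: sym_def adj_def insert_commute)

lemma gdist_commute: "gdist G x y = gdist G y x"
proof -
  have "(x, y) \<in> adj G ^^ k \<Longrightarrow> (y, x) \<in> adj G ^^ k" for k x y
  proof (induction k arbitrary: x y)
    case (Suc k)
    then obtain z where "(x, z) \<in> adj G ^^ k" "(z, y) \<in> adj G"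
      by auto
    then show ?case
      using Suc.IH sym_adj by (metis relpow_Suc_I2 symD)
  qed auto
  then have "(x, y) \<in> adj G ^^ k \<longleftrightarrow> (y, x) \<in> adj G ^^ k" for k
    by blast
  then show ?thesis
    unfolding gdist_def by presburger
qed

lemma gdist_triangle_le:
  assumes "gdist G x y \<le> enat a" "gdist G y z \<le> enat b"
  shows "gdist G x z \<le> enat (a + b)"
proof -
  obtain k l where "k \<le> a" "(x, y) \<in> adj G ^^ k" "l \<le> b" "(y, z) \<in> adj G ^^ l"
    using assms unfolding gdist_le_iff by blast
  then have "k + l \<le> a + b" "(x, z) \<in> adj G ^^ (k + l)"
    by (auto simp: relpow_add)
  then show ?thesis
    unfolding gdist_le_iff by blast
qed

lemma gdist_mono_edges:
  assumes "edges G \<subseteq> edges H" "gdist G x y \<le> enat r"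
  shows "gdist H x y \<le> enat r"
proof -
  have "adj G \<subseteq> adj H"
    using assms(1) by (auto simp: adj_def)
  then have "(x, y) \<in> adj G ^^ k \<Longrightarrow> (x, y) \<in> adj H ^^ k" for k y
    by (induction k arbitrary: y) auto
  then show ?thesis
    using assms(2) unfolding gdist_le_iff by blast
qed

lemma gdist_edge: "{x, y} \<in> edges G \<Longrightarrow> gdist G x y \<le> enat 1"
  unfolding gdist_le_iff by (intro exI[of _ 1]) (auto simp: adj_def)

lemma gdist_mono_radius: "gdist G x y \<le> enat a \<Longrightarrow> a \<le> b \<Longrightarrow> gdist G x y \<le> enat b"
  by (meson enat_ord_simps(1) order_trans)

lemma gball_mono:
  "edges G \<subseteq> edges H \<Longrightarrow> verts G = verts H \<Longrightarrow> a \<le> b \<Longrightarrow> gball a G v \<subseteq> gball b H v"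
  unfolding gball_def by (auto intro: gdist_mono_radius[OF gdist_mono_edges])

section \<open>Flips\<close>

lemma partition_on_unique:
  "partition_on V P \<Longrightarrow> A \<in> P \<Longrightarrow> B \<in> P \<Longrightarrow> x \<in> A \<Longrightarrow> x \<in> B \<Longrightarrow> A = B"
  unfolding partition_on_def disjoint_def by blast

lemma partition_on_obtain:
  assumes "partition_on V P" "x \<in> V" obtains A where "A \<in> P" "x \<in> A"
  using assms unfolding partition_on_def by blast

lemma verts_flip [simp]: "verts (flip F G) = verts G"
  by (simp add: flip_def)

lemma edges_flip_iff:
  assumes P: "partition_on (verts G) P" and F: "F \<subseteq> P \<times> P"
    and "A \<in> P" "B \<in> P" "x \<in> A" "y \<in> B" "x \<noteq> y"
  shows "{x, y} \<in> edges (flip F G) \<longleftrightarrow> ({x, y} \<in> edges G) \<noteq> ((A, B) \<in> F \<or> (B, A) \<in> F)"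
proof -
  have V: "x \<in> verts G" "y \<in> verts G"
    using assms unfolding partition_on_def by auto
  have "(\<exists>(X, Y)\<in>F. \<exists>u\<in>X. \<exists>w\<in>Y. {x, y} = {u, w}) \<longleftrightarrow> (A, B) \<in> F \<or> (B, A) \<in> F" (is "?L \<longleftrightarrow> ?R")
  proof
    assume ?L
    then obtain X Y u w where "(X, Y) \<in> F" "u \<in> X" "w \<in> Y" "{x, y} = {u, w}" by blast
    moreover from this F have "X \<in> P" "Y \<in> P" by auto
    ultimately show ?R
      using assms partition_on_unique[OF P] by (metis doubleton_eq_iff)
  next
    assume ?R
    then show ?L using assms by (auto simp: insert_commute)
  qed
  then show ?thesis
    using V \<open>x \<noteq> y\<close> by (simp add: flip_def del: bex_simps ball_simps) 
qed

lemma edges_flip_subset: "edges (flip F G) \<subseteq> [verts G]\<^bsup>2\<^esup>"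
  by (auto simp: flip_def)

text \<open>A chosen pair of coarse parts is replaced by all pairs of fine parts inside it. Hence a
  finer partition has more flips, larger flip distances and smaller balls.\<close>

lemma flips_antimono:
  assumes "refines (verts G) P P'"
  shows "flips P' G \<subseteq> flips P G"
proof
  fix H assume "H \<in> flips P' G"
  then obtain F where F: "H = flip F G" "F \<subseteq> P' \<times> P'" by (auto simp: flips_def)
  define F0 where "F0 = {(A, B) \<in> P \<times> P. \<exists>(X, Y) \<in> F. A \<subseteq> X \<and> B \<subseteq> Y}"
  have F0_sub: "F0 \<subseteq> P \<times> P"
    by (auto simp: F0_def)
  have P: "partition_on (verts G) P" and P': "partition_on (verts G) P'"
    using assms by (auto simp: refines_def)
  have "e \<in> edges (flip F0 G) \<longleftrightarrow> e \<in> edges (flip F G)" for e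
  proof (cases "e \<in> [verts G]\<^bsup>2\<^esup>")
    case True
    then obtain x y where e: "e = {x, y}" "x \<in> verts G" "y \<in> verts G" "x \<noteq> y"
      by (metis doubleton_in_nsets_2 nsets2_E)
    obtain A B where A: "A \<in> P" "x \<in> A" "B \<in> P" "y \<in> B"
      using e P by (meson partition_on_obtain)
    then obtain X Y where X: "X \<in> P'" "A \<subseteq> X" "Y \<in> P'" "B \<subseteq> Y"
      using assms unfolding refines_def by metis
    \<comment> \<open>Stated for arbitrary parts because a pair of parts is unordered and both
      orders are needed below.\<close>
    have *: "(A, B) \<in> F0 \<longleftrightarrow> (X, Y) \<in> F"
      if "A \<in> P" "B \<in> P" "x \<in> A" "y \<in> B" "A \<subseteq> X" "B \<subseteq> Y" "X \<in> P'" "Y \<in> P'" for A B X Y x y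
    proof
      assume "(A, B) \<in> F0"
      then obtain X' Y' where X': "(X', Y') \<in> F" "A \<subseteq> X'" "B \<subseteq> Y'"
        by (auto simp: F0_def)
      moreover from this F(2) have "X' \<in> P'" "Y' \<in> P'" by auto
      ultimately have "X = X'" "Y = Y'"
        using that partition_on_unique[OF P'] by (meson subsetD)+
      then show "(X, Y) \<in> F" using X' by simp
    qed (use that in \<open>auto simp: F0_def\<close>)
    have "(A, B) \<in> F0 \<longleftrightarrow> (X, Y) \<in> F" "(B, A) \<in> F0 \<longleftrightarrow> (Y, X) \<in> F"
      using A X *[of A B x y X Y] *[of B A y x Y X] by auto
    then show ?thesis
      using edges_flip_iff[OF P, of F0 A B x y] edges_flip_iff[OF P' F(2), of X Y x y] A X e
      by (auto simp: F0_def subset_iff)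
  next
    case False
    then show ?thesis
      using edges_flip_subset by blast
  qed
  then have "flip F0 G = H"
    unfolding F(1) by (auto simp: flip_def)
  then show "H \<in> flips P G"
    unfolding flips_def using F0_sub by blast
qed

section \<open>Flip distances and their balls\<close>

lemma pdist_le_iff: "pdist G P x y \<le> c \<longleftrightarrow> (\<forall>F. F \<subseteq> P \<times> P \<longrightarrow> gdist (flip F G) x y \<le> c)"
  unfolding pdist_def flips_def by (auto simp: SUP_le_iff)

lemma pdist_self [simp]: "pdist G P x x = 0"
  using pdist_le_iff[of G P x x 0] by simp

lemma pdist_commute: "pdist G P x y = pdist G P y x"
  unfolding pdist_def by (simp add: gdist_commute)

lemma pdist_triangle_le:
  assumes "pdist G P x y \<le> enat a" "pdist G P y z \<le> enat b"
  shows "pdist G P x z \<le> enat (a + b)"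
  unfolding pdist_le_iff
proof (intro allI impI)
  fix F assume "F \<subseteq> P \<times> P"
  then show "gdist (flip F G) x z \<le> enat (a + b)"
    using assms by (intro gdist_triangle_le[of _ x y]) (auto simp: pdist_le_iff)
qed

lemma pdist_mono_radius: "pdist G P x y \<le> enat a \<Longrightarrow> a \<le> b \<Longrightarrow> pdist G P x y \<le> enat b"
  by (meson enat_ord_simps(1) order_trans)

lemma pdist_antimono:
  "refines (verts G) P P' \<Longrightarrow> pdist G P' x y \<le> pdist G P x y"
  unfolding pdist_def by (intro SUP_subset_mono flips_antimono) auto

lemma pball_antimono:
  "refines (verts G) P P' \<Longrightarrow> pball r G P v \<subseteq> pball r G P' v"
  unfolding pball_def by (auto intro: order_trans[OF pdist_antimono])

section \<open>Partitions given by labellings\<close>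

text \<open>Partitions are handled as kernels of labellings, so that the parts met by a set are
  counted as the values of the labelling on it.\<close>

definition fibers :: "('a \<Rightarrow> 'b) \<Rightarrow> 'a set \<Rightarrow> 'a set set" where
  "fibers f V = (\<lambda>x. {y \<in> V. f y = f x}) ` V"

lemma partition_on_fibers: "partition_on V (fibers f V)"
  by (rule partition_onI) (auto simp: fibers_def disjnt_def)

lemma refines_fibers:
  assumes "\<And>x y. x \<in> V \<Longrightarrow> y \<in> V \<Longrightarrow> f x = f y \<Longrightarrow> g x = g y"
  shows "refines V (fibers f V) (fibers g V)"
  unfolding refines_def
proof (intro conjI ballI partition_on_fibers)
  fix A assume "A \<in> fibers f V"
  then obtain x where x: "x \<in> V" "A = {y \<in> V. f y = f x}"
    by (auto simp: fibers_def)
  have "A \<subseteq> {y \<in> V. g y = g x}"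
    using x assms by blast
  then show "\<exists>B\<in>fibers g V. A \<subseteq> B"
    using x(1) by (auto simp: fibers_def)
qed

lemma fibers_const: "V \<noteq> {} \<Longrightarrow> fibers (\<lambda>x. c) V = {V}"
  by (simp add: fibers_def image_constant_conv)

lemma fibers_inj: "inj_on f V \<Longrightarrow> fibers f V = (\<lambda>x. {x}) ` V"
  unfolding fibers_def by (intro image_cong) (auto dest: inj_onD)

lemma same_fiber:
  "A \<in> fibers f V \<Longrightarrow> x \<in> A \<Longrightarrow> y \<in> A \<Longrightarrow> x \<in> V \<and> y \<in> V \<and> f x = f y"
  by (auto simp: fibers_def)

lemma card_parts_meeting_fibers:
  assumes "W \<subseteq> V"
  shows "card (parts_meeting W (fibers f V)) = card (f ` W)"
proof -
  have "parts_meeting W (fibers f V) = (\<lambda>c. {y \<in> V. f y = c}) ` f ` W"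
  proof (intro equalityI subsetI)
    fix A assume "A \<in> parts_meeting W (fibers f V)"
    then obtain x w where "A = {y \<in> V. f y = f x}" "w \<in> A" "w \<in> W"
      by (auto simp: parts_meeting_def fibers_def)
    then show "A \<in> (\<lambda>c. {y \<in> V. f y = c}) ` f ` W"
      by (auto simp: image_image intro!: image_eqI[of _ _ w])
  next
    fix A assume "A \<in> (\<lambda>c. {y \<in> V. f y = c}) ` f ` W"
    then obtain w where "A = {y \<in> V. f y = f w}" "w \<in> W" by blast
    then show "A \<in> parts_meeting W (fibers f V)"
      using assms by (auto simp: parts_meeting_def fibers_def)
  qed
  moreover have "inj_on (\<lambda>c. {y \<in> V. f y = c}) (f ` W)"
    using assms by (intro inj_onI) blast
  ultimately show ?thesis
    by (simp add: card_image)
qed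

text \<open>For a vertex this is the singleton of its part; taking the set of parts avoids a choice
  operator.\<close>

definition part_label :: "'a set set \<Rightarrow> 'a \<Rightarrow> 'a set set" where
  "part_label P x = {A \<in> P. x \<in> A}"

lemma part_label_eq_iff:
  assumes "partition_on V P" "x \<in> V"
  shows "part_label P x = part_label P y \<longleftrightarrow> (\<exists>A\<in>P. x \<in> A \<and> y \<in> A)"
proof
  assume "part_label P x = part_label P y"
  then show "\<exists>A\<in>P. x \<in> A \<and> y \<in> A"
    using assms partition_on_obtain unfolding part_label_def by (metis (mono_tags, lifting) mem_Collect_eq)
next
  assume "\<exists>A\<in>P. x \<in> A \<and> y \<in> A"
  then show "part_label P x = part_label P y"
    using partition_on_unique[OF assms(1)] unfolding part_label_def by blast
qed

lemma fibers_part_label: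
  assumes "partition_on V P" shows "fibers (part_label P) V = P"
proof -
  have "{y \<in> V. part_label P y = part_label P x} = A" if "A \<in> P" "x \<in> A" for x A
  proof -
    have "y \<in> V \<and> part_label P y = part_label P x \<longleftrightarrow> y \<in> A" for y
      using that assms part_label_eq_iff[OF assms, of y x] partition_on_unique[OF assms]
      by (metis UnionI partition_onD1)
    then show ?thesis by blast
  qed
  moreover have "A \<noteq> {}" if "A \<in> P" for A
    using that assms partition_onD3 by blast
  ultimately show ?thesis
    unfolding fibers_def using assms
    by (auto simp: image_iff dest!: partition_onD1) (metis UnionI all_not_in_conv)+
qed

lemma card_parts_meeting:
  "partition_on V P \<Longrightarrow> W \<subseteq> V \<Longrightarrow> card (parts_meeting W P) = card (part_label P ` W)"
  using card_parts_meeting_fibers[of W V "part_label P"] by (simp add: fibers_part_label)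

lemma finite_parts_meeting: "finite V \<Longrightarrow> partition_on V P \<Longrightarrow> finite (parts_meeting W P)"
  by (rule finite_subset[of _ P]) (auto simp: parts_meeting_def intro: finite_elements)

lemma card_parts_meeting_mono:
  "finite V \<Longrightarrow> partition_on V P \<Longrightarrow> W \<subseteq> W' \<Longrightarrow> card (parts_meeting W P) \<le> card (parts_meeting W' P)"
  by (rule card_mono[OF finite_parts_meeting]) (auto simp: parts_meeting_def)

lemma refines_part_label:
  assumes "refines V P P'" "x \<in> V" "part_label P x = part_label P y"
  shows "part_label P' x = part_label P' y"
  using assms part_label_eq_iff[of V P x y] part_label_eq_iff[of V P' x y] unfolding refines_def
  by (metis subsetD)

text \<open>The tool behind all comparisons of class counts: one representative for each value of
  \<open>f\<close> recovers every value of \<open>g\<close>.\<close>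

lemma card_image_le_factor:
  assumes "finite W" "\<And>x y. x \<in> W \<Longrightarrow> y \<in> W \<Longrightarrow> f x = f y \<Longrightarrow> g x = g y"
  shows "card (g ` W) \<le> card (f ` W)"
proof -
  have "g ` W = (\<lambda>c. g (SOME x. x \<in> W \<and> f x = c)) ` f ` W"
    unfolding image_image
    by (intro image_cong refl) (rule assms(2), (metis (mono_tags, lifting) someI_ex)+)
  then show ?thesis
    using assms(1) by (metis card_image_le finite_imageI)
qed

section \<open>Neighbourhood partitions\<close>

definition nbhd_label :: "'a graph \<Rightarrow> 'a set \<Rightarrow> 'a \<Rightarrow> 'a + 'a set" where
  "nbhd_label G S x = (if x \<in> S then Inl x else Inr (nbhd G x \<inter> S))"

lemma nbhd_partition_fibers:
  assumes "S \<subseteq> verts G"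
  shows "nbhd_partition G S = fibers (nbhd_label G S) (verts G)"
proof -
  have 1: "(\<lambda>s. {s}) ` S = (\<lambda>x. {y \<in> verts G. nbhd_label G S y = nbhd_label G S x}) ` S"
    using assms by (intro image_cong) (auto simp: nbhd_label_def split: if_splits)
  have 2: "(\<lambda>u. {v \<in> verts G - S. nbhd G v \<inter> S = nbhd G u \<inter> S}) ` (verts G - S) =
     (\<lambda>x. {y \<in> verts G. nbhd_label G S y = nbhd_label G S x}) ` (verts G - S)"
    using assms by (intro image_cong) (auto simp: nbhd_label_def split: if_splits)
  have "verts G = S \<union> (verts G - S)"
    using assms by blast
  then show ?thesis
    unfolding nbhd_partition_def fibers_def 1 2 by (metis image_Un)
qed

lemma nbhd_label_mono:
  "S \<subseteq> S' \<Longrightarrow> nbhd_label G S' x = nbhd_label G S' y \<Longrightarrow> nbhd_label G S x = nbhd_label G S y"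
  unfolding nbhd_label_def by (auto split: if_splits)

lemma partition_on_nbhd_partition: "S \<subseteq> verts G \<Longrightarrow> partition_on (verts G) (nbhd_partition G S)"
  by (simp add: nbhd_partition_fibers partition_on_fibers)

lemma refines_nbhd_partition:
  assumes "S \<subseteq> S'" "S' \<subseteq> verts G"
  shows "refines (verts G) (nbhd_partition G S') (nbhd_partition G S)"
  using assms by (auto simp: nbhd_partition_fibers intro!: refines_fibers intro: nbhd_label_mono)

section \<open>Comparing the width parameters\<close>

text \<open>Any radius \<open>r'\<close> and any polynomial are allowed, since the hypothesis on
  \<open>g\<close> covers all radii and all exponents. The empty graph is avoided by a threshold of
  at least 1.\<close>

lemma almost_bounded_transfer:
  assumes g: "almost_bounded g C"
    and le: "\<And>r. \<exists>r' c e. \<forall>G\<in>C. verts G \<noteq> {} \<longrightarrow> f r G \<le> c * (1 + g r' G) ^ e"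
  shows "almost_bounded f C"
  unfolding almost_bounded_def
proof (intro allI impI)
  fix r and \<epsilon> :: real assume eps: "\<epsilon> > 0"
  obtain r' c e where bound: "\<And>G. G \<in> C \<Longrightarrow> verts G \<noteq> {} \<Longrightarrow> f r G \<le> c * (1 + g r' G) ^ e"
    using le by meson
  \<comment> \<open>Half of the exponent is spent on the constant and half on the power;
    \<open>e + 1\<close> avoids a division by zero.\<close>
  define \<delta> where "\<delta> = \<epsilon> / (2 * (real e + 1))"
  have delta: "\<delta> > 0" "\<delta> * real e \<le> \<epsilon> / 2"
    using eps by (auto simp: \<delta>_def field_simps)
  obtain n0 where n0: "\<And>G. G \<in> C \<Longrightarrow> card (verts G) \<ge> n0 \<Longrightarrow> real (g r' G) \<le> real (card (verts G)) powr \<delta>"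
    using g delta(1) unfolding almost_bounded_def by meson
  \<comment> \<open>From here on \<open>n powr (\<epsilon> / 2)\<close> is at least
    \<open>c * 2 ^ e\<close>, where \<open>2 ^ e\<close> comes from
    \<open>1 + g \<le> 2 * n powr \<delta>\<close>.\<close>
  define n1 where "n1 = nat \<lceil>(real c * 2 ^ e) powr (2 / \<epsilon>)\<rceil>"
  have "real (f r G) \<le> real (card (verts G)) powr \<epsilon>"
    if G: "G \<in> C" "card (verts G) \<ge> max 1 (max n0 n1)" for G
  proof -
    define n where "n = real (card (verts G))"
    have n: "n \<ge> 1" and ne: "verts G \<noteq> {}"
      using G(2) by (auto simp: n_def)
    have "real c * 2 ^ e = ((real c * 2 ^ e) powr (2 / \<epsilon>)) powr (\<epsilon> / 2)"
      using eps by (simp add: powr_powr)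
    also have "\<dots> \<le> n powr (\<epsilon> / 2)"
      using G(2) eps unfolding n_def n1_def
      by (intro powr_mono2) (auto simp: le_nat_iff nat_le_iff ceiling_le_iff)
    finally have c: "real c * 2 ^ e \<le> n powr (\<epsilon> / 2)" .
    have "1 + real (g r' G) \<le> 2 * n powr \<delta>"
      using n0[OF G(1)] G(2) n delta(1) ge_one_powr_ge_zero[of n \<delta>] by (auto simp: n_def)
    then have "(1 + real (g r' G)) ^ e \<le> (2 * n powr \<delta>) ^ e"
      by (intro power_mono) auto
    also have "\<dots> = 2 ^ e * n powr (\<delta> * real e)"
      using n by (simp add: power_mult_distrib powr_powr[symmetric] powr_realpow)
    also have "\<dots> \<le> 2 ^ e * n powr (\<epsilon> / 2)"
      using n delta(2) by (intro mult_left_mono powr_mono) auto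
    finally have e: "(1 + real (g r' G)) ^ e \<le> 2 ^ e * n powr (\<epsilon> / 2)" .
    have "real (f r G) \<le> real (c * (1 + g r' G) ^ e)"
      using bound[OF G(1) ne] of_nat_le_iff by blast
    also have "\<dots> = real c * (1 + real (g r' G)) ^ e"
      by simp
    also have "\<dots> \<le> real c * (2 ^ e * n powr (\<epsilon> / 2))"
      using e by (intro mult_left_mono) auto
    also have "\<dots> \<le> n powr (\<epsilon> / 2) * n powr (\<epsilon> / 2)"
      using mult_right_mono[OF c, of "n powr (\<epsilon> / 2)"] by (simp add: mult.assoc)
    also have "\<dots> = n powr \<epsilon>"
      by (simp add: powr_add[symmetric])
    finally show ?thesis
      unfolding n_def .
  qed
  then show "\<exists>n\<^sub>0. \<forall>G\<in>C. n\<^sub>0 \<le> card (verts G) \<longrightarrow> real (f r G) \<le> real (card (verts G)) powr \<epsilon>"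
    by blast
qed

section \<open>The parameters as attained minima\<close>

lemma nat_Sup_le: "(\<And>x. x \<in> X \<Longrightarrow> x \<le> k) \<Longrightarrow> Sup X \<le> (k::nat)"
  by (cases "X = {}") (simp_all add: cSup_least)

lemma chain_width_le:
  assumes "\<And>i v. i \<in> {1..<m} \<Longrightarrow> v \<in> verts G \<Longrightarrow> card (parts_meeting (pball r G (P (i + 1)) v) (P i)) \<le> k"
  shows "chain_width r G m P \<le> k"
  unfolding chain_width_def by (rule nat_Sup_le) (use assms in auto)

lemma chain_width_ge:
  assumes "finite (verts G)" "i \<in> {1..<m}" "v \<in> verts G"
  shows "card (parts_meeting (pball r G (P (i + 1)) v) (P i)) \<le> chain_width r G m P"
  unfolding chain_width_def using assms by (intro le_cSup_finite) (auto intro!: image_eqI[of _ _ "(i, v)"])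

lemma merge_sequence_width_le:
  assumes "\<And>t v. t \<in> {1..<m} \<Longrightarrow> v \<in> verts G \<Longrightarrow>
    card (parts_meeting (gball r \<lparr>verts = verts G, edges = R (t + 1)\<rparr> v) (P t)) \<le> k"
  shows "merge_sequence_width r G m P R \<le> k"
  unfolding merge_sequence_width_def by (rule nat_Sup_le) (use assms in auto)

lemma merge_sequence_width_ge:
  assumes "finite (verts G)" "t \<in> {1..<m}" "v \<in> verts G"
  shows "card (parts_meeting (gball r \<lparr>verts = verts G, edges = R (t + 1)\<rparr> v) (P t))
    \<le> merge_sequence_width r G m P R"
  unfolding merge_sequence_width_def using assms
  by (intro le_cSup_finite) (auto intro!: image_eqI[of _ _ "(t, v)"])

lemma pmw_le: "partition_chain (verts G) m P \<Longrightarrow> pmw r G \<le> chain_width r G m P"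
  unfolding pmw_def Inf_nat_def by (rule Least_le) blast

lemma mw_le: "merge_sequence G m P R \<Longrightarrow> mw r G \<le> merge_sequence_width r G m P R"
  unfolding mw_def Inf_nat_def by (rule Least_le) blast

lemma dmw_le: "distinct xs \<Longrightarrow> set xs = verts G \<Longrightarrow> dmw r G \<le> order_width r G xs"
  unfolding dmw_def Inf_nat_def by (rule Least_le) blast

text \<open>Witnesses that the infima and least elements defining the parameters range over nonempty
  sets.\<close>

definition two_step_chain :: "'a set \<Rightarrow> nat \<Rightarrow> 'a set set" where
  "two_step_chain V t = (if t = 1 then (\<lambda>v. {v}) ` V else {V})"

lemma partition_chain_two_step:
  assumes "V \<noteq> {}" shows "partition_chain V 2 (two_step_chain V)"
proof -
  have "{1..2} = {1, 2 :: nat}" "{1..<2} = {1 :: nat}"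
    by auto
  then show ?thesis
    using assms partition_on_singletons[of V] partition_on_space[OF assms]
    by (auto simp: partition_chain_def two_step_chain_def refines_def)
qed

lemma pmw_attained:
  assumes "verts G \<noteq> {}"
  obtains m P where "partition_chain (verts G) m P" "pmw r G = chain_width r G m P"
proof -
  have "pmw r G \<in> {chain_width r G m P | m P. partition_chain (verts G) m P}"
    unfolding pmw_def using partition_chain_two_step[OF assms] by (intro Inf_nat_def1) blast
  then show ?thesis
    using that by blast
qed

lemma mw_attained:
  assumes "verts G \<noteq> {}"
  obtains m P R where "merge_sequence G m P R" "mw r G = merge_sequence_width r G m P R"
proof -
  \<comment> \<open>With all pairs in \<open>R\<close>, homogeneity is vacuous.\<close>
  have "merge_sequence G 2 (two_step_chain (verts G)) (\<lambda>_. [verts G]\<^bsup>2\<^esup>)"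
    unfolding merge_sequence_def
  proof (intro conjI partition_chain_two_step[OF assms] ballI)
    fix t :: nat
    have "X \<subseteq> verts G" if "X \<in> two_step_chain (verts G) t" for X
      using that by (auto simp: two_step_chain_def split: if_splits)
    then show "homogeneous_mod G (two_step_chain (verts G) t) ([verts G]\<^bsup>2\<^esup>)"
      unfolding homogeneous_mod_def doubleton_in_nsets_2 by blast
  qed auto
  then have "mw r G \<in> {merge_sequence_width r G m P R | m P R. merge_sequence G m P R}"
    unfolding mw_def by (intro Inf_nat_def1) blast
  then show ?thesis
    using that by blast
qed

lemma dmw_attained:
  assumes "finite (verts G)"
  obtains xs where "distinct xs" "set xs = verts G" "dmw r G = order_width r G xs"
proof -
  have "dmw r G \<in> {order_width r G xs | xs. distinct xs \<and> set xs = verts G}"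
    unfolding dmw_def using finite_distinct_list[OF assms] by (intro Inf_nat_def1) blast
  then show ?thesis
    using that by blast
qed

section \<open>Inequalities valid in every nonempty finite graph\<close>

lemma simple_graph_edgeD: "simple_graph G \<Longrightarrow> {x, y} \<in> edges G \<Longrightarrow> x \<noteq> y \<and> x \<in> verts G \<and> y \<in> verts G"
  unfolding simple_graph_def by (metis doubleton_in_nsets_2 subsetD)

text \<open>Complement exactly the pairs of parts that contain an edge outside \<open>R\<close>. By
  homogeneity all their pairs outside \<open>R\<close> are edges and disappear, while the remaining
  pairs of parts have no edge outside \<open>R\<close>.\<close>

lemma homogeneous_flip_subset:
  assumes P: "partition_on (verts G) P" and hom: "homogeneous_mod G P R"
  obtains F where "F \<subseteq> P \<times> P" "edges (flip F G) \<subseteq> R"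
proof -
  define F where "F = {(X, Y) \<in> P \<times> P. \<exists>x\<in>X. \<exists>y\<in>Y. x \<noteq> y \<and> {x, y} \<notin> R \<and> {x, y} \<in> edges G}"
  have F: "F \<subseteq> P \<times> P"
    by (auto simp: F_def)
  have "e \<in> R" if e: "e \<in> edges (flip F G)" for e
  proof (rule ccontr)
    assume eR: "e \<notin> R"
    obtain x y where xy: "e = {x, y}" "x \<in> verts G" "y \<in> verts G" "x \<noteq> y"
      using e edges_flip_subset by (metis doubleton_in_nsets_2 nsets2_E subsetD)
    obtain A B where A: "A \<in> P" "x \<in> A" "B \<in> P" "y \<in> B"
      using xy P by (meson partition_on_obtain)
    have iff: "e \<in> edges G \<longleftrightarrow> \<not> ((A, B) \<in> F \<or> (B, A) \<in> F)"
      using edges_flip_iff[OF P F, of A B x y] A xy e by simp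
    show False
    proof (cases "e \<in> edges G")
      case True
      then have "(A, B) \<in> F"
        using A xy eR unfolding F_def by blast
      then show False using iff True by blast
    next
      case False
      then obtain u w where "u \<in> A" "w \<in> B" "u \<noteq> w" "{u, w} \<notin> R" "{u, w} \<in> edges G"
      proof -
        consider "(A, B) \<in> F" | "(B, A) \<in> F"
          using iff False by blast
        then show ?thesis
        proof cases
          case 1
          then show ?thesis using that by (auto simp: F_def)
        next
          case 2
          then obtain w u where "w \<in> B" "u \<in> A" "w \<noteq> u" "{w, u} \<notin> R" "{w, u} \<in> edges G"
            by (auto simp: F_def)
          then show ?thesis using that[of u w] by (simp add: insert_commute)
        qed
      qed
      then show False
        using hom A xy eR False unfolding homogeneous_mod_def by blast
    qed
  qed
  then show ?thesis
    using that F by blast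
qed

lemma gball_subset_verts: "gball r G v \<subseteq> verts G"
  by (auto simp: gball_def)

lemma pball_subset_verts: "pball r G P v \<subseteq> verts G"
  by (auto simp: pball_def)

text \<open>The flip obtained from homogeneity has its edges inside \<open>R\<close>, so its balls
  are contained in those of \<open>R\<close>.\<close>

lemma tmw_le_mw:
  assumes fin: "finite (verts G)" and ne: "verts G \<noteq> {}"
  shows "tmw r G \<le> mw r G"
proof -
  obtain m P R where ms: "merge_sequence G m P R" and w: "mw r G = merge_sequence_width r G m P R"
    using mw_attained[OF ne] .
  have P: "partition_on (verts G) (P i)" "homogeneous_mod G (P i) (R i)" if "i \<in> {1..m}" for i
    using ms that by (auto simp: merge_sequence_def partition_chain_def)
  have "\<exists>F. F \<subseteq> P i \<times> P i \<and> edges (flip F G) \<subseteq> R i" if "i \<in> {1..m}" for i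
    using homogeneous_flip_subset[OF P[OF that]] by metis
  then obtain F where F: "\<And>i. i \<in> {1..m} \<Longrightarrow> F i \<subseteq> P i \<times> P i \<and> edges (flip (F i) G) \<subseteq> R i"
    by metis
  have "card (parts_meeting (gball r (flip (F (i + 1)) G) v) (P i)) \<le> mw r G"
    if "i \<in> {1..<m}" "v \<in> verts G" for i v
  proof -
    have "card (parts_meeting (gball r (flip (F (i + 1)) G) v) (P i))
        \<le> card (parts_meeting (gball r \<lparr>verts = verts G, edges = R (i + 1)\<rparr> v) (P i))"
      using F[of "i + 1"] that P(1)[of i]
      by (intro card_parts_meeting_mono[OF fin] gball_mono) auto
    also have "\<dots> \<le> mw r G"
      unfolding w using merge_sequence_width_ge[OF fin that] .
    finally show ?thesis .
  qed
  moreover have "flip (F i) G \<in> flips (P i) G" if "i \<in> {1..m}" for i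
    using F[OF that] by (auto simp: flips_def)
  moreover have "partition_chain (verts G) m P"
    using ms by (simp add: merge_sequence_def)
  ultimately show ?thesis
    unfolding tmw_def by (intro Least_le exI[of _ m] exI[of _ P] exI[of _ "\<lambda>i. flip (F i) G"]) auto
qed

text \<open>Flip distance is a maximum over all flips, so its balls lie in the balls of any single
  flip.\<close>

lemma pmw_le_tmw:
  assumes fin: "finite (verts G)" and ne: "verts G \<noteq> {}"
  shows "pmw r G \<le> tmw r G"
proof -
  let ?Q = "\<lambda>k. \<exists>m P H. partition_chain (verts G) m P \<and> (\<forall>i\<in>{1..m}. H i \<in> flips (P i) G) \<and>
     (\<forall>i\<in>{1..<m}. \<forall>v\<in>verts G. card (parts_meeting (gball r (H (i + 1)) v) (P i)) \<le> k)"
  let ?P = "two_step_chain (verts G)"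
  have "card (parts_meeting (gball r (flip {} G) v) (?P i)) \<le> card (?P 1)" if "i \<in> {1..<2}" for i v
  proof -
    have "i = 1" using that by simp
    then show ?thesis
      using fin by (auto simp: parts_meeting_def two_step_chain_def intro!: card_mono)
  qed
  \<comment> \<open>\<open>LEAST\<close> is informative only if some bound is achieved; the number
    of parts of the first partition is one.\<close>
  then have "?Q (card (?P 1))"
    using partition_chain_two_step[OF ne]
    by (intro exI[of _ 2] exI[of _ ?P] exI[of _ "\<lambda>_. flip {} G"]) (auto simp: flips_def)
  then have "?Q (tmw r G)"
    unfolding tmw_def by (rule LeastI)
  then obtain m P H where c: "partition_chain (verts G) m P" "\<And>i. i \<in> {1..m} \<Longrightarrow> H i \<in> flips (P i) G"
    and b: "\<And>i v. i \<in> {1..<m} \<Longrightarrow> v \<in> verts G \<Longrightarrow> card (parts_meeting (gball r (H (i + 1)) v) (P i)) \<le> tmw r G"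
    by blast
  have "card (parts_meeting (pball r G (P (i + 1)) v) (P i)) \<le> tmw r G"
    if "i \<in> {1..<m}" "v \<in> verts G" for i v
  proof -
    have H: "H (i + 1) \<in> flips (P (i + 1)) G"
      using c(2)[of "i + 1"] that by auto
    then have "verts (H (i + 1)) = verts G"
      by (auto simp: flips_def)
    moreover have "gdist (H (i + 1)) v u \<le> pdist G (P (i + 1)) v u" for u
      unfolding pdist_def using H by (rule SUP_upper)
    ultimately have "pball r G (P (i + 1)) v \<subseteq> gball r (H (i + 1)) v"
      by (auto simp: pball_def gball_def intro: order_trans)
    then have "card (parts_meeting (pball r G (P (i + 1)) v) (P i))
        \<le> card (parts_meeting (gball r (H (i + 1)) v) (P i))"
      using c(1) that by (intro card_parts_meeting_mono[OF fin]) (auto simp: partition_chain_def)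
    then show ?thesis
      using b[OF that] by simp
  qed
  then have "chain_width r G m P \<le> tmw r G"
    by (rule chain_width_le)
  then show ?thesis
    using pmw_le[OF c(1)] by (meson order_trans)
qed

lemma partition_chain_order_partition:
  assumes xs: "distinct xs" "set xs = verts G" and ne: "verts G \<noteq> {}"
  shows "partition_chain (verts G) (length xs) (order_partition G xs)"
proof -
  define n where "n = length xs"
  have n: "n \<ge> 1"
    using xs ne by (cases xs) (auto simp: n_def)
  have sub: "set (take k xs) \<subseteq> verts G" for k
    using xs set_take_subset by metis
  \<comment> \<open>Only the last vertex lies outside the defining set, so the labels still separate
    all vertices.\<close>
  have "inj_on (nbhd_label G (set (take (n - 1) xs))) (verts G)"
  proof (rule inj_onI)
    have xs': "xs = take (n - 1) xs @ [last xs]"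
      using n by (metis append_butlast_last_id butlast_conv_take length_0_conv n_def not_one_le_zero)
    fix x y
    assume "x \<in> verts G" "y \<in> verts G"
      and eq: "nbhd_label G (set (take (n - 1) xs)) x = nbhd_label G (set (take (n - 1) xs)) y"
    then have "x \<in> set (take (n - 1) xs) \<or> x = last xs" "y \<in> set (take (n - 1) xs) \<or> y = last xs"
      unfolding xs(2)[symmetric] by (metis xs' Un_iff empty_set insert_iff list.simps(15) set_append empty_iff)+
    then show "x = y"
      using eq by (auto simp: nbhd_label_def split: if_splits)
  qed
  then have 1: "order_partition G xs 1 = (\<lambda>v. {v}) ` verts G"
    unfolding order_partition_def using sub by (simp add: nbhd_partition_fibers fibers_inj n_def)
  \<comment> \<open>At the end of the chain the defining set is empty and all vertices have the same
    label.\<close>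
  have 2: "order_partition G xs n = {verts G}"
    using fibers_const[OF ne]
    by (simp add: order_partition_def n_def nbhd_partition_fibers nbhd_label_def[abs_def])
  show ?thesis
    unfolding partition_chain_def n_def[symmetric]
  proof (intro conjI ballI)
    fix t
    show "partition_on (verts G) (order_partition G xs t)"
      unfolding order_partition_def by (intro partition_on_nbhd_partition sub)
    show "refines (verts G) (order_partition G xs t) (order_partition G xs (t + 1))"
      unfolding order_partition_def by (intro refines_nbhd_partition set_take_subset_set_take sub) simp
  qed (use n 1 2 in auto)
qed

lemma card_nbhd_label_insert:
  assumes "finite W"
  shows "card (nbhd_label G (insert a S) ` W) \<le> 3 * card (nbhd_label G S ` W)"
proof -
  \<comment> \<open>\<open>a\<close> itself, its neighbours and all others: the three pieces into
    which a class can split.\<close>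
  define c :: "_ \<Rightarrow> nat" where "c x = (if x = a then 0 else if a \<in> nbhd G x then 1 else 2)" for x
  have c: "c x \<in> {0, 1, 2}" for x
    by (simp add: c_def)
  have "card (nbhd_label G (insert a S) ` W) \<le> card ((\<lambda>x. (c x, nbhd_label G S x)) ` W)"
    using assms by (rule card_image_le_factor) (auto simp: nbhd_label_def c_def split: if_splits)
  also have "\<dots> \<le> card ({0, 1, 2 :: nat} \<times> nbhd_label G S ` W)"
    using assms c by (intro card_mono finite_cartesian_product finite_imageI) blast+
  finally show ?thesis
    by (simp add: card_cartesian_product)
qed

text \<open>The order width measures distances and counts parts with the same partition. A chain
  counts the parts of the preceding partition, whose defining set has one vertex more; this costs
  the factor 3.\<close>

lemma pmw_le_dmw:
  assumes fin: "finite (verts G)" and ne: "verts G \<noteq> {}"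
  shows "pmw r G \<le> 3 * dmw r G"
proof -
  obtain xs where xs: "distinct xs" "set xs = verts G" and w: "dmw r G = order_width r G xs"
    using dmw_attained[OF fin] .
  have "card (parts_meeting (pball r G (order_partition G xs (i + 1)) v) (order_partition G xs i))
      \<le> 3 * dmw r G" if i: "i \<in> {1..<length xs}" and v: "v \<in> verts G" for i v
  proof -
    let ?W = "pball r G (order_partition G xs (i + 1)) v"
    define S where "S = set (take (length xs - (i + 1)) xs)"
    define a where "a = xs ! (length xs - (i + 1))"
    have "take (length xs - i) xs = take (length xs - (i + 1)) xs @ [a]"
      using i unfolding a_def
      by (subst take_Suc_conv_app_nth[symmetric]) (auto simp: Suc_diff_Suc)
    then have S': "set (take (length xs - i) xs) = insert a S"
      by (simp add: S_def)
    have sub: "S \<subseteq> verts G" "insert a S \<subseteq> verts G"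
      using xs set_take_subset unfolding S'[symmetric] unfolding S_def by metis+
    have W: "?W \<subseteq> verts G" "finite ?W"
      using finite_subset[OF pball_subset_verts fin] by (auto simp: pball_subset_verts)
    have "card (parts_meeting ?W (order_partition G xs i)) = card (nbhd_label G (insert a S) ` ?W)"
      unfolding order_partition_def S' nbhd_partition_fibers[OF sub(2)]
      using W by (intro card_parts_meeting_fibers) (simp add: order_partition_def)
    also have "\<dots> \<le> 3 * card (nbhd_label G S ` ?W)"
      using W by (intro card_nbhd_label_insert)
    also have "card (nbhd_label G S ` ?W) = card (parts_meeting ?W (order_partition G xs (i + 1)))"
      using W unfolding order_partition_def S_def[symmetric] nbhd_partition_fibers[OF sub(1)]
      by (intro card_parts_meeting_fibers[symmetric]) (simp add: order_partition_def)
    also have "\<dots> \<le> dmw r G"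
      unfolding w order_width_def using i v fin
      by (intro le_cSup_finite) (auto intro!: image_eqI[of _ _ "(i + 1, v)"])
    finally show ?thesis by simp
  qed
  then have "chain_width r G (length xs) (order_partition G xs) \<le> 3 * dmw r G"
    by (rule chain_width_le)
  then show ?thesis
    using pmw_le[OF partition_chain_order_partition[OF xs ne]] by (meson order_trans)
qed

section \<open>Shattered sets\<close>

definition shatters :: "'a set set \<Rightarrow> 'a set \<Rightarrow> bool" where
  "shatters F Z \<longleftrightarrow> (\<forall>W. W \<subseteq> Z \<longrightarrow> (\<exists>A\<in>F. A \<inter> Z = W))"

lemma shatters_subset:
  assumes "shatters F Z" "Y \<subseteq> Z" shows "shatters F Y"
  unfolding shatters_def
proof (intro allI impI)
  fix W assume W: "W \<subseteq> Y"
  then obtain A where A: "A \<in> F" "A \<inter> Z = W"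
    using assms unfolding shatters_def by (meson order_trans)
  then have "A \<inter> Y = W"
    using W assms(2) by blast
  then show "\<exists>A\<in>F. A \<inter> Y = W"
    using A(1) by blast
qed

text \<open>Pajor's strengthening of the Sauer--Shelah lemma, which makes the induction immediate.\<close>

lemma card_le_card_shattered:
  "finite T \<Longrightarrow> F \<subseteq> Pow T \<Longrightarrow> card F \<le> card {Z. Z \<subseteq> T \<and> shatters F Z}"
proof (induction T arbitrary: F rule: finite_induct)
  case empty
  then consider "F = {}" | "F = {{}}" by auto
  then show ?case
  proof cases
    case 2
    then have "{Z. Z \<subseteq> {} \<and> shatters F Z} = {{}}"
      by (auto simp: shatters_def)
    then show ?thesis using 2 by simp
  qed simp
next
  case (insert a T)
  define F0 where "F0 = {A \<in> F. a \<notin> A}"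
  define F1 where "F1 = {A. A \<subseteq> T \<and> insert a A \<in> F}"
  define sh where "sh H = {Z. Z \<subseteq> T \<and> shatters H Z}" for H
  have fin_sh: "finite (sh H)" for H
    unfolding sh_def using insert.hyps(1) by auto
  have fin: "finite F0" "finite F1"
    using insert.hyps(1) insert.prems unfolding F0_def F1_def
    by (auto intro: finite_subset[of _ "Pow (insert a T)"])
  have "F \<subseteq> F0 \<union> insert a ` F1"
  proof
    fix A assume A: "A \<in> F"
    show "A \<in> F0 \<union> insert a ` F1"
    proof (cases "a \<in> A")
      case True
      then have "A - {a} \<in> F1" "A = insert a (A - {a})"
        using A insert.prems by (auto simp: F1_def insert_absorb)
      then show ?thesis by blast
    qed (use A in \<open>auto simp: F0_def\<close>)
  qed
  then have "card F \<le> card (F0 \<union> insert a ` F1)"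
    using fin by (intro card_mono) auto
  also have "\<dots> \<le> card F0 + card (insert a ` F1)"
    by (rule card_Un_le)
  also have "\<dots> \<le> card F0 + card F1"
    using card_image_le[OF fin(2)] by simp
  also have "\<dots> \<le> card (sh F0) + card (sh F1)"
    unfolding sh_def using insert.prems by (intro add_mono insert.IH) (auto simp: F0_def F1_def)
  \<comment> \<open>A set counted in both \<open>sh F0\<close> and \<open>sh F1\<close> pays for its
    second count with \<open>insert a Z\<close>, which \<open>F\<close> shatters and which is not a
    subset of \<open>T\<close>.\<close>
  also have "\<dots> = card (sh F0 \<union> sh F1) + card (sh F0 \<inter> sh F1)"
    by (intro card_Un_Int fin_sh)
  also have "card (sh F0 \<inter> sh F1) = card (insert a ` (sh F0 \<inter> sh F1))"
  proof (rule card_image[symmetric], rule inj_onI)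
    fix Z Z' assume "Z \<in> sh F0 \<inter> sh F1" "Z' \<in> sh F0 \<inter> sh F1" "insert a Z = insert a Z'"
    moreover from this have "a \<notin> Z" "a \<notin> Z'"
      using insert.hyps(2) by (auto simp: sh_def)
    ultimately show "Z = Z'"
      by (metis Diff_insert_absorb)
  qed
  also have "card (sh F0 \<union> sh F1) + \<dots> = card ((sh F0 \<union> sh F1) \<union> insert a ` (sh F0 \<inter> sh F1))"
    using fin_sh insert.hyps(2) by (intro card_Un_disjoint[symmetric]) (auto simp: sh_def)
  also have "\<dots> \<le> card {Z. Z \<subseteq> insert a T \<and> shatters F Z}"
  proof (rule card_mono)
    have "shatters F Z" if Z: "Z \<subseteq> T" "shatters F0 Z \<or> shatters F1 Z" for Z
      unfolding shatters_def
    proof (intro allI impI)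
      fix W assume "W \<subseteq> Z"
      then consider A where "A \<in> F0" "A \<inter> Z = W" | A where "A \<in> F1" "A \<inter> Z = W"
        using Z(2) unfolding shatters_def by meson
      then show "\<exists>A\<in>F. A \<inter> Z = W"
      proof cases
        case 1
        then show ?thesis by (auto simp: F0_def)
      next
        case 2
        moreover have "a \<notin> Z" using Z(1) insert.hyps(2) by blast
        ultimately show ?thesis by (intro bexI[of _ "insert a A"]) (auto simp: F1_def)
      qed
    qed
    moreover have "shatters F (insert a Z)" if Z: "Z \<subseteq> T" "shatters F0 Z" "shatters F1 Z" for Z
      unfolding shatters_def
    proof (intro allI impI)
      fix W assume W: "W \<subseteq> insert a Z"
      have aZ: "a \<notin> Z" using Z(1) insert.hyps(2) by blast
      show "\<exists>A\<in>F. A \<inter> insert a Z = W"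
      proof (cases "a \<in> W")
        case True
        have "W - {a} \<subseteq> Z" using W by blast
        then obtain A where "A \<in> F1" "A \<inter> Z = W - {a}"
          using Z(3) unfolding shatters_def by meson
        then show ?thesis
          using True by (intro bexI[of _ "insert a A"]) (auto simp: F1_def)
      next
        case False
        then have "W \<subseteq> Z" using W by blast
        then obtain A where "A \<in> F0" "A \<inter> Z = W"
          using Z(2) unfolding shatters_def by meson
        then show ?thesis
          by (intro bexI[of _ A]) (auto simp: F0_def)
      qed
    qed
    ultimately show "(sh F0 \<union> sh F1) \<union> insert a ` (sh F0 \<inter> sh F1) \<subseteq> {Z. Z \<subseteq> insert a T \<and> shatters F Z}"
      by (auto simp: sh_def)
    show "finite {Z. Z \<subseteq> insert a T \<and> shatters F Z}"
      using insert.hyps(1) by auto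
  qed
  finally show ?case .
qed

text \<open>List the elements and pad with \<open>None\<close> to length exactly \<open>d\<close>: a
  crude count that avoids binomial coefficients.\<close>

lemma card_small_subsets:
  assumes "finite T" shows "card {Z. Z \<subseteq> T \<and> card Z < d} \<le> (card T + 1) ^ d"
proof -
  let ?A = "insert None (Some ` T)"
  let ?L = "{xs. set xs \<subseteq> ?A \<and> length xs = d}"
  have "{Z. Z \<subseteq> T \<and> card Z < d} \<subseteq> (\<lambda>xs. {x. Some x \<in> set xs}) ` ?L"
  proof
    fix Z assume Z: "Z \<in> {Z. Z \<subseteq> T \<and> card Z < d}"
    then obtain ys where ys: "set ys = Z" "distinct ys"
      using assms finite_distinct_list finite_subset by (metis (lifting) mem_Collect_eq)
    let ?xs = "map Some ys @ replicate (d - length ys) None"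
    have "?xs \<in> ?L"
      using Z ys distinct_card[of ys] by auto
    moreover have "Z = {x. Some x \<in> set ?xs}"
      using ys by auto
    ultimately show "Z \<in> (\<lambda>xs. {x. Some x \<in> set xs}) ` ?L" by blast
  qed
  then have "card {Z. Z \<subseteq> T \<and> card Z < d} \<le> card ?L"
    using assms by (intro surj_card_le) (auto intro: finite_lists_length_eq)
  also have "\<dots> = (card T + 1) ^ d"
    using assms by (subst card_lists_length_eq) (auto simp: card_image)
  finally show ?thesis .
qed

text \<open>Shattering passes to subsets, so every shattered set has fewer than \<open>d\<close>
  elements and Pajor's count applies.\<close>

lemma sauer_shelah:
  assumes "finite T" "F \<subseteq> Pow T" "\<And>Z. Z \<subseteq> T \<Longrightarrow> card Z = d \<Longrightarrow> \<not> shatters F Z"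
  shows "card F \<le> (card T + 1) ^ d"
proof -
  have "{Z. Z \<subseteq> T \<and> shatters F Z} \<subseteq> {Z. Z \<subseteq> T \<and> card Z < d}"
  proof safe
    fix Z assume Z: "Z \<subseteq> T" "shatters F Z"
    show "card Z < d"
    proof (rule ccontr)
      assume "\<not> card Z < d"
      then obtain Y where "Y \<subseteq> Z" "card Y = d"
        by (meson not_less obtain_subset_with_card_n)
      then show False
        using assms(3)[of Y] Z shatters_subset[of F Z Y] by auto
    qed
  qed
  then have "card {Z. Z \<subseteq> T \<and> shatters F Z} \<le> card {Z. Z \<subseteq> T \<and> card Z < d}"
    using assms(1) by (intro card_mono) auto
  then show ?thesis
    using card_le_card_shattered[OF assms(1,2)] card_small_subsets[OF assms(1), of d] by simp
qed

section \<open>VC dimension of the neighbourhoods\<close>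

definition nbhd_vc_free :: "nat \<Rightarrow> 'a graph \<Rightarrow> bool" where
  "nbhd_vc_free d G \<longleftrightarrow> (\<forall>Z. Z \<subseteq> verts G \<longrightarrow> card Z = d \<longrightarrow> \<not> shatters (nbhd G ` verts G) Z)"

lemma card_traces_le:
  assumes "finite (verts G)" "nbhd_vc_free d G" "T \<subseteq> verts G"
  shows "card ((\<lambda>x. nbhd G x \<inter> T) ` verts G) \<le> (card T + 1) ^ d"
proof (rule sauer_shelah)
  show "finite T" using assms finite_subset by blast
  fix Z assume Z: "Z \<subseteq> T" "card Z = d"
  show "\<not> shatters ((\<lambda>x. nbhd G x \<inter> T) ` verts G) Z"
  proof
    assume sh: "shatters ((\<lambda>x. nbhd G x \<inter> T) ` verts G) Z"
    have "shatters (nbhd G ` verts G) Z"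
      unfolding shatters_def
    proof (intro allI impI)
      fix W assume "W \<subseteq> Z"
      then obtain x where "x \<in> verts G" "nbhd G x \<inter> T \<inter> Z = W"
        using sh unfolding shatters_def by blast
      moreover have "nbhd G x \<inter> T \<inter> Z = nbhd G x \<inter> Z"
        using Z(1) by blast
      ultimately show "\<exists>A\<in>nbhd G ` verts G. A \<inter> Z = W"
        by blast
    qed
    then show False
      using assms(2,3) Z unfolding nbhd_vc_free_def by blast
  qed
qed auto

section \<open>Inner product graphs\<close>

text \<open>Subsets of \<open>{..<k}\<close> stand for vectors over the two-element field; this is
  the character \<open>(-1)\<close> to the inner product of \<open>x\<close> and \<open>y\<close>,
  an entry of the Sylvester-Hadamard matrix.\<close>

definition walsh :: "nat set \<Rightarrow> nat set \<Rightarrow> int" where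
  "walsh x y = (if odd (card (x \<inter> y)) then - 1 else 1)"

lemma walsh_commute: "walsh x y = walsh y x"
  by (simp add: walsh_def Int_commute)

lemma walsh_square [simp]: "walsh x y * walsh x y = 1"
  by (simp add: walsh_def)

lemma walsh_insert:
  assumes "finite x" "i \<notin> x"
  shows "walsh (insert i x) y = (if i \<in> y then - walsh x y else walsh x y)"
  using assms by (auto simp: walsh_def Int_insert_left)

lemma walsh_orthogonal:
  assumes "y \<subseteq> {..<k}" "y' \<subseteq> {..<k}" "y \<noteq> y'"
  shows "(\<Sum>x\<in>Pow {..<k}. walsh x y * walsh x y') = 0"
proof -
  obtain i where i: "i < k" "(i \<in> y) \<noteq> (i \<in> y')"
    using assms by blast
  \<comment> \<open>Toggling a coordinate in which \<open>y\<close> and \<open>y'\<close> differ is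
    an involution that negates every summand.\<close>
  define h where "h x = (if i \<in> x then x - {i} else insert i x)" for x :: "nat set"
  have h: "walsh (h x) y * walsh (h x) y' = - (walsh x y * walsh x y')" if "x \<in> Pow {..<k}" for x
  proof -
    have fin: "finite x" using that finite_subset by blast
    have 1: "walsh (insert i z) y * walsh (insert i z) y' = - (walsh z y * walsh z y')"
      if "finite z" "i \<notin> z" for z
      using that i(2) by (simp add: walsh_insert)
    show ?thesis
    proof (cases "i \<in> x")
      case True
      then show ?thesis
        using 1[of "x - {i}"] fin by (simp add: h_def insert_absorb)
    qed (use 1 fin in \<open>simp add: h_def\<close>)
  qed
  have "(\<Sum>x\<in>Pow {..<k}. walsh x y * walsh x y') = (\<Sum>x\<in>Pow {..<k}. walsh (h x) y * walsh (h x) y')"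
    using i(1) by (intro sum.reindex_bij_witness[of _ h h]) (auto simp: h_def insert_absorb)
  also have "\<dots> = - (\<Sum>x\<in>Pow {..<k}. walsh x y * walsh x y')"
    using h by (simp add: sum_negf)
  finally show ?thesis by simp
qed

text \<open>Orthogonal sign vectors differ in exactly half of the places.\<close>

lemma card_walsh_neq:
  assumes "x \<subseteq> {..<k}" "x' \<subseteq> {..<k}" "x \<noteq> x'"
  shows "2 * card {y \<in> Pow {..<k}. walsh x y \<noteq> walsh x' y} = 2 ^ k"
proof -
  let ?X = "Pow {..<k}" and ?D = "{y \<in> Pow {..<k}. walsh x y \<noteq> walsh x' y}"
  have "(\<Sum>y\<in>?X. walsh x y * walsh x' y) = (\<Sum>y\<in>?X. 1 - 2 * of_bool (y \<in> ?D))"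
    by (intro sum.cong) (auto simp: walsh_def)
  also have "\<dots> = int (card ?X) - 2 * int (card ?D)"
    by (simp add: sum_subtractf sum_distrib_left[symmetric] Int_def)
  finally have "2 * int (card ?D) = int (card ?X)"
    using walsh_orthogonal[OF assms] by (simp add: walsh_commute)
  then have "2 * card ?D = card ?X"
    by linarith
  then show ?thesis
    by (simp add: card_Pow)
qed

text \<open>By Parseval, columns indexed by \<open>B\<close> cannot be almost constant on \<open>A\<close>.\<close>

lemma walsh_columns_differ:
  assumes A: "A \<subseteq> Pow {..<k}" and B: "B \<subseteq> Pow {..<k}" and B0: "B \<noteq> {}"
    and large: "2 ^ k < int (card B) * (int (card A) - 4)"
  obtains y y' where "y \<in> B" "y' \<in> B" "3 \<le> card {x \<in> A. walsh x y \<noteq> walsh x y'}"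
proof (rule ccontr)
  note witness = that
  assume no: "\<not> thesis"
  have few: "card {x \<in> A. walsh x y \<noteq> walsh x y'} \<le> 2" if "y \<in> B" "y' \<in> B" for y y'
  proof (rule ccontr)
    assume "\<not> ?thesis"
    then show False
      using no witness[OF that] by simp
  qed
  have finA: "finite A" and finB: "finite B"
    using A B by (auto intro: finite_subset)
  \<comment> \<open>Each of the at most two disagreements lowers the correlation by 2, which is the
    origin of the 4.\<close>
  have corr: "(\<Sum>x\<in>A. walsh x y * walsh x y') \<ge> int (card A) - 4" if "y \<in> B" "y' \<in> B" for y y'
  proof -
    have "(\<Sum>x\<in>A. walsh x y * walsh x y') = (\<Sum>x\<in>A. 1 - 2 * of_bool (walsh x y \<noteq> walsh x y'))"
      by (intro sum.cong) (auto simp: walsh_def)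
    also have "\<dots> = int (card A) - 2 * int (card {x \<in> A. walsh x y \<noteq> walsh x y'})"
      using finA by (simp add: sum_subtractf sum_distrib_left[symmetric] Int_def)
    finally show ?thesis
      using few[OF that] by linarith
  qed
  \<comment> \<open>The sum of the correlations over all pairs of columns in \<open>B\<close> is
    bounded from both sides.\<close>
  have "int (card B) * (int (card B) * (int (card A) - 4)) = (\<Sum>y\<in>B. \<Sum>y'\<in>B. int (card A) - 4)"
    by simp
  also have "\<dots> \<le> (\<Sum>y\<in>B. \<Sum>y'\<in>B. \<Sum>x\<in>A. walsh x y * walsh x y')"
    by (intro sum_mono corr)
  also have "\<dots> = (\<Sum>y\<in>B. \<Sum>x\<in>A. \<Sum>y'\<in>B. walsh x y * walsh x y')"
    by (intro sum.cong refl sum.swap)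
  also have "\<dots> = (\<Sum>x\<in>A. \<Sum>y\<in>B. \<Sum>y'\<in>B. walsh x y * walsh x y')"
    by (rule sum.swap)
  also have "\<dots> = (\<Sum>x\<in>A. (\<Sum>y\<in>B. walsh x y)\<^sup>2)"
    by (simp add: power2_eq_square sum_product)
  \<comment> \<open>A sum of squares only grows when \<open>A\<close> is extended to all rows, where
    orthogonality evaluates it exactly.\<close>
  also have "\<dots> \<le> (\<Sum>x\<in>Pow {..<k}. (\<Sum>y\<in>B. walsh x y)\<^sup>2)"
    using A by (intro sum_mono2) auto
  also have "\<dots> = (\<Sum>x\<in>Pow {..<k}. \<Sum>y\<in>B. \<Sum>y'\<in>B. walsh x y * walsh x y')"
    by (simp add: power2_eq_square sum_product)
  also have "\<dots> = (\<Sum>y\<in>B. \<Sum>x\<in>Pow {..<k}. \<Sum>y'\<in>B. walsh x y * walsh x y')"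
    by (rule sum.swap)
  also have "\<dots> = (\<Sum>y\<in>B. \<Sum>y'\<in>B. \<Sum>x\<in>Pow {..<k}. walsh x y * walsh x y')"
    by (intro sum.cong refl sum.swap)
  also have "\<dots> = (\<Sum>y\<in>B. \<Sum>y'\<in>B. if y' = y then 2 ^ k else 0)"
  proof (intro sum.cong refl)
    fix y y' assume "y \<in> B" "y' \<in> B"
    then show "(\<Sum>x\<in>Pow {..<k}. walsh x y * walsh x y') = (if y' = y then 2 ^ k else 0)"
      using walsh_orthogonal[of y k y'] B by (auto simp: card_Pow)
  qed
  also have "\<dots> = int (card B) * 2 ^ k"
    using finB by simp
  finally have "int (card B) * (int (card B) * (int (card A) - 4)) \<le> int (card B) * 2 ^ k" .
  moreover have "int (card B) > 0"
    using finB B0 by (simp add: card_gt_0_iff)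
  ultimately have "int (card B) * (int (card A) - 4) \<le> 2 ^ k"
    by simp
  then show False using large by simp
qed

section \<open>Rectangles in the Walsh matrix and lower bounds for partition merge-width\<close>

lemma two_elements:
  assumes "2 \<le> card S" obtains x y where "x \<in> S" "y \<in> S" "x \<noteq> y"
  using assms card_le_Suc0_iff_eq[of S] card.infinite[of S] by fastforce

text \<open>Three rows in which two columns disagree show only two sign patterns, so two of the rows
  agree; exchanging \<open>y\<close> and \<open>y'\<close> adjusts the signs.\<close>

lemma walsh_rectangle:
  assumes A: "A \<subseteq> Pow {..<k}" and B: "B \<subseteq> Pow {..<k}" and B0: "B \<noteq> {}"
    and large: "2 ^ k < int (card B) * (int (card A) - 4)"
  obtains x x' y y' where "x \<in> A" "x' \<in> A" "x \<noteq> x'" "y \<in> B" "y' \<in> B"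
    "walsh x y = - 1" "walsh x' y = - 1" "walsh x y' = 1" "walsh x' y' = 1"
proof -
  obtain y y' where y: "y \<in> B" "y' \<in> B" "3 \<le> card {x \<in> A. walsh x y \<noteq> walsh x y'}"
    using walsh_columns_differ[OF assms] .
  let ?D1 = "{x \<in> A. walsh x y = -1 \<and> walsh x y' = 1}" and ?D2 = "{x \<in> A. walsh x y = 1 \<and> walsh x y' = -1}"
  have finA: "finite A"
    using A by (auto intro: finite_subset)
  have "{x \<in> A. walsh x y \<noteq> walsh x y'} = ?D1 \<union> ?D2"
    by (auto simp: walsh_def)
  then have "3 \<le> card ?D1 + card ?D2"
    using y(3) card_Un_le[of ?D1 ?D2] by simp
  then consider "2 \<le> card ?D1" | "2 \<le> card ?D2" by linarith
  then show ?thesis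
  proof cases
    case 1
    then obtain x x' where "x \<in> ?D1" "x' \<in> ?D1" "x \<noteq> x'"
      using two_elements by blast
    then show ?thesis using that y by blast
  next
    case 2
    then obtain x x' where "x \<in> ?D2" "x' \<in> ?D2" "x \<noteq> x'"
      using two_elements by blast
    then show ?thesis using that y by blast
  qed
qed

text \<open>In every flip \<open>y\<close> or \<open>y'\<close> is a common neighbour of
  \<open>x\<close> and \<open>x'\<close>, because complementing the pair of their parts exchanges
  the two roles. Moreover \<open>z\<close> stays adjacent to one of \<open>x\<close>,
  \<open>x'\<close>. So two steps lead to \<open>x'\<close> and at most one more to
  \<open>z\<close>.\<close>

lemma pball_contains_distinguishers:
  assumes G: "simple_graph G" and P: "partition_on (verts G) P"
    and A: "A \<in> P" "x \<in> A" "x' \<in> A" and B: "B \<in> P" "y \<in> B" "y' \<in> B"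
    and adj: "{x, y} \<in> edges G" "{x', y} \<in> edges G" "{x, y'} \<notin> edges G" "{x', y'} \<notin> edges G"
    and ne: "x \<noteq> y'" "x' \<noteq> y'"
    and z: "z \<in> verts G" "x \<noteq> z" "x' \<noteq> z" "({x, z} \<in> edges G) \<noteq> ({x', z} \<in> edges G)"
  shows "z \<in> pball 3 G P x"
proof -
  obtain C where C: "C \<in> P" "z \<in> C"
    using P z(1) by (meson partition_on_obtain)
  have "gdist (flip F G) x z \<le> enat 3" if F: "F \<subseteq> P \<times> P" for F
  proof -
    have ne': "x \<noteq> y" "x' \<noteq> y"
      using adj G simple_graph_edgeD by metis+
    note iff = edges_flip_iff[OF P F]
    have e: "{x, y} \<in> edges (flip F G) \<longleftrightarrow> \<not> ((A, B) \<in> F \<or> (B, A) \<in> F)"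
      "{x', y} \<in> edges (flip F G) \<longleftrightarrow> \<not> ((A, B) \<in> F \<or> (B, A) \<in> F)"
      "{x, y'} \<in> edges (flip F G) \<longleftrightarrow> ((A, B) \<in> F \<or> (B, A) \<in> F)"
      "{x', y'} \<in> edges (flip F G) \<longleftrightarrow> ((A, B) \<in> F \<or> (B, A) \<in> F)"
      using iff[OF A(1) B(1)] A B adj ne ne' by simp_all
    have "({x, y} \<in> edges (flip F G) \<and> {x', y} \<in> edges (flip F G)) \<or>
        ({x, y'} \<in> edges (flip F G) \<and> {x', y'} \<in> edges (flip F G))"
      unfolding e by blast
    then obtain w where "{x, w} \<in> edges (flip F G)" "{w, x'} \<in> edges (flip F G)"
      using that by (auto simp: insert_commute[of _ x'])
    then have d: "gdist (flip F G) x x' \<le> enat (1 + 1)"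
      by (intro gdist_triangle_le gdist_edge)
    have "{x, z} \<in> edges (flip F G) \<or> {x', z} \<in> edges (flip F G)"
      using iff[of A C x z] iff[of A C x' z] A C z by auto
    then show ?thesis
    proof
      assume "{x, z} \<in> edges (flip F G)"
      then show ?thesis
        by (rule gdist_mono_radius[OF gdist_edge]) simp
    next
      assume "{x', z} \<in> edges (flip F G)"
      then have "gdist (flip F G) x z \<le> enat (1 + 1 + 1)"
        by (intro gdist_triangle_le[OF d] gdist_edge)
      then show ?thesis by (simp add: numeral_3_eq_3)
    qed
  qed
  then show ?thesis
    using z(1) by (simp add: pball_def pdist_le_iff)
qed

text \<open>\<open>D\<close> is spread over the parts met by \<open>W\<close>, and each of them
  holds at most \<open>s\<close> of its elements.\<close>

lemma card_le_parts_meeting: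
  assumes fin: "finite V" and P: "partition_on V P"
    and D: "D \<subseteq> W \<inter> R" "D \<subseteq> V" and small: "\<And>B. B \<in> P \<Longrightarrow> card (B \<inter> R) \<le> s"
  shows "card D \<le> s * card (parts_meeting W P)"
proof -
  have "D \<subseteq> (\<Union>B\<in>parts_meeting W P. B \<inter> D)"
  proof
    fix z assume z: "z \<in> D"
    then obtain B where "B \<in> P" "z \<in> B"
      using D(2) P by (meson partition_on_obtain subsetD)
    then show "z \<in> (\<Union>B\<in>parts_meeting W P. B \<inter> D)"
      using z D(1) unfolding parts_meeting_def by blast
  qed
  then have "card D \<le> card (\<Union>B\<in>parts_meeting W P. B \<inter> D)"
    using finite_subset[OF D(2) fin] finite_parts_meeting[OF fin P] by (intro card_mono) auto
  also have "\<dots> \<le> (\<Sum>B\<in>parts_meeting W P. card (B \<inter> D))"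
    using finite_parts_meeting[OF fin P] by (rule card_UN_le)
  also have "\<dots> \<le> (\<Sum>B\<in>parts_meeting W P. s)"
  proof (rule sum_mono)
    fix B assume B: "B \<in> parts_meeting W P"
    then have "B \<subseteq> V"
      using P by (auto simp: parts_meeting_def partition_on_def)
    then have "card (B \<inter> D) \<le> card (B \<inter> R)"
      using D fin by (intro card_mono) (auto intro: finite_subset)
    then show "card (B \<inter> D) \<le> s"
      using small[of B] B by (auto simp: parts_meeting_def)
  qed
  finally show ?thesis
    by (simp add: mult.commute)
qed

text \<open>Look at the first partition having parts with many vertices on both sides: the previous
  one still splits one of the sides into small pieces.\<close>

lemma bipartite_chain_width_lower:
  assumes G: "simple_graph G" and V: "verts G = L \<union> R" "L \<inter> R = {}"
    and chain: "partition_chain (verts G) m P"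
    and s: "2 \<le> s" "s \<le> card L" "s \<le> card R"
    and rectL: "\<And>A B. A \<subseteq> L \<Longrightarrow> B \<subseteq> R \<Longrightarrow> s \<le> card A \<Longrightarrow> s \<le> card B \<Longrightarrow>
      \<exists>x\<in>A. \<exists>x'\<in>A. \<exists>y\<in>B. \<exists>y'\<in>B. x \<noteq> x' \<and> {x, y} \<in> edges G \<and> {x', y} \<in> edges G \<and>
        {x, y'} \<notin> edges G \<and> {x', y'} \<notin> edges G"
    and rectR: "\<And>A B. A \<subseteq> R \<Longrightarrow> B \<subseteq> L \<Longrightarrow> s \<le> card A \<Longrightarrow> s \<le> card B \<Longrightarrow>
      \<exists>x\<in>A. \<exists>x'\<in>A. \<exists>y\<in>B. \<exists>y'\<in>B. x \<noteq> x' \<and> {x, y} \<in> edges G \<and> {x', y} \<in> edges G \<and>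
        {x, y'} \<notin> edges G \<and> {x', y'} \<notin> edges G"
    and distL: "\<And>x x'. x \<in> L \<Longrightarrow> x' \<in> L \<Longrightarrow> x \<noteq> x' \<Longrightarrow>
      M \<le> card {z \<in> R. ({x, z} \<in> edges G) \<noteq> ({x', z} \<in> edges G)}"
    and distR: "\<And>x x'. x \<in> R \<Longrightarrow> x' \<in> R \<Longrightarrow> x \<noteq> x' \<Longrightarrow>
      M \<le> card {z \<in> L. ({x, z} \<in> edges G) \<noteq> ({x', z} \<in> edges G)}"
  shows "M \<le> s * chain_width 3 G m P"
proof -
  have fin: "finite (verts G)"
    using G by (simp add: simple_graph_def)
  define big where "big t \<longleftrightarrow> 1 \<le> t \<and> (\<exists>A\<in>P t. \<exists>B\<in>P t. s \<le> card (A \<inter> L) \<and> s \<le> card (B \<inter> R))" for t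
  define t where "t = (LEAST t. big t)"
  have Pm: "P m = {verts G}" "1 \<le> m" and P1: "P 1 = (\<lambda>v. {v}) ` verts G"
    using chain by (auto simp: partition_chain_def)
  have "verts G \<inter> L = L" "verts G \<inter> R = R"
    using V by auto
  then have "big m"
    using Pm s by (simp add: big_def)
  then have t: "big t" "t \<le> m"
    unfolding t_def by (auto intro: LeastI Least_le)
  \<comment> \<open>This is where \<open>2 \<le> s\<close> enters: singletons must not count as
    large.\<close>
  have "\<not> big 1"
  proof
    assume "big 1"
    then obtain v where "s \<le> card ({v} \<inter> L)"
      unfolding big_def P1 by blast
    moreover have "card ({v} \<inter> L) \<le> card {v}"
      by (intro card_mono) auto
    ultimately show False
      using s(1) by simp
  qed
  then have "t \<noteq> 1"
    using t(1) by auto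
  then obtain i where i: "t = i + 1" "i \<in> {1..<m}"
    using t by (intro that[of "t - 1"]) (auto simp: big_def)
  have "\<not> big i"
    using i(1) not_less_Least[of i big] unfolding t_def by simp
  then consider "\<forall>A\<in>P i. card (A \<inter> L) \<le> s" | "\<forall>B\<in>P i. card (B \<inter> R) \<le> s"
    using i(2) unfolding big_def by (meson atLeastLessThan_iff nat_le_linear)
  moreover have Pi: "partition_on (verts G) (P i)" and Pt: "partition_on (verts G) (P t)"
    using chain i by (auto simp: partition_chain_def)
  obtain A B where AB: "A \<in> P t" "B \<in> P t" "s \<le> card (A \<inter> L)" "s \<le> card (B \<inter> R)"
    using t(1) by (auto simp: big_def)
  \<comment> \<open>Stated for arbitrary sides, since one of the two cases uses it with
    \<open>L\<close> and \<open>R\<close> exchanged.\<close>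
  have core: "M \<le> s * chain_width 3 G m P"
    if V: "verts G = L \<union> R" "L \<inter> R = {}" and AB: "A \<in> P t" "B \<in> P t"
      and rect: "x \<in> A \<inter> L" "x' \<in> A \<inter> L" "y \<in> B \<inter> R" "y' \<in> B \<inter> R" "x \<noteq> x'"
        "{x, y} \<in> edges G" "{x', y} \<in> edges G" "{x, y'} \<notin> edges G" "{x', y'} \<notin> edges G"
      and M: "M \<le> card {z \<in> R. ({x, z} \<in> edges G) \<noteq> ({x', z} \<in> edges G)}"
      and small: "\<forall>B\<in>P i. card (B \<inter> R) \<le> s"
    for L R A B x x' y y'
  proof -
    let ?D = "{z \<in> R. ({x, z} \<in> edges G) \<noteq> ({x', z} \<in> edges G)}"
    let ?W = "pball 3 G (P t) x"
    have "z \<in> ?W" if "z \<in> ?D" for z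
      using that AB rect V
      by (intro pball_contains_distinguishers[OF G Pt AB(1) _ _ AB(2), of x x' y y' z]) auto
    then have "card ?D \<le> s * card (parts_meeting ?W (P i))"
      using small V by (intro card_le_parts_meeting[OF fin Pi, of _ _ R]) auto
    moreover have "card (parts_meeting ?W (P i)) \<le> chain_width 3 G m P"
      unfolding i(1) using rect V by (intro chain_width_ge[OF fin i(2)]) auto
    ultimately show ?thesis
      using M by (meson le_trans mult_le_mono2)
  qed
  ultimately show ?thesis
  proof cases
    case 2
    obtain x x' y y' where r: "x \<in> A \<inter> L" "x' \<in> A \<inter> L" "y \<in> B \<inter> R" "y' \<in> B \<inter> R" "x \<noteq> x'"
        "{x, y} \<in> edges G" "{x', y} \<in> edges G" "{x, y'} \<notin> edges G" "{x', y'} \<notin> edges G"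
      using rectL[of "A \<inter> L" "B \<inter> R"] AB by blast
    show ?thesis
      using core[OF V AB(1,2) r _ 2] distL[of x x'] r by auto
  next
    case 1
    obtain x x' y y' where r: "x \<in> B \<inter> R" "x' \<in> B \<inter> R" "y \<in> A \<inter> L" "y' \<in> A \<inter> L" "x \<noteq> x'"
        "{x, y} \<in> edges G" "{x', y} \<in> edges G" "{x, y'} \<notin> edges G" "{x', y'} \<notin> edges G"
      using rectR[of "B \<inter> R" "A \<inter> L"] AB by blast
    have V': "verts G = R \<union> L" "R \<inter> L = {}"
      using V by auto
    show ?thesis
      using core[OF V' AB(2,1) r _ 1] distR[of x x'] r by auto
  qed
qed

text \<open>The threshold \<open>2 ^ (j + 1)\<close> is twice the square root of the size of a side.
  With \<open>q = 2 ^ j\<close> the numerical hypothesis of \<open>walsh_rectangle\<close> becomes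
  \<open>q * (3 * q - 8) > 0\<close>, which holds as \<open>4 \<le> q\<close>.\<close>

lemma inner_product_rectangle:
  assumes l: "inj_on l (Pow {..<2 * j})"
    and edge: "\<And>x y. x \<subseteq> {..<2 * j} \<Longrightarrow> y \<subseteq> {..<2 * j} \<Longrightarrow> {l x, p y} \<in> edges G \<longleftrightarrow> walsh x y = - 1"
    and j: "2 \<le> j"
    and A: "A \<subseteq> l ` Pow {..<2 * j}" "2 ^ (j + 1) \<le> card A"
    and B: "B \<subseteq> p ` Pow {..<2 * j}" "2 ^ (j + 1) \<le> card B"
  shows "\<exists>x\<in>A. \<exists>x'\<in>A. \<exists>y\<in>B. \<exists>y'\<in>B. x \<noteq> x' \<and> {x, y} \<in> edges G \<and> {x', y} \<in> edges G \<and>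
        {x, y'} \<notin> edges G \<and> {x', y'} \<notin> edges G"
proof -
  obtain A' where A': "A' \<subseteq> Pow {..<2 * j}" "A = l ` A'"
    using A(1) by (meson subset_image_iff)
  obtain B' where B': "B' \<subseteq> Pow {..<2 * j}" "B = p ` B'"
    using B(1) by (meson subset_image_iff)
  have "finite B'"
    using B'(1) by (auto intro: finite_subset)
  then have cB: "2 ^ (j + 1) \<le> card B'"
    using B(2) card_image_le[of B' p] unfolding B'(2) by simp
  have "finite A'"
    using A'(1) by (auto intro: finite_subset)
  then have cA: "2 ^ (j + 1) \<le> card A'"
    using A(2) card_image_le[of A' l] unfolding A'(2) by simp
  have four: "(4 :: int) \<le> 2 ^ j"
    using j power_increasing[of 2 j "2 :: int"] by simp
  have "(2 :: int) ^ (2 * j) = 2 ^ j * 2 ^ j"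
    by (simp add: power_add[symmetric] mult_2)
  also have "\<dots> < 2 ^ (j + 1) * (2 ^ (j + 1) - 4)"
  proof -
    define q :: int where "q = 2 ^ j"
    have "2 * q * (2 * q - 4) - q * q = q * (3 * q - 8)"
      by (simp add: algebra_simps)
    moreover have "q * (3 * q - 8) > 0"
      using four unfolding q_def[symmetric] by (intro mult_pos_pos) auto
    ultimately show ?thesis
      unfolding power_add q_def[symmetric] by (simp add: mult.commute)
  qed
  also have "\<dots> \<le> int (card B') * (int (card A') - 4)"
  proof (rule mult_mono)
    show "(2 :: int) ^ (j + 1) \<le> int (card B')"
      using cB by (metis of_nat_le_iff of_nat_numeral of_nat_power)
    show "(2 :: int) ^ (j + 1) - 4 \<le> int (card A') - 4"
      using cA by (metis diff_right_mono of_nat_le_iff of_nat_numeral of_nat_power)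
    show "0 \<le> (2 :: int) ^ (j + 1) - 4"
      using four by simp
  qed simp
  finally have large: "2 ^ (2 * j) < int (card B') * (int (card A') - 4)" .
  have "B' \<noteq> {}"
    using cB by auto
  from walsh_rectangle[OF A'(1) B'(1) this large]
  obtain x x' y y' where r: "x \<in> A'" "x' \<in> A'" "x \<noteq> x'" "y \<in> B'" "y' \<in> B'"
    "walsh x y = - 1" "walsh x' y = - 1" "walsh x y' = 1" "walsh x' y' = 1" .
  have sub: "x \<subseteq> {..<2 * j}" "x' \<subseteq> {..<2 * j}" "y \<subseteq> {..<2 * j}" "y' \<subseteq> {..<2 * j}"
    using r A' B' by auto
  have "l x \<noteq> l x'"
    using l r(3) sub by (auto dest: inj_onD)
  moreover have "{l x, p y} \<in> edges G" "{l x', p y} \<in> edges G" "{l x, p y'} \<notin> edges G" "{l x', p y'} \<notin> edges G"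
    using edge r sub by auto
  ultimately show ?thesis
    using r unfolding A'(2) B'(2) by blast
qed

lemma inner_product_distinguishers:
  assumes p: "inj_on p (Pow {..<k})"
    and edge: "\<And>x y. x \<subseteq> {..<k} \<Longrightarrow> y \<subseteq> {..<k} \<Longrightarrow> {l x, p y} \<in> edges G \<longleftrightarrow> walsh x y = - 1"
    and x: "x \<in> l ` Pow {..<k}" "x' \<in> l ` Pow {..<k}" "x \<noteq> x'"
  shows "2 * card {z \<in> p ` Pow {..<k}. ({x, z} \<in> edges G) \<noteq> ({x', z} \<in> edges G)} = 2 ^ k"
proof -
  obtain u u' where u: "u \<subseteq> {..<k}" "u' \<subseteq> {..<k}" "x = l u" "x' = l u'" "u \<noteq> u'"
    using x by auto
  have "{z \<in> p ` Pow {..<k}. ({x, z} \<in> edges G) \<noteq> ({x', z} \<in> edges G)} =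
      p ` {y \<in> Pow {..<k}. walsh u y \<noteq> walsh u' y}"
  proof -
    have "({x, p y} \<in> edges G) \<noteq> ({x', p y} \<in> edges G) \<longleftrightarrow> walsh u y \<noteq> walsh u' y" if "y \<subseteq> {..<k}" for y
      using edge[OF u(1) that] edge[OF u(2) that] u(3,4) by (auto simp: walsh_def)
    then show ?thesis by blast
  qed
  moreover have "card (p ` {y \<in> Pow {..<k}. walsh u y \<noteq> walsh u' y}) = card {y \<in> Pow {..<k}. walsh u y \<noteq> walsh u' y}"
    using p by (intro card_image) (auto intro: inj_on_subset)
  ultimately show ?thesis
    using card_walsh_neq[OF u(1,2,5)] by simp
qed

text \<open>Half of a side, \<open>2 ^ (2 * j - 1)\<close>, divided by the threshold
  \<open>2 ^ (j + 1)\<close> gives the bound, which is of the order of the square root of the number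
  of vertices.\<close>

lemma inner_product_pmw_lower:
  assumes G: "simple_graph G" and j: "2 \<le> j"
    and l: "inj_on l (Pow {..<2 * j})" and p: "inj_on p (Pow {..<2 * j})"
    and V: "verts G = l ` Pow {..<2 * j} \<union> p ` Pow {..<2 * j}"
    and disj: "l ` Pow {..<2 * j} \<inter> p ` Pow {..<2 * j} = {}"
    and edge: "\<And>x y. x \<subseteq> {..<2 * j} \<Longrightarrow> y \<subseteq> {..<2 * j} \<Longrightarrow> {l x, p y} \<in> edges G \<longleftrightarrow> walsh x y = - 1"
  shows "2 ^ (j - 2) \<le> pmw 3 G"
proof -
  have "verts G \<noteq> {}"
    using V by auto
  from pmw_attained[OF this, of 3]
  obtain m P where chain: "partition_chain (verts G) m P" and w: "pmw 3 G = chain_width 3 G m P" .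
  have edge': "{p y, l x} \<in> edges G \<longleftrightarrow> walsh y x = - 1" if "y \<subseteq> {..<2 * j}" "x \<subseteq> {..<2 * j}" for x y
    using edge[OF that(2,1)] by (simp add: insert_commute walsh_commute)
  have card: "card (l ` Pow {..<2 * j}) = 2 ^ (2 * j)" "card (p ` Pow {..<2 * j}) = 2 ^ (2 * j)"
    using l p by (simp_all add: card_image card_Pow)
  have le: "(2::nat) ^ (j + 1) \<le> 2 ^ (2 * j)" "(2::nat) \<le> 2 ^ (j + 1)"
    using j power_increasing[of "j + 1" "2 * j" "2 :: nat"] by auto
  have "2 ^ (2 * j - 1) \<le> 2 ^ (j + 1) * chain_width 3 G m P"
  proof (rule bipartite_chain_width_lower[OF G V disj chain])
    have half: "2 ^ (2 * j - 1) \<le> c" if "2 * c = 2 ^ (2 * j)" for c :: nat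
    proof -
      have "(2 :: nat) ^ (2 * j) = 2 * 2 ^ (2 * j - 1)"
        using j by (simp flip: power_Suc)
      then show ?thesis using that by simp
    qed
    show "2 ^ (2 * j - 1) \<le> card {z \<in> p ` Pow {..<2 * j}. ({x, z} \<in> edges G) \<noteq> ({x', z} \<in> edges G)}"
      if "x \<in> l ` Pow {..<2 * j}" "x' \<in> l ` Pow {..<2 * j}" "x \<noteq> x'" for x x'
      by (rule half[OF inner_product_distinguishers[OF p edge that]])
    show "2 ^ (2 * j - 1) \<le> card {z \<in> l ` Pow {..<2 * j}. ({x, z} \<in> edges G) \<noteq> ({x', z} \<in> edges G)}"
      if "x \<in> p ` Pow {..<2 * j}" "x' \<in> p ` Pow {..<2 * j}" "x \<noteq> x'" for x x'
      by (rule half[OF inner_product_distinguishers[OF l edge' that]])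
  qed (use card le inner_product_rectangle[OF l edge j] inner_product_rectangle[OF p edge' j] in auto)
  moreover have "(2 :: nat) ^ (2 * j - 1) = 2 ^ (j + 1) * 2 ^ (j - 2)"
    using j by (simp add: power_add[symmetric] del: power_Suc)
  ultimately show ?thesis
    unfolding w by simp
qed

text \<open>Half of \<open>Z\<close> becomes the side \<open>l\<close>. Shattering provides vertices
  with any prescribed trace on it, and the freedom on the other half of \<open>Z\<close> allows
  choosing them outside the first half.\<close>

lemma shattered_inner_product:
  assumes G: "simple_graph G" and Z: "Z \<subseteq> verts G" "card Z = 2 * 2 ^ k" "shatters (nbhd G ` verts G) Z"
  obtains l p where "inj_on l (Pow {..<k})" "inj_on p (Pow {..<k})"
    "l ` Pow {..<k} \<subseteq> verts G" "p ` Pow {..<k} \<subseteq> verts G" "l ` Pow {..<k} \<inter> p ` Pow {..<k} = {}"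
    "\<And>x y. x \<subseteq> {..<k} \<Longrightarrow> y \<subseteq> {..<k} \<Longrightarrow> {l x, p y} \<in> edges G \<longleftrightarrow> walsh x y = - 1"
proof -
  have finZ: "finite Z"
    using Z(2) by (metis card.infinite mult_eq_0_iff power_not_zero zero_neq_numeral)
  obtain Z1 where Z1: "Z1 \<subseteq> Z" "card Z1 = 2 ^ k"
    using Z(2) obtain_subset_with_card_n[of "2 ^ k" Z] by auto
  define Z2 where "Z2 = Z - Z1"
  have fin: "finite Z1" "finite Z2"
    using finZ Z1 by (auto simp: Z2_def intro: finite_subset)
  have cardZ2: "card Z2 = 2 ^ k"
    using Z1 Z(2) fin by (simp add: Z2_def card_Diff_subset)
  have "card (Pow {..<k}) = card Z1"
    using Z1 by (simp add: card_Pow)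
  then obtain l where l: "bij_betw l (Pow {..<k}) Z1"
    using fin finite_same_card_bij[of "Pow {..<k}" Z1] by auto
  have "\<exists>v\<in>verts G - Z1. nbhd G v \<inter> Z1 = l ` {x \<in> Pow {..<k}. walsh x y = - 1}" for y
  proof -
    let ?W = "l ` {x \<in> Pow {..<k}. walsh x y = - 1}"
    have W: "?W \<subseteq> Z1"
      using l by (auto simp: bij_betw_def)
    have "\<exists>v\<in>verts G. nbhd G v \<inter> Z = ?W \<union> U" if "U \<in> Pow Z2" for U
    proof -
      have "?W \<union> U \<subseteq> Z"
        using W Z1 that by (auto simp: Z2_def)
      then show ?thesis
        using Z(3) unfolding shatters_def by blast
    qed
    then obtain g where g: "\<And>U. U \<in> Pow Z2 \<Longrightarrow> g U \<in> verts G \<and> nbhd G (g U) \<inter> Z = ?W \<union> U"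
      by metis
    have Z2_trace: "nbhd G (g U) \<inter> Z2 = U" if "U \<in> Pow Z2" for U
    proof -
      have "nbhd G (g U) \<inter> Z2 = (nbhd G (g U) \<inter> Z) \<inter> Z2"
        by (auto simp: Z2_def)
      also have "\<dots> = (?W \<union> U) \<inter> Z2"
        using g[OF that] by simp
      finally show ?thesis
        using W that by (auto simp: Z2_def)
    qed
    then have "inj_on g (Pow Z2)"
      by (metis inj_onI)
    then have "card (g ` Pow Z2) = 2 ^ (2 ^ k)"
      using fin cardZ2 by (simp add: card_image card_Pow)
    \<comment> \<open>There are \<open>2 ^ (2 ^ k)\<close> candidates, one for each trace on
      \<open>Z2\<close>, but only \<open>2 ^ k\<close> vertices in \<open>Z1\<close>.\<close>
    then have "card Z1 < card (g ` Pow Z2)"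
      using Z1(2) less_exp[of "2 ^ k"] by simp
    then have "\<not> g ` Pow Z2 \<subseteq> Z1"
      using fin(1) card_mono[of Z1 "g ` Pow Z2"] by auto
    then obtain U where U: "U \<in> Pow Z2" "g U \<notin> Z1"
      by blast
    have "nbhd G (g U) \<inter> Z1 = (nbhd G (g U) \<inter> Z) \<inter> Z1"
      using Z1 by blast
    also have "\<dots> = (?W \<union> U) \<inter> Z1"
      using g[OF U(1)] by simp
    also have "\<dots> = ?W"
      using W U(1) by (auto simp: Z2_def)
    finally show ?thesis
      using g[OF U(1)] U(2) by blast
  qed
  then obtain p where p: "\<And>y. p y \<in> verts G - Z1" "\<And>y. nbhd G (p y) \<inter> Z1 = l ` {x \<in> Pow {..<k}. walsh x y = - 1}"
    by metis
  have edge: "{l x, p y} \<in> edges G \<longleftrightarrow> walsh x y = - 1" if "x \<subseteq> {..<k}" for x y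
  proof -
    have "{l x, p y} \<in> edges G \<longleftrightarrow> l x \<in> nbhd G (p y) \<inter> Z1"
      using l that by (auto simp: nbhd_def insert_commute bij_betw_def)
    also have "\<dots> \<longleftrightarrow> x \<in> {x \<in> Pow {..<k}. walsh x y = - 1}"
      unfolding p(2) using l that by (intro inj_on_image_mem_iff[of l "Pow {..<k}"]) (auto simp: bij_betw_def)
    finally show ?thesis
      using that by simp
  qed
  \<comment> \<open>Coordinate \<open>i\<close> of \<open>y\<close> can be read off from the
    adjacency of \<open>p y\<close> to \<open>l {i}\<close>.\<close>
  have "inj_on p (Pow {..<k})"
  proof (rule inj_onI)
    fix y y' assume y: "y \<in> Pow {..<k}" "y' \<in> Pow {..<k}" "p y = p y'"
    have "i \<in> y \<longleftrightarrow> i \<in> y'" if "i < k" for i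
    proof -
      have "walsh {i} z = - 1 \<longleftrightarrow> i \<in> z" for z
        by (cases "i \<in> z") (auto simp: walsh_def)
      then show ?thesis
        using edge[of "{i}" y] edge[of "{i}" y'] y(3) that by simp
    qed
    then show "y = y'"
      using y by auto
  qed
  moreover have lZ: "l ` Pow {..<k} = Z1" and "inj_on l (Pow {..<k})"
    using l by (auto simp: bij_betw_def)
  moreover have "p ` Pow {..<k} \<subseteq> verts G" "l ` Pow {..<k} \<inter> p ` Pow {..<k} = {}" "l ` Pow {..<k} \<subseteq> verts G"
    unfolding lZ using p(1) Z1 Z(1) by auto
  ultimately show ?thesis
    using that[of l p] edge by blast
qed

text \<open>A single large \<open>j\<close> suffices: the induced inner product graph has
  \<open>n = 2 ^ (2 * j + 1)\<close> vertices and \<open>pmw 3\<close> of order at least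
  \<open>n powr (1 / 2)\<close>, beyond the permitted \<open>n powr (1 / 4)\<close>.\<close>

lemma nbhd_vc_bounded:
  fixes C :: "'a graph set"
  assumes simple: "\<And>G. G \<in> C \<Longrightarrow> simple_graph G" and her: "hereditary C"
    and bounded: "almost_bounded pmw C"
  obtains d where "\<And>G. G \<in> C \<Longrightarrow> nbhd_vc_free d G"
proof -
  have "(1 / 4 :: real) > 0"
    by simp
  then obtain n0 where n0: "\<And>G. G \<in> C \<Longrightarrow> n0 \<le> card (verts G) \<Longrightarrow> real (pmw 3 G) \<le> real (card (verts G)) powr (1 / 4)"
    using bounded unfolding almost_bounded_def by meson
  \<comment> \<open>\<open>5 \<le> j\<close> gives \<open>(2 * j + 1) / 4 < j - 2\<close>, and
    \<open>n0 \<le> j\<close> makes the subgraph large enough.\<close>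
  define j where "j = max 5 n0"
  have j: "5 \<le> j" "n0 \<le> j"
    by (auto simp: j_def)
  have "nbhd_vc_free (2 * 2 ^ (2 * j)) G" if G: "G \<in> C" for G
    unfolding nbhd_vc_free_def
  proof (intro allI impI notI)
    fix Z assume Z: "Z \<subseteq> verts G" "card Z = 2 * 2 ^ (2 * j)" "shatters (nbhd G ` verts G) Z"
    obtain l p where lp: "inj_on l (Pow {..<2 * j})" "inj_on p (Pow {..<2 * j})"
      "l ` Pow {..<2 * j} \<subseteq> verts G" "p ` Pow {..<2 * j} \<subseteq> verts G" "l ` Pow {..<2 * j} \<inter> p ` Pow {..<2 * j} = {}"
      and edge: "\<And>x y. x \<subseteq> {..<2 * j} \<Longrightarrow> y \<subseteq> {..<2 * j} \<Longrightarrow> {l x, p y} \<in> edges G \<longleftrightarrow> walsh x y = - 1"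
      using shattered_inner_product[OF simple[OF G] Z] by metis
    define U where "U = l ` Pow {..<2 * j} \<union> p ` Pow {..<2 * j}"
    define H where "H = induced_subgraph G U"
    have "U \<subseteq> verts G"
      using lp(3,4) by (simp add: U_def)
    then have H: "H \<in> C"
      using her G unfolding hereditary_def H_def by simp
    have vH: "verts H = U"
      by (simp add: H_def induced_subgraph_def)
    have "card U = 2 ^ (2 * j) + 2 ^ (2 * j)"
      unfolding U_def using lp by (subst card_Un_disjoint) (auto simp: card_image card_Pow)
    then have cU: "card U = 2 ^ (2 * j + 1)"
      by simp
    have "j < 2 ^ j"
      by (rule less_exp)
    also have "\<dots> \<le> (2::nat) ^ (2 * j + 1)"
      by (intro power_increasing) auto
    finally have "n0 \<le> card (verts H)"
      using j vH cU by simp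
    then have "real (pmw 3 H) \<le> real (2 ^ (2 * j + 1)) powr (1 / 4)"
      using n0[OF H] vH cU by simp
    also have "\<dots> = 2 powr (real (2 * j + 1) / 4)"
    proof -
      have "real (2 ^ (2 * j + 1)) = 2 powr real (2 * j + 1)"
        by (subst powr_realpow) auto
      then show ?thesis
        by (simp only: powr_powr) simp
    qed
    also have "\<dots> < 2 powr (real (j - 2))"
      using j by (intro powr_less_mono) auto
    also have "\<dots> = real (2 ^ (j - 2))"
      by (simp add: powr_realpow)
    finally have "pmw 3 H < 2 ^ (j - 2)"
      by (simp only: of_nat_less_iff)
    moreover have "2 ^ (j - 2) \<le> pmw 3 H"
    proof (rule inner_product_pmw_lower[OF simple[OF H] _ lp(1,2) _ lp(5)])
      fix x y assume "x \<subseteq> {..<2 * j}" "y \<subseteq> {..<2 * j}"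
      then show "{l x, p y} \<in> edges H \<longleftrightarrow> walsh x y = - 1"
        using edge by (auto simp: H_def induced_subgraph_def U_def)
    qed (use vH j in \<open>auto simp: U_def\<close>)
    ultimately show False by simp
  qed
  then show ?thesis
    using that by blast
qed

section \<open>From partition merge-width to merge-width\<close>

text \<open>\<open>T\<close> contains the members of \<open>S\<close> that matter locally: those in
  \<open>W\<close> and those telling apart two vertices of \<open>W\<close> in one part. Outside
  \<open>S\<close>, the part and the trace on \<open>T\<close> determine the label on all of
  \<open>S\<close>; the vertices of \<open>W\<close> in \<open>S\<close> are counted one by
  one.\<close>

lemma card_image_traces_le:
  assumes fin: "finite (verts G)" and W: "W \<subseteq> verts G" and P: "partition_on (verts G) P"
    and T: "T \<subseteq> verts G" "W \<inter> S \<subseteq> T"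
    and dist: "\<And>x x' s. x \<in> W \<Longrightarrow> x' \<in> W \<Longrightarrow> part_label P x = part_label P x' \<Longrightarrow> s \<in> S \<Longrightarrow>
      (s \<in> nbhd G x) \<noteq> (s \<in> nbhd G x') \<Longrightarrow> s \<in> T"
    and f: "\<And>x x'. x \<in> W \<Longrightarrow> x' \<in> W \<Longrightarrow> part_label P x = part_label P x' \<Longrightarrow>
      nbhd_label G S x = nbhd_label G S x' \<Longrightarrow> f x = f x'"
  shows "card (f ` W) \<le> card T + card (parts_meeting W P) * card ((\<lambda>x. nbhd G x \<inter> T) ` verts G)"
proof -
  define g where "g x = (if x \<in> S then Inl x else Inr (part_label P x, nbhd G x \<inter> T))" for x
  have finW: "finite W" "finite T"
    using fin W T by (auto intro: finite_subset)
  have "f x = f x'" if x: "x \<in> W" "x' \<in> W" "g x = g x'" for x x'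
  proof (cases "x \<in> S")
    case True
    then have "x = x'"
      using x(3) by (auto simp: g_def split: if_splits)
    then show ?thesis by simp
  next
    case False
    then have x': "x' \<notin> S" "part_label P x = part_label P x'" "nbhd G x \<inter> T = nbhd G x' \<inter> T"
      using x(3) by (auto simp: g_def split: if_splits)
    have "s \<in> nbhd G x \<longleftrightarrow> s \<in> nbhd G x'" if "s \<in> S" for s
      using dist[OF x(1,2) x'(2) that] x'(3) by blast
    then have "nbhd_label G S x = nbhd_label G S x'"
      using False x'(1) by (auto simp: nbhd_label_def)
    then show ?thesis
      using f x x' by blast
  qed
  then have "card (f ` W) \<le> card (g ` W)"
    using finW by (intro card_image_le_factor)
  also have "\<dots> \<le> card (Inl ` T \<union> Inr ` (part_label P ` W \<times> (\<lambda>x. nbhd G x \<inter> T) ` verts G))"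
    using finW fin W T by (intro card_mono) (auto simp: g_def)
  also have "\<dots> \<le> card (Inl ` T :: ('a + ('a set set \<times> 'a set)) set) +
      card (Inr ` (part_label P ` W \<times> (\<lambda>x. nbhd G x \<inter> T) ` verts G) :: ('a + ('a set set \<times> 'a set)) set)"
    by (rule card_Un_le)
  also have "\<dots> = card T + card (part_label P ` W) * card ((\<lambda>x. nbhd G x \<inter> T) ` verts G)"
    by (simp add: card_image card_cartesian_product)
  finally show ?thesis
    by (simp add: card_parts_meeting[OF P W])
qed

lemma nbhd_label_eqD:
  assumes "nbhd_label G S x = nbhd_label G S x'" "x \<noteq> x'"
  shows "x \<notin> S" "x' \<notin> S" "s \<in> S \<Longrightarrow> {x, s} \<in> edges G \<longleftrightarrow> {x', s} \<in> edges G"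
  using assms by (auto simp: nbhd_label_def nbhd_def split: if_splits)

text \<open>If \<open>xy\<close> is an edge and \<open>x'y'\<close> a non-edge, both at flip distance more than 3, then the
  flip separating \<open>x\<close> from \<open>y\<close> complements the pair of parts and the one separating \<open>x'\<close>
  from \<open>y'\<close> does not. Avoiding walks of length 3 in both forces \<open>x\<close>, \<open>x'\<close> (or \<open>y\<close>, \<open>y'\<close>) to have
  complementary neighbourhoods in the opposite part, so any representative tells them apart.\<close>

lemma far_pairs_agree:
  assumes G: "simple_graph G" and P: "partition_on (verts G) P"
    and A: "A \<in> P" "x \<in> A" "x' \<in> A" "a \<in> A" "a \<in> S"
    and B: "B \<in> P" "y \<in> B" "y' \<in> B" "b \<in> B" "b \<in> S"
    and eq: "nbhd_label G S x = nbhd_label G S x'" "nbhd_label G S y = nbhd_label G S y'"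
    and e: "{x, y} \<in> edges G" and e': "x' \<noteq> y'" "{x', y'} \<notin> edges G"
    and far: "\<not> pdist G P x y \<le> enat 3" "\<not> pdist G P x' y' \<le> enat 3"
  shows False
proof -
  obtain F1 where F1: "F1 \<subseteq> P \<times> P" "\<not> gdist (flip F1 G) x y \<le> enat 3"
    using far(1) by (auto simp: pdist_le_iff)
  obtain F2 where F2: "F2 \<subseteq> P \<times> P" "\<not> gdist (flip F2 G) x' y' \<le> enat 3"
    using far(2) by (auto simp: pdist_le_iff)
  have ne: "u \<noteq> w" if "{u, w} \<in> edges G" for u w
    using simple_graph_edgeD[OF G that] by blast
  have "{x, y} \<notin> edges (flip F1 G)"
    using F1(2) gdist_mono_radius[OF gdist_edge, of x y _ 3] by auto
  \<comment> \<open>The first flip must complement the pair of parts, so its non-edges in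
    \<open>G\<close> become edges; the second must not, so edges of \<open>G\<close> survive
    there.\<close>
  then have "(A, B) \<in> F1 \<or> (B, A) \<in> F1"
    using edges_flip_iff[OF P F1(1) A(1) B(1) A(2) B(2) ne[OF e]] e by blast
  then have f1: "{u, w} \<in> edges (flip F1 G)" if "u \<in> A" "w \<in> B" "u \<noteq> w" "{u, w} \<notin> edges G" for u w
    using edges_flip_iff[OF P F1(1) A(1) B(1) that(1-3)] that(4) by blast
  have "{x', y'} \<notin> edges (flip F2 G)"
    using F2(2) gdist_mono_radius[OF gdist_edge, of x' y' _ 3] by auto
  then have "\<not> ((A, B) \<in> F2 \<or> (B, A) \<in> F2)"
    using edges_flip_iff[OF P F2(1) A(1) B(1) A(3) B(3) e'(1)] e'(2) by blast
  then have f2: "{u, w} \<in> edges (flip F2 G)" if "u \<in> A" "w \<in> B" "{u, w} \<in> edges G" for u w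
    using edges_flip_iff[OF P F2(1) A(1) B(1) that(1,2) ne[OF that(3)]] that(3) by blast
  have walk3: "gdist H u z \<le> enat 3"
    if "{u, p} \<in> edges H" "{q, p} \<in> edges H" "{q, z} \<in> edges H" for H :: "'a graph" and u p q z
  proof -
    have "gdist H u z \<le> enat (1 + 1 + 1)"
      using that by (intro gdist_triangle_le[of _ u q] gdist_triangle_le[of _ u p] gdist_edge) (auto simp: insert_commute)
    then show ?thesis by (simp add: numeral_3_eq_3)
  qed
  have walk2: "gdist H u z \<le> enat 3"
    if "{u, p} \<in> edges H" "{p, z} \<in> edges H" for H :: "'a graph" and u p z
  proof -
    have "gdist H u z \<le> enat (1 + 1)"
      using that by (intro gdist_triangle_le[of _ u p] gdist_edge)
    then show ?thesis
      by (rule gdist_mono_radius) simp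
  qed
  have no1: False if "p \<in> B" "q \<in> A" "x \<noteq> p" "{x, p} \<notin> edges G" "q \<noteq> p" "{q, p} \<notin> edges G" "q \<noteq> y" "{q, y} \<notin> edges G" for p q
    using F1(2) walk3[of x p "flip F1 G" q y] f1 that A B by blast
  have no2: False if "p \<in> B" "q \<in> A" "{x', p} \<in> edges G" "{q, p} \<in> edges G" "{q, y'} \<in> edges G" for p q
    using F2(2) walk3[of x' p "flip F2 G" q y'] f2 that A B by blast
  \<comment> \<open>If \<open>x = y'\<close> or \<open>x' = y\<close>, the two parts coincide and
    the walks of length 3 degenerate; walks of length 2 replace them.\<close>
  have short1: False if "p \<in> A" "p \<in> B" "x \<noteq> p" "{x, p} \<notin> edges G" "p \<noteq> y" "{p, y} \<notin> edges G" for p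
    using F1(2) walk2[of x p "flip F1 G" y] f1 that A B by blast
  have short2: False if "p \<in> A" "p \<in> B" "{x', p} \<in> edges G" "{p, y'} \<in> edges G" for p
    using F2(2) walk2[of x' p "flip F2 G" y'] f2 that A B by blast
  consider "x = y'" | "x' = y" | "x \<noteq> y'" "x' \<noteq> y" by blast
  then show False
  proof cases
    case 1
    then have "x' \<noteq> y"
      using e e' by (auto simp: insert_commute)
    have AB: "x' \<in> B" "y \<in> A"
      using 1 A B partition_on_unique[OF P A(1) B(1)] by blast+
    show False
    proof (cases "{x', y} \<in> edges G")
      case True
      then show False
        using short2[of y] AB B e 1 by (simp add: insert_commute)
    next
      case False
      then show False
        using short1[of x'] AB A e' 1 \<open>x' \<noteq> y\<close> by (auto simp: insert_commute)
    qed
  next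
    case 2
    then have "x \<noteq> y'"
      using e e' by (auto simp: insert_commute)
    have AB: "x \<in> B" "y' \<in> A"
      using 2 A B partition_on_unique[OF P A(1) B(1)] by blast+
    show False
    proof (cases "{x, y'} \<in> edges G")
      case True
      then show False
        using short2[of x] AB A e 2 by (simp add: insert_commute)
    next
      case False
      then show False
        using short1[of y'] AB B e' 2 \<open>x \<noteq> y'\<close> by (auto simp: insert_commute)
    qed
  next
    case 3
    consider "{x, y'} \<in> edges G" "{x', y} \<in> edges G" | "{x, y'} \<notin> edges G" "{x', y} \<notin> edges G" |
      "{x, y'} \<in> edges G" "{x', y} \<notin> edges G" | "{x, y'} \<notin> edges G" "{x', y} \<in> edges G" by blast
    then show False
    proof cases
      case 1
      then show False using no2[of y x] A B e by blast
    next
      case 2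
      then show False using no1[of y' x'] 3 A B e' by blast
    next
      case c: 3
      then have "x \<noteq> x'" using e by auto
      note eqs = nbhd_label_eqD[OF eq(1) this]
      \<comment> \<open>If \<open>b\<close> is adjacent to both \<open>x\<close> and
        \<open>x'\<close>, the second flip has the walk \<open>x' b x y'\<close>; if to neither, the
        first flip has the walk \<open>x b x' y\<close>.\<close>
      have "x \<noteq> b" "x' \<noteq> b" using eqs B by blast+
      then show False
        using no1[of b x'] no2[of b x] eqs(3)[OF B(5)] 3 c A B by blast
    next
      case 4
      then have "y \<noteq> y'" using e by auto
      note eqs = nbhd_label_eqD[OF eq(2) this]
      have "y \<noteq> a" "y' \<noteq> a" using eqs A by blast+
      moreover have "{a, y} \<in> edges G \<longleftrightarrow> {a, y'} \<in> edges G"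
        using eqs(3)[OF A(5)] by (simp add: insert_commute)
      ultimately show False
        using no1[of y' a] no2[of y a] 3 4 A B by blast
    qed
  qed
qed

section \<open>The merge sequence built from a partition chain\<close>

definition short_pairs :: "'a graph \<Rightarrow> 'a set set \<Rightarrow> 'a set set" where
  "short_pairs G P = {{x, y} | x y. x \<in> verts G \<and> y \<in> verts G \<and> x \<noteq> y \<and> pdist G P x y \<le> enat 3}"

lemma short_pairs_iff:
  "{x, y} \<in> short_pairs G P \<longleftrightarrow> x \<in> verts G \<and> y \<in> verts G \<and> x \<noteq> y \<and> pdist G P x y \<le> enat 3"
  unfolding short_pairs_def by (auto simp: doubleton_eq_iff pdist_commute)

definition trace_refinement :: "'a graph \<Rightarrow> 'a set set \<Rightarrow> 'a set \<Rightarrow> 'a set set" where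
  "trace_refinement G P S = fibers (\<lambda>x. (part_label P x, nbhd_label G S x)) (verts G)"

text \<open>Two conflicting far pairs between the same classes would have equal labels on
  \<open>S\<close>; \<open>reps\<close> supplies the representatives with which
  \<open>far_pairs_agree\<close> excludes this.\<close>

lemma homogeneous_mod_short_pairs:
  assumes G: "simple_graph G" and P: "partition_on (verts G) P"
    and reps: "\<And>A. A \<in> P \<Longrightarrow> A \<inter> S \<noteq> {}"
  shows "homogeneous_mod G (trace_refinement G P S) (short_pairs G P)"
  unfolding homogeneous_mod_def
proof (intro ballI)
  fix X Y assume X: "X \<in> trace_refinement G P S" and Y: "Y \<in> trace_refinement G P S"
  show "(\<forall>x\<in>X. \<forall>y\<in>Y. x \<noteq> y \<and> {x, y} \<notin> short_pairs G P \<longrightarrow> {x, y} \<in> edges G) \<or>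
        (\<forall>x\<in>X. \<forall>y\<in>Y. x \<noteq> y \<and> {x, y} \<notin> short_pairs G P \<longrightarrow> {x, y} \<notin> edges G)"
  proof (rule ccontr)
    assume "\<not> ?thesis"
    then obtain x y x' y' where xy: "x \<in> X" "y \<in> Y" "x \<noteq> y" "{x, y} \<notin> short_pairs G P" "{x, y} \<in> edges G"
      and xy': "x' \<in> X" "y' \<in> Y" "x' \<noteq> y'" "{x', y'} \<notin> short_pairs G P" "{x', y'} \<notin> edges G"
      by blast
    have x: "x \<in> verts G" "x' \<in> verts G" "part_label P x = part_label P x'" "nbhd_label G S x = nbhd_label G S x'"
      using same_fiber[OF X[unfolded trace_refinement_def] xy(1) xy'(1)] by auto
    have y: "y \<in> verts G" "y' \<in> verts G" "part_label P y = part_label P y'" "nbhd_label G S y = nbhd_label G S y'"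
      using same_fiber[OF Y[unfolded trace_refinement_def] xy(2) xy'(2)] by auto
    obtain A where A: "A \<in> P" "x \<in> A" "x' \<in> A"
      using x part_label_eq_iff[OF P] by blast
    obtain B where B: "B \<in> P" "y \<in> B" "y' \<in> B"
      using y part_label_eq_iff[OF P] by blast
    obtain a b where ab: "a \<in> A" "a \<in> S" "b \<in> B" "b \<in> S"
      using reps A(1) B(1) by blast
    have far: "\<not> pdist G P x y \<le> enat 3" "\<not> pdist G P x' y' \<le> enat 3"
      using xy xy' x y by (auto simp: short_pairs_iff)
    show False
      by (rule far_pairs_agree[OF G P A ab(1,2) B ab(3,4) x(4) y(4) xy(5) xy'(3,5) far])
  qed
qed

text \<open>Each short pair advances the flip distance by at most 3.\<close>

lemma gball_short_pairs_subset:
  assumes "v \<in> verts G"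
  shows "gball r \<lparr>verts = verts G, edges = short_pairs G P\<rparr> v \<subseteq> pball (3 * r) G P v"
proof
  let ?H = "\<lparr>verts = verts G, edges = short_pairs G P\<rparr>"
  have walk: "(v, u) \<in> adj ?H ^^ k \<Longrightarrow> pdist G P v u \<le> enat (3 * k)" for k u
  proof (induction k arbitrary: u)
    case 0
    then show ?case by (simp add: zero_enat_def[symmetric])
  next
    case (Suc k)
    then obtain w where "(v, w) \<in> adj ?H ^^ k" "(w, u) \<in> adj ?H"
      by auto
    then have "pdist G P v u \<le> enat (3 * k + 3)"
      using Suc.IH by (intro pdist_triangle_le[of _ _ v w]) (auto simp: adj_def short_pairs_iff)
    then show ?case by (simp add: add.commute)
  qed
  fix u assume "u \<in> gball r ?H v"
  then obtain k where "k \<le> r" "(v, u) \<in> adj ?H ^^ k" "u \<in> verts G"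
    by (auto simp: gball_def gdist_le_iff)
  then show "u \<in> pball (3 * r) G P v"
    using pdist_mono_radius[OF walk] by (auto simp: pball_def)
qed

text \<open>A vertex distinguishing two close vertices of the same part is close to both of them, because
  in every flip it is adjacent to one of them.\<close>

lemma pdist_distinguisher:
  assumes P: "partition_on (verts G) P" and A: "A \<in> P" "x \<in> A" "x' \<in> A"
    and s: "s \<in> verts G" "({x, s} \<in> edges G) \<noteq> ({x', s} \<in> edges G)" "s \<noteq> x" "s \<noteq> x'"
    and d: "pdist G P x x' \<le> enat c"
  shows "pdist G P x s \<le> enat (c + 1)"
  unfolding pdist_le_iff
proof (intro allI impI)
  fix F assume F: "F \<subseteq> P \<times> P"
  obtain B where B: "B \<in> P" "s \<in> B"
    using P s(1) by (meson partition_on_obtain)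
  have "{x, s} \<in> edges (flip F G) \<or> {x', s} \<in> edges (flip F G)"
    using edges_flip_iff[OF P F A(1) B(1) A(2) B(2)] edges_flip_iff[OF P F A(1) B(1) A(3) B(2)] s by auto
  then show "gdist (flip F G) x s \<le> enat (c + 1)"
  proof
    assume "{x, s} \<in> edges (flip F G)"
    then show ?thesis
      by (rule gdist_mono_radius[OF gdist_edge]) simp
  next
    assume e: "{x', s} \<in> edges (flip F G)"
    have "gdist (flip F G) x x' \<le> enat c"
      using d F by (auto simp: pdist_le_iff)
    then show ?thesis
      using e by (intro gdist_triangle_le gdist_edge)
  qed
qed

text \<open>A fixed numbering \<open>f\<close> makes the choices coherent: the least vertex of a
  coarse part is also least in the fine part containing it, so the representatives shrink as the
  partition coarsens.\<close>

definition min_reps :: "('a \<Rightarrow> nat) \<Rightarrow> 'a set set \<Rightarrow> 'a set" where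
  "min_reps f P = {v \<in> \<Union>P. \<forall>A\<in>P. v \<in> A \<longrightarrow> (\<forall>u\<in>A. f v \<le> f u)}"

lemma min_repsI:
  "v \<in> \<Union>P \<Longrightarrow> (\<And>A u. A \<in> P \<Longrightarrow> v \<in> A \<Longrightarrow> u \<in> A \<Longrightarrow> f v \<le> f u) \<Longrightarrow> v \<in> min_reps f P"
  by (simp add: min_reps_def)

lemma min_repsD: "v \<in> min_reps f P \<Longrightarrow> A \<in> P \<Longrightarrow> v \<in> A \<Longrightarrow> u \<in> A \<Longrightarrow> f v \<le> f u"
  by (simp add: min_reps_def)

lemma min_reps_nonempty:
  assumes P: "partition_on V P" and A: "A \<in> P"
  shows "A \<inter> min_reps f P \<noteq> {}"
proof -
  have "A \<noteq> {}"
    using P A partition_onD3 by blast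
  then obtain v where v: "v \<in> A" "\<And>u. u \<in> A \<Longrightarrow> f v \<le> f u"
    using ex_has_least_nat[of "\<lambda>v. v \<in> A" _ f] by blast
  have "v \<in> min_reps f P"
  proof (rule min_repsI)
    fix B u assume "B \<in> P" "v \<in> B" "u \<in> B"
    moreover from this have "B = A"
      using partition_on_unique[OF P _ A] v(1) by simp
    ultimately show "f v \<le> f u"
      using v(2) by simp
  qed (use A v(1) in blast)
  then show ?thesis using v(1) by blast
qed

lemma min_reps_antimono:
  assumes "refines V P P'"
  shows "min_reps f P' \<subseteq> min_reps f P"
proof
  fix v assume v: "v \<in> min_reps f P'"
  have P: "partition_on V P" and P': "partition_on V P'"
    using assms by (auto simp: refines_def)
  have "v \<in> \<Union>P"
    using v partition_onD1[OF P] partition_onD1[OF P'] by (auto simp: min_reps_def)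
  moreover have "f v \<le> f u" if "A \<in> P" "v \<in> A" "u \<in> A" for A u
  proof -
    obtain A' where "A' \<in> P'" "A \<subseteq> A'"
      using assms \<open>A \<in> P\<close> unfolding refines_def by metis
    then show ?thesis
      using min_repsD[OF v, of A' u] that by auto
  qed
  ultimately show "v \<in> min_reps f P"
    by (rule min_repsI)
qed

lemma card_min_reps_le:
  assumes fin: "finite V" and P: "partition_on V P" and f: "inj_on f V" and W: "W \<subseteq> V"
  shows "card (min_reps f P \<inter> W) \<le> card (parts_meeting W P)"
proof -
  have "inj_on (part_label P) (min_reps f P \<inter> W)"
  proof (rule inj_onI)
    fix x y assume xy: "x \<in> min_reps f P \<inter> W" "y \<in> min_reps f P \<inter> W" "part_label P x = part_label P y"
    then obtain A where "A \<in> P" "x \<in> A" "y \<in> A"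
      using part_label_eq_iff[OF P, of x y] W by auto
    then have "f x = f y"
      using xy min_repsD[of x f P A y] min_repsD[of y f P A x] by auto
    then show "x = y"
      using f W xy by (auto dest: inj_onD)
  qed
  then have "card (min_reps f P \<inter> W) = card (part_label P ` (min_reps f P \<inter> W))"
    by (simp add: card_image)
  also have "\<dots> \<le> card (part_label P ` W)"
    using finite_subset[OF W fin] by (intro card_mono) auto
  finally show ?thesis
    by (simp add: card_parts_meeting[OF P W])
qed

lemma partition_on_trace_refinement: "partition_on (verts G) (trace_refinement G P S)"
  unfolding trace_refinement_def by (rule partition_on_fibers)

lemma refines_trace_refinement:
  assumes "refines (verts G) P P'" "S' \<subseteq> S"
  shows "refines (verts G) (trace_refinement G P S) (trace_refinement G P' S')"
  unfolding trace_refinement_def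
proof (rule refines_fibers)
  fix x y assume "x \<in> verts G" "(part_label P x, nbhd_label G S x) = (part_label P y, nbhd_label G S y)"
  then show "(part_label P' x, nbhd_label G S' x) = (part_label P' y, nbhd_label G S' y)"
    using refines_part_label[OF assms(1), of x y] nbhd_label_mono[OF assms(2), of G x y] by auto
qed

lemma short_pairs_mono:
  assumes "refines (verts G) P P'" shows "short_pairs G P \<subseteq> short_pairs G P'"
proof
  fix e assume "e \<in> short_pairs G P"
  then obtain x y where "e = {x, y}" "x \<in> verts G" "y \<in> verts G" "x \<noteq> y" "pdist G P x y \<le> enat 3"
    by (auto simp: short_pairs_def)
  then show "e \<in> short_pairs G P'"
    using order_trans[OF pdist_antimono[OF assms]] by (simp add: short_pairs_iff)
qed

text \<open>Bounded VC dimension enters here: at most \<open>k\<close> representatives are near the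
  ball, and they leave at most \<open>(k + 1) ^ d\<close> traces on each of at most \<open>k\<close>
  parts.\<close>

lemma card_trace_refinement_pball_le:
  assumes G: "simple_graph G" and ref: "refines (verts G) P P'" and vc: "nbhd_vc_free d G"
    and f: "inj_on f (verts G)" and v: "v \<in> verts G"
    and k: "card (parts_meeting (pball (9 * r + 1) G P' v) P) \<le> k"
  shows "card (parts_meeting (pball (3 * r) G P' v) (trace_refinement G P (min_reps f P)))
    \<le> 2 * (1 + k) ^ (d + 1)"
proof -
  let ?S = "min_reps f P" and ?W = "pball (3 * r) G P' v"
  \<comment> \<open>A representative telling apart two vertices of the ball is within
    \<open>6 * r + 1\<close> of one of them, hence within \<open>9 * r + 1\<close> of
    \<open>v\<close>.\<close>
  let ?T = "min_reps f P \<inter> pball (9 * r + 1) G P' v"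
  let ?f = "\<lambda>x. (part_label P x, nbhd_label G ?S x)"
  have fin: "finite (verts G)"
    using G by (simp add: simple_graph_def)
  have P: "partition_on (verts G) P" and P': "partition_on (verts G) P'"
    using ref by (auto simp: refines_def)
  have WT: "?W \<subseteq> pball (9 * r + 1) G P' v"
    using pdist_mono_radius[of G P' v _ "3 * r" "9 * r + 1"] by (auto simp: pball_def)
  have "card (parts_meeting ?W (trace_refinement G P ?S)) = card (?f ` ?W)"
    unfolding trace_refinement_def by (intro card_parts_meeting_fibers pball_subset_verts)
  also have "\<dots> \<le> card ?T + card (parts_meeting ?W P) * card ((\<lambda>x. nbhd G x \<inter> ?T) ` verts G)"
  proof (rule card_image_traces_le[OF fin pball_subset_verts P, where S = ?S])
    fix x x' s
    assume x: "x \<in> ?W" "x' \<in> ?W" "part_label P x = part_label P x'" and s: "s \<in> ?S"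
      and neq: "(s \<in> nbhd G x) \<noteq> (s \<in> nbhd G x')"
    have sV: "s \<in> verts G"
      using s partition_onD1[OF P] by (auto simp: min_reps_def)
    have xV: "x \<in> verts G" and dx: "pdist G P' v x \<le> enat (3 * r)" "pdist G P' v x' \<le> enat (3 * r)"
      using x by (auto simp: pball_def)
    show "s \<in> ?T"
    proof (cases "s = x \<or> s = x'")
      case True
      then show ?thesis using WT x s by auto
    next
      case False
      \<comment> \<open>Distances are measured for the coarser \<open>P'\<close>, so the
        distinguisher argument needs a common part there.\<close>
      have "part_label P' x = part_label P' x'"
        using refines_part_label[OF ref xV x(3)] .
      then obtain A where A: "A \<in> P'" "x \<in> A" "x' \<in> A"
        using part_label_eq_iff[OF P' xV] by blast
      have "pdist G P' x x' \<le> enat (3 * r + 3 * r)"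
        using dx by (intro pdist_triangle_le[of G P' x v]) (auto simp: pdist_commute)
      then have "pdist G P' x s \<le> enat (3 * r + 3 * r + 1)"
        using neq False by (intro pdist_distinguisher[OF P' A sV]) (auto simp: nbhd_def)
      then have "pdist G P' v s \<le> enat (3 * r + (3 * r + 3 * r + 1))"
        by (rule pdist_triangle_le[OF dx(1)])
      then show ?thesis
        using s sV by (simp add: pball_def)
    qed
  qed (use WT in \<open>auto simp: pball_def\<close>)
  also have "\<dots> \<le> k + k * (k + 1) ^ d"
  proof (intro add_mono mult_mono)
    have "card ?T \<le> card (parts_meeting (pball (9 * r + 1) G P' v) P)"
      by (intro card_min_reps_le[OF fin P f] pball_subset_verts)
    then show T: "card ?T \<le> k"
      using k by simp
    have "card (parts_meeting ?W P) \<le> card (parts_meeting (pball (9 * r + 1) G P' v) P)"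
      by (intro card_parts_meeting_mono[OF fin P] WT)
    then show "card (parts_meeting ?W P) \<le> k"
      using k by simp
    have "card ((\<lambda>x. nbhd G x \<inter> ?T) ` verts G) \<le> (card ?T + 1) ^ d"
      using pball_subset_verts[of "9 * r + 1" G P' v] by (intro card_traces_le[OF fin vc]) auto
    also have "\<dots> \<le> (k + 1) ^ d"
      using T by (intro power_mono) auto
    finally show "card ((\<lambda>x. nbhd G x \<inter> ?T) ` verts G) \<le> (k + 1) ^ d" .
  qed auto
  also have "\<dots> \<le> 2 * (1 + k) ^ (d + 1)"
  proof -
    have "(1 + k) ^ 1 \<le> (1 + k) ^ (d + 1)"
      by (intro power_increasing) auto
    moreover have "k * (k + 1) ^ d \<le> (1 + k) ^ (d + 1)"
      by (simp add: add.commute)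
    ultimately show ?thesis
      by (simp only: power_one_right)
  qed
  finally show ?thesis .
qed

text \<open>The classes are the representative, its neighbours and its non-neighbours.\<close>

lemma card_trace_refinement_trivial:
  assumes fin: "finite (verts G)" and ne: "verts G \<noteq> {}" and f: "inj_on f (verts G)" and W: "W \<subseteq> verts G"
  shows "card (parts_meeting W (trace_refinement G {verts G} (min_reps f {verts G}))) \<le> 3"
proof -
  let ?P = "{verts G}" and ?S = "min_reps f {verts G}"
  let ?f = "\<lambda>x. (part_label ?P x, nbhd_label G ?S x)"
  have P: "partition_on (verts G) ?P"
    using ne by (rule partition_on_space)
  have S: "?S \<subseteq> verts G" "finite ?S"
    using fin by (auto simp: min_reps_def)
  have one: "card (parts_meeting W' ?P) \<le> 1" for W'
    using card_mono[of ?P "parts_meeting W' ?P"] by (auto simp: parts_meeting_def)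
  have "card (?S \<inter> verts G) \<le> card (parts_meeting (verts G) ?P)"
    by (rule card_min_reps_le[OF fin P f]) simp
  then have cS: "card ?S \<le> 1"
    using one[of "verts G"] S by (simp add: Int_absorb2)
  have "card (parts_meeting W (trace_refinement G ?P ?S)) = card (?f ` W)"
    unfolding trace_refinement_def by (intro card_parts_meeting_fibers W)
  also have "\<dots> \<le> card ?S + card (parts_meeting W ?P) * card ((\<lambda>x. nbhd G x \<inter> ?S) ` verts G)"
    by (rule card_image_traces_le[OF fin W P, where S = ?S]) (use S in auto)
  also have "\<dots> \<le> 1 + 1 * 2"
  proof (intro add_mono mult_mono cS one)
    have "card ((\<lambda>x. nbhd G x \<inter> ?S) ` verts G) \<le> card (Pow ?S)"
      using S by (intro card_mono) auto
    also have "\<dots> \<le> 2 ^ 1"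
      unfolding card_Pow[OF S(2)] using cS by (intro power_increasing) auto
    finally show "card ((\<lambda>x. nbhd G x \<inter> ?S) ` verts G) \<le> 2"
      by simp
  qed auto
  finally show ?thesis by simp
qed

lemma mw_le_pmw:
  assumes G: "simple_graph G" and ne: "verts G \<noteq> {}" and vc: "nbhd_vc_free d G"
  shows "mw r G \<le> 3 * (1 + pmw (9 * r + 1) G) ^ (d + 1)"
proof -
  have fin: "finite (verts G)"
    using G by (simp add: simple_graph_def)
  define k where "k = pmw (9 * r + 1) G"
  from pmw_attained[OF ne, of "9 * r + 1"]
  obtain m P where chain: "partition_chain (verts G) m P" and w: "k = chain_width (9 * r + 1) G m P"
    unfolding k_def .
  obtain f :: "'a \<Rightarrow> nat" where f: "inj_on f (verts G)"
    using finite_imp_inj_to_nat_seg[OF fin] by blast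
  have m: "1 \<le> m" and P1: "P 1 = (\<lambda>v. {v}) ` verts G" and Pm: "P m = {verts G}"
    and Pt: "\<And>t. t \<in> {1..m} \<Longrightarrow> partition_on (verts G) (P t)"
    and ref: "\<And>t. t \<in> {1..<m} \<Longrightarrow> refines (verts G) (P t) (P (t + 1))"
    using chain by (auto simp: partition_chain_def)
  \<comment> \<open>The refinement of the last partition may still have several parts, so one
    further step with all pairs in \<open>R\<close> closes the sequence.\<close>
  define Q where "Q t = (if t \<le> m then trace_refinement G (P t) (min_reps f (P t)) else {verts G})" for t
  define R where "R t = (if t \<le> m then short_pairs G (P t) else [verts G]\<^bsup>2\<^esup>)" for t
  have "part_label (P 1) x = {{x}}" if "x \<in> verts G" for x
    unfolding P1 part_label_def using that by auto
  then have "inj_on (\<lambda>x. (part_label (P 1) x, nbhd_label G (min_reps f (P 1)) x)) (verts G)"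
    by (intro inj_onI) simp
  then have Q1: "Q 1 = (\<lambda>v. {v}) ` verts G"
    using m by (simp add: Q_def trace_refinement_def fibers_inj)
  have Qpart: "partition_on (verts G) (Q t)" for t
    using partition_on_trace_refinement partition_on_space[OF ne] by (auto simp: Q_def)
  have "merge_sequence G (m + 1) Q R"
    unfolding merge_sequence_def partition_chain_def
  proof (intro conjI ballI)
    fix t assume t: "t \<in> {1..<m + 1}"
    show "refines (verts G) (Q t) (Q (t + 1))"
    proof (cases "t = m")
      case True
      then show ?thesis
        using Qpart[of t] Qpart[of "t + 1"] partition_onD1[OF Qpart[of t]]
        by (auto simp: refines_def Q_def)
    next
      case False
      then have "t \<in> {1..<m}"
        using t by auto
      then show ?thesis
        using refines_trace_refinement[OF ref min_reps_antimono[OF ref]] by (simp add: Q_def)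
    qed
    show "R t \<subseteq> R (t + 1)"
    proof (cases "t = m")
      case True
      then show ?thesis
        by (auto simp: R_def short_pairs_def)
    next
      case False
      then have "t \<in> {1..<m}"
        using t by auto
      then show ?thesis
        using short_pairs_mono[OF ref] by (simp add: R_def)
    qed
  next
    fix t assume t: "t \<in> {1..m + 1}"
    show "R t \<subseteq> [verts G]\<^bsup>2\<^esup>"
      by (auto simp: R_def short_pairs_def)
    show "homogeneous_mod G (Q t) (R t)"
    proof (cases "t \<le> m")
      case True
      then show ?thesis
        using homogeneous_mod_short_pairs[OF G Pt min_reps_nonempty[OF Pt]] t by (simp add: Q_def R_def)
    next
      case False
      then show ?thesis
        by (simp add: Q_def R_def homogeneous_mod_def)
    qed
  qed (use Q1 Qpart in \<open>auto simp: Q_def\<close>)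
  moreover have "merge_sequence_width r G (m + 1) Q R \<le> 3 * (1 + k) ^ (d + 1)"
  proof (rule merge_sequence_width_le)
    fix t v assume t: "t \<in> {1..<m + 1}" and v: "v \<in> verts G"
    let ?W = "gball r \<lparr>verts = verts G, edges = R (t + 1)\<rparr> v"
    have WV: "?W \<subseteq> verts G"
      using gball_subset_verts[of r "\<lparr>verts = verts G, edges = R (t + 1)\<rparr>"] by simp
    show "card (parts_meeting ?W (Q t)) \<le> 3 * (1 + k) ^ (d + 1)"
    proof (cases "t = m")
      case True
      \<comment> \<open>All pairs belong to \<open>R (m + 1)\<close>, so the ball can be everything;
        the refinement of the trivial partition is small anyway.\<close>
      have "card (parts_meeting ?W (Q t)) \<le> 3"
        using True card_trace_refinement_trivial[OF fin ne f WV] by (simp add: Q_def Pm)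
      also have "\<dots> \<le> 3 * (1 + k) ^ (d + 1)"
        using one_le_power[of "1 + k" "d + 1"] by linarith
      finally show ?thesis .
    next
      case False
      then have t: "t \<in> {1..<m}"
        using t by auto
      then have "?W \<subseteq> pball (3 * r) G (P (t + 1)) v"
        using gball_short_pairs_subset[OF v, of r "P (t + 1)"] by (simp add: R_def)
      then have "card (parts_meeting ?W (Q t)) \<le> card (parts_meeting (pball (3 * r) G (P (t + 1)) v) (Q t))"
        by (intro card_parts_meeting_mono[OF fin Qpart])
      also have "\<dots> \<le> 2 * (1 + k) ^ (d + 1)"
        using card_trace_refinement_pball_le[OF G ref[OF t] vc f v, of r k]
          chain_width_ge[OF fin t v, of "9 * r + 1" P] t by (simp add: Q_def w)
      finally show ?thesis by simp
    qed
  qed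
  ultimately show ?thesis
    using mw_le[of G "m + 1" Q R r] unfolding k_def by (meson order_trans)
qed

section \<open>From merge-width to definable merge-width\<close>

text \<open>Three representatives at pairwise distance more than 2 suffice because a vertex is close to at
  most one of them.\<close>

definition spread_reps :: "'a graph \<Rightarrow> 'a set set \<Rightarrow> 'a set \<Rightarrow> bool" where
  "spread_reps H P S \<longleftrightarrow> S \<subseteq> verts H \<and>
     (\<forall>A\<in>P. card (S \<inter> A) \<le> 3 \<and>
        (\<forall>a\<in>S \<inter> A. \<forall>b\<in>S \<inter> A. a \<noteq> b \<longrightarrow> \<not> gdist H a b \<le> enat 2) \<and>
        (card (S \<inter> A) = 3 \<or> (\<forall>x\<in>A. \<exists>a\<in>S \<inter> A. gdist H x a \<le> enat 2)))"

text \<open>Take a maximal separated set: as long as it has fewer than three elements, a vertex far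
  from all of them could be added.\<close>

lemma extend_spread:
  assumes fin: "finite A" and B0: "B0 \<subseteq> A" "card B0 \<le> 3"
    and sep: "\<And>a b. a \<in> B0 \<Longrightarrow> b \<in> B0 \<Longrightarrow> a \<noteq> b \<Longrightarrow> \<not> gdist H a b \<le> enat 2"
  shows "\<exists>B. B0 \<subseteq> B \<and> B \<subseteq> A \<and> card B \<le> 3 \<and> (\<forall>a\<in>B. \<forall>b\<in>B. a \<noteq> b \<longrightarrow> \<not> gdist H a b \<le> enat 2) \<and>
    (card B = 3 \<or> (\<forall>x\<in>A. \<exists>a\<in>B. gdist H x a \<le> enat 2))"
proof -
  let ?S = "{B. B0 \<subseteq> B \<and> B \<subseteq> A \<and> card B \<le> 3 \<and> (\<forall>a\<in>B. \<forall>b\<in>B. a \<noteq> b \<longrightarrow> \<not> gdist H a b \<le> enat 2)}"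
  have "finite ?S"
    using fin by (intro finite_subset[of ?S "Pow A"]) auto
  moreover have "B0 \<in> ?S"
    using B0 sep by blast
  ultimately have "\<exists>B\<in>?S. B0 \<subseteq> B \<and> (\<forall>B'\<in>?S. B \<subseteq> B' \<longrightarrow> B = B')"
    by (rule finite_has_maximal2)
  then obtain B where B: "B \<in> ?S" and max: "\<forall>B'\<in>?S. B \<subseteq> B' \<longrightarrow> B = B'"
    by (elim bexE conjE) (rule that)
  have "\<exists>a\<in>B. gdist H x a \<le> enat 2" if "card B \<noteq> 3" "x \<in> A" for x
  proof (rule ccontr)
    assume far: "\<not> (\<exists>a\<in>B. gdist H x a \<le> enat 2)"
    have "x \<notin> B"
      using far by (metis gdist_self zero_le)
    have "finite B"
      using B fin by (auto intro: finite_subset)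
    then have "card (insert x B) \<le> 3"
      using B that(1) \<open>x \<notin> B\<close> by simp
    moreover have "\<not> gdist H a b \<le> enat 2" if "a \<in> insert x B" "b \<in> insert x B" "a \<noteq> b" for a b
      using that far B gdist_commute[of H] by auto
    ultimately have "insert x B \<in> ?S"
      using B \<open>x \<in> A\<close> by blast
    then have "B = insert x B"
      using bspec[OF max] by (simp only: subset_insertI simp_thms)
    then show False using \<open>x \<notin> B\<close> by blast
  qed
  then show ?thesis
    using B by (intro exI[of _ B]) blast
qed

text \<open>With fewer edges distances only grow, so the old representatives stay separated and each
  fine part extends its share of them.\<close>

lemma spread_reps_refine:
  assumes fin: "finite V" and V: "verts H = V" "verts H' = V" and edges: "edges H \<subseteq> edges H'"
    and ref: "refines V P P'" and S: "spread_reps H' P' S"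
  shows "\<exists>S'. S \<subseteq> S' \<and> spread_reps H P S'"
proof -
  have P: "partition_on V P"
    using ref by (simp add: refines_def)
  have "\<exists>B. S \<inter> A \<subseteq> B \<and> B \<subseteq> A \<and> card B \<le> 3 \<and> (\<forall>a\<in>B. \<forall>b\<in>B. a \<noteq> b \<longrightarrow> \<not> gdist H a b \<le> enat 2) \<and>
    (card B = 3 \<or> (\<forall>x\<in>A. \<exists>a\<in>B. gdist H x a \<le> enat 2))" if A: "A \<in> P" for A
  proof (rule extend_spread)
    obtain A' where A': "A' \<in> P'" "A \<subseteq> A'"
      using ref A unfolding refines_def by metis
    have "A' \<subseteq> V"
      using ref A' by (auto simp: refines_def partition_on_def)
    then have "finite (S \<inter> A')" and "finite A"
      using fin A' by (auto intro: finite_subset)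
    then show "finite A" by simp
    have "card (S \<inter> A) \<le> card (S \<inter> A')"
      using \<open>finite (S \<inter> A')\<close> A' by (intro card_mono) auto
    also have "\<dots> \<le> 3"
      using S A'(1) by (auto simp: spread_reps_def)
    finally show "card (S \<inter> A) \<le> 3" .
    fix a b assume "a \<in> S \<inter> A" "b \<in> S \<inter> A" "a \<noteq> b"
    then have "\<not> gdist H' a b \<le> enat 2"
      using S A' unfolding spread_reps_def by blast
    then show "\<not> gdist H a b \<le> enat 2"
      using gdist_mono_edges[OF edges] by blast
  qed auto
  then obtain B where B: "\<And>A. A \<in> P \<Longrightarrow> S \<inter> A \<subseteq> B A \<and> B A \<subseteq> A \<and> card (B A) \<le> 3 \<and>
      (\<forall>a\<in>B A. \<forall>b\<in>B A. a \<noteq> b \<longrightarrow> \<not> gdist H a b \<le> enat 2) \<and>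
      (card (B A) = 3 \<or> (\<forall>x\<in>A. \<exists>a\<in>B A. gdist H x a \<le> enat 2))"
    by metis
  let ?S' = "\<Union>A\<in>P. B A"
  have int: "?S' \<inter> A = B A" if A: "A \<in> P" for A
  proof
    show "?S' \<inter> A \<subseteq> B A"
    proof
      fix x assume "x \<in> ?S' \<inter> A"
      then obtain A1 where "A1 \<in> P" "x \<in> B A1" "x \<in> A" by blast
      moreover from this have "x \<in> A1"
        using B[of A1] by auto
      then have "A1 = A"
        using partition_on_unique[OF P \<open>A1 \<in> P\<close> A] \<open>x \<in> A\<close> by simp
      ultimately show "x \<in> B A" by simp
    qed
  qed (use B[OF A] A in blast)
  have "S \<subseteq> ?S'"
  proof
    fix x assume x: "x \<in> S"
    then have "x \<in> V"
      using S V by (auto simp: spread_reps_def)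
    then obtain A where A: "A \<in> P" "x \<in> A"
      using P by (meson partition_on_obtain)
    then have "x \<in> B A"
      using B[OF A(1)] x by auto
    then show "x \<in> ?S'"
      using A(1) by (rule UN_I[rotated])
  qed
  moreover have "spread_reps H P ?S'"
    unfolding spread_reps_def
  proof (intro conjI)
    show "?S' \<subseteq> verts H"
    proof (rule UN_least)
      fix A assume "A \<in> P"
      then show "B A \<subseteq> verts H"
        using B[of A] V partition_onD1[OF P] by auto
    qed
    show "\<forall>A\<in>P. card (?S' \<inter> A) \<le> 3 \<and>
        (\<forall>a\<in>?S' \<inter> A. \<forall>b\<in>?S' \<inter> A. a \<noteq> b \<longrightarrow> \<not> gdist H a b \<le> enat 2) \<and>
        (card (?S' \<inter> A) = 3 \<or> (\<forall>x\<in>A. \<exists>a\<in>?S' \<inter> A. gdist H x a \<le> enat 2))"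
    proof
      fix A assume A: "A \<in> P"
      show "card (?S' \<inter> A) \<le> 3 \<and>
        (\<forall>a\<in>?S' \<inter> A. \<forall>b\<in>?S' \<inter> A. a \<noteq> b \<longrightarrow> \<not> gdist H a b \<le> enat 2) \<and>
        (card (?S' \<inter> A) = 3 \<or> (\<forall>x\<in>A. \<exists>a\<in>?S' \<inter> A. gdist H x a \<le> enat 2))"
        unfolding int[OF A] using B[OF A] by (elim conjE) (intro conjI)
    qed
  qed
  ultimately show ?thesis by blast
qed

section \<open>Flips of neighbourhood partitions adapted to a merge sequence\<close>

lemma homogeneous_modD:
  assumes "homogeneous_mod G P R" "X \<in> P" "Y \<in> P" "x \<in> X" "x' \<in> X" "y \<in> Y" "y' \<in> Y"
    "x \<noteq> y" "{x, y} \<notin> R" "x' \<noteq> y'" "{x', y'} \<notin> R"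
  shows "{x, y} \<in> edges G \<longleftrightarrow> {x', y'} \<in> edges G"
  using assms unfolding homogeneous_mod_def by metis

lemma not_near_free:
  assumes "\<not> gdist H x y \<le> enat r" "1 \<le> r" shows "x \<noteq> y" "{x, y} \<notin> edges H"
  using assms gdist_mono_radius[OF gdist_edge, of x y H r] by (auto simp: zero_enat_def[symmetric])

text \<open>Some representative \<open>b\<close> in the part of \<open>y\<close> is not within
  distance 1 of \<open>x\<close> or \<open>x'\<close>. Homogeneity relates \<open>x y\<close> to
  \<open>x b\<close> and \<open>x' b\<close> to \<open>x' y\<close>, and the equal labels relate
  \<open>x b\<close> to \<open>x' b\<close>.\<close>

lemma nbhd_label_far_agree:
  assumes P: "partition_on (verts G) P" and hom: "homogeneous_mod G P (edges H)"
    and S: "spread_reps H P S"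
    and x: "x \<in> verts G" "x' \<in> verts G" "nbhd_label G S x = nbhd_label G S x'"
    and y: "y \<in> verts G" "\<not> gdist H x y \<le> enat 3" "\<not> gdist H x' y \<le> enat 3"
  shows "{x, y} \<in> edges G \<longleftrightarrow> {x', y} \<in> edges G"
proof (cases "x = x'")
  case False
  obtain A A' B where A: "A \<in> P" "x \<in> A" "A' \<in> P" "x' \<in> A'" "B \<in> P" "y \<in> B"
    using P x y by (meson partition_on_obtain)
  have "\<exists>b\<in>S \<inter> B. \<not> gdist H x b \<le> enat 1 \<and> \<not> gdist H x' b \<le> enat 1"
  proof -
    have sep: "\<not> gdist H a b \<le> enat 2" if "a \<in> S \<inter> B" "b \<in> S \<inter> B" "a \<noteq> b" for a b
      using S A(5) that unfolding spread_reps_def by blast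
    \<comment> \<open>With three representatives, \<open>x\<close> and \<open>x'\<close> spoil at
      most one each; otherwise a representative within 2 of \<open>y\<close> is far enough from
      both.\<close>
    consider "card (S \<inter> B) = 3" | "\<exists>b\<in>S \<inter> B. gdist H y b \<le> enat 2"
      using S A(5,6) unfolding spread_reps_def by blast
    then show ?thesis
    proof cases
      case 1
      then obtain b1 b2 b3 where b: "S \<inter> B = {b1, b2, b3}" "b1 \<noteq> b2" "b1 \<noteq> b3" "b2 \<noteq> b3"
        by (metis card_3_iff)
      have near: "a = b" if "gdist H u a \<le> enat 1" "gdist H u b \<le> enat 1" "a \<in> S \<inter> B" "b \<in> S \<inter> B" for u a b
      proof (rule ccontr)
        assume "a \<noteq> b"
        have "gdist H a b \<le> enat (1 + 1)"
          using that gdist_commute[of H u a] by (intro gdist_triangle_le[of H a u]) auto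
        then show False
          using sep[OF that(3,4) \<open>a \<noteq> b\<close>] by (simp add: numeral_2_eq_2)
      qed
      show ?thesis
      proof (rule ccontr)
        assume "\<not> ?thesis"
        then have "gdist H x c \<le> enat 1 \<or> gdist H x' c \<le> enat 1" if "c \<in> {b1, b2, b3}" for c
          using that b(1) by blast
        then show False
          using near[of _ b1 b2] near[of _ b1 b3] near[of _ b2 b3] b by (metis insertCI)
      qed
    next
      case 2
      then obtain b where b: "b \<in> S \<inter> B" "gdist H y b \<le> enat 2" by blast
      have "\<not> gdist H u b \<le> enat 1" if "\<not> gdist H u y \<le> enat 3" for u
      proof
        assume "gdist H u b \<le> enat 1"
        then have "gdist H u y \<le> enat (1 + 2)"
          using b(2) by (intro gdist_triangle_le[of H u b]) (auto simp: gdist_commute)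
        then show False using that by (simp add: numeral_3_eq_3)
      qed
      then show ?thesis
        using b(1) y by blast
    qed
  qed
  then obtain b where b: "b \<in> S" "b \<in> B" "\<not> gdist H x b \<le> enat 1" "\<not> gdist H x' b \<le> enat 1"
    by blast
  have "{x, y} \<in> edges G \<longleftrightarrow> {x, b} \<in> edges G"
    by (rule homogeneous_modD[OF hom A(1,5,2,2,6) b(2)])
      (use not_near_free[OF y(2)] not_near_free[OF b(3)] in auto)
  also have "\<dots> \<longleftrightarrow> {x', b} \<in> edges G"
    using nbhd_label_eqD(3)[OF x(3) False b(1)] .
  also have "\<dots> \<longleftrightarrow> {x', y} \<in> edges G"
    by (rule homogeneous_modD[OF hom A(3,5,4,4) b(2) A(6)])
      (use not_near_free[OF y(3)] not_near_free[OF b(4)] in auto)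
  finally show ?thesis .
qed simp

definition far_edge :: "'a graph \<Rightarrow> 'a graph \<Rightarrow> 'a \<Rightarrow> 'a \<Rightarrow> bool" where
  "far_edge G H x y \<longleftrightarrow> x \<in> verts G \<and> y \<in> verts G \<and> {x, y} \<in> edges G \<and> \<not> gdist H x y \<le> enat 3"

lemma far_edge_commute: "far_edge G H x y \<longleftrightarrow> far_edge G H y x"
  by (auto simp: far_edge_def insert_commute gdist_commute)

text \<open>A single far edge is taken as evidence that far pairs between its classes are edges; the
  non-edges that this turns into far edges of the flip are the exceptions controlled below.\<close>

definition far_edge_flip :: "'a graph \<Rightarrow> 'a graph \<Rightarrow> 'a set \<Rightarrow> 'a graph" where
  "far_edge_flip G H S = flip {(X, Y) \<in> nbhd_partition G S \<times> nbhd_partition G S. \<exists>x\<in>X. \<exists>y\<in>Y. far_edge G H x y} G"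

lemma far_edge_flip_in_flips: "far_edge_flip G H S \<in> flips (nbhd_partition G S) G"
  unfolding far_edge_flip_def flips_def by blast

text \<open>The vertex \<open>x0\<close> does not depend on \<open>x\<close> and \<open>y\<close>, but only on their classes: the flip has few
  edges that are not short.\<close>

lemma far_edge_flip_edge:
  assumes P: "partition_on (verts G) P" and hom: "homogeneous_mod G P (edges H)"
    and S: "spread_reps H P S" "S \<subseteq> verts G"
    and e: "{x, y} \<in> edges (far_edge_flip G H S)" and far: "\<not> gdist H x y \<le> enat 3"
  shows "\<exists>x0 y0. far_edge G H x0 y0 \<and> nbhd_label G S x0 = nbhd_label G S x \<and> nbhd_label G S y0 = nbhd_label G S y"
    and "far_edge G H x0 y0 \<Longrightarrow> nbhd_label G S x0 = nbhd_label G S x \<Longrightarrow> nbhd_label G S y0 = nbhd_label G S y \<Longrightarrow>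
      gdist H x y0 \<le> enat 3 \<and> gdist H x0 y \<le> enat 3"
proof -
  let ?N = "nbhd_partition G S"
  let ?F = "{(X, Y) \<in> ?N \<times> ?N. \<exists>x\<in>X. \<exists>y\<in>Y. far_edge G H x y}"
  have N: "partition_on (verts G) ?N"
    using S(2) by (rule partition_on_nbhd_partition)
  have "{x, y} \<in> [verts G]\<^bsup>2\<^esup>"
    using e edges_flip_subset unfolding far_edge_flip_def by blast
  then have xy: "x \<in> verts G" "y \<in> verts G" "x \<noteq> y"
    by auto
  obtain X Y where X: "X \<in> ?N" "x \<in> X" "Y \<in> ?N" "y \<in> Y"
    using N xy by (meson partition_on_obtain)
  have label: "nbhd_label G S u = nbhd_label G S w" if "u \<in> Z" "w \<in> Z" "Z \<in> ?N" for u w Z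
    using same_fiber[of Z "nbhd_label G S" "verts G" u w] that S(2) by (simp add: nbhd_partition_fibers)
  have "({x, y} \<in> edges G) \<noteq> ((X, Y) \<in> ?F \<or> (Y, X) \<in> ?F)"
    using edges_flip_iff[OF N _ X(1,3,2,4) xy(3), of ?F] e unfolding far_edge_flip_def by blast
  \<comment> \<open>A far edge of \<open>G\<close> is always removed, so a far edge of the flip is a
    non-edge of \<open>G\<close> in a complemented pair.\<close>
  moreover have "(X, Y) \<in> ?F" if "{x, y} \<in> edges G"
    using X that far xy by (auto simp: far_edge_def)
  ultimately have nonedge: "{x, y} \<notin> edges G" and "(X, Y) \<in> ?F \<or> (Y, X) \<in> ?F"
    by blast+
  then obtain x0 y0 where "x0 \<in> X" "y0 \<in> Y" "far_edge G H x0 y0"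
    using far_edge_commute[of G H] by blast
  then show "\<exists>x0 y0. far_edge G H x0 y0 \<and> nbhd_label G S x0 = nbhd_label G S x \<and> nbhd_label G S y0 = nbhd_label G S y"
    using label X by blast
  fix x0 y0
  assume fe: "far_edge G H x0 y0" and lx: "nbhd_label G S x0 = nbhd_label G S x" and ly: "nbhd_label G S y0 = nbhd_label G S y"
  have V: "x0 \<in> verts G" "y0 \<in> verts G" and e0: "{x0, y0} \<in> edges G" and far0: "\<not> gdist H x0 y0 \<le> enat 3"
    using fe by (auto simp: far_edge_def)
  note agree = nbhd_label_far_agree[OF P hom S(1)]
  \<comment> \<open>If \<open>x\<close> were far from \<open>y0\<close>, equal labels would carry
    the edge \<open>x0 y0\<close> to \<open>x y0\<close> and on to the non-edge \<open>x y\<close>;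
    the second claim goes through \<open>x0 y\<close> instead.\<close>
  show "gdist H x y0 \<le> enat 3 \<and> gdist H x0 y \<le> enat 3"
  proof (rule conjI; rule ccontr)
    assume f: "\<not> gdist H x y0 \<le> enat 3"
    have "{x0, y0} \<in> edges G \<longleftrightarrow> {x, y0} \<in> edges G"
      by (rule agree[OF V(1) xy(1) lx V(2) far0 f])
    moreover have "{y0, x} \<in> edges G \<longleftrightarrow> {y, x} \<in> edges G"
      by (rule agree[OF V(2) xy(2) ly xy(1)]) (use f far in \<open>auto simp: gdist_commute\<close>)
    ultimately show False
      using e0 nonedge by (simp add: insert_commute)
  next
    assume f: "\<not> gdist H x0 y \<le> enat 3"
    have "{x0, y} \<in> edges G \<longleftrightarrow> {x, y} \<in> edges G"
      by (rule agree[OF V(1) xy(1) lx xy(2) f far])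
    moreover have "{y0, x0} \<in> edges G \<longleftrightarrow> {y, x0} \<in> edges G"
      by (rule agree[OF V(2) xy(2) ly V(1)]) (use f far0 in \<open>auto simp: gdist_commute\<close>)
    ultimately show False
      using e0 nonedge by (simp add: insert_commute)
  qed
qed

text \<open>The choice depends on the two labels only, so few labels mean few anchors.\<close>

definition far_anchor :: "'a graph \<Rightarrow> 'a graph \<Rightarrow> 'a set \<Rightarrow> ('a + 'a set) \<times> ('a + 'a set) \<Rightarrow> 'a" where
  "far_anchor G H S = (\<lambda>(c, c'). SOME x0. \<exists>y0. far_edge G H x0 y0 \<and> nbhd_label G S x0 = c \<and> nbhd_label G S y0 = c')"

text \<open>The label of \<open>y\<close> is read off from a vertex \<open>y0\<close> close to
  \<open>x\<close>, so both labels selecting the anchor are visible near \<open>x\<close>, although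
  \<open>y\<close> is far.\<close>

lemma far_edge_flip_step:
  assumes P: "partition_on (verts G) P" and hom: "homogeneous_mod G P (edges H)"
    and S: "spread_reps H P S" "S \<subseteq> verts G"
    and e: "{x, y} \<in> edges (far_edge_flip G H S)" and far: "\<not> gdist H x y \<le> enat 3"
  obtains y0 where "y0 \<in> verts G" "gdist H x y0 \<le> enat 3"
    "far_anchor G H S (nbhd_label G S x, nbhd_label G S y0) \<in> verts G"
    "gdist H (far_anchor G H S (nbhd_label G S x, nbhd_label G S y0)) y \<le> enat 3"
proof -
  note * = far_edge_flip_edge[OF assms]
  define x0 where "x0 = far_anchor G H S (nbhd_label G S x, nbhd_label G S y)"
  have "\<exists>y0. far_edge G H x0 y0 \<and> nbhd_label G S x0 = nbhd_label G S x \<and> nbhd_label G S y0 = nbhd_label G S y"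
    unfolding x0_def far_anchor_def prod.case using *(1) by (rule someI_ex)
  then obtain y0 where y0: "far_edge G H x0 y0" "nbhd_label G S x0 = nbhd_label G S x" "nbhd_label G S y0 = nbhd_label G S y"
    by blast
  have "gdist H x y0 \<le> enat 3 \<and> gdist H x0 y \<le> enat 3"
    by (rule *(2)[OF y0])
  moreover have "x0 \<in> verts G" "y0 \<in> verts G"
    using y0(1) by (auto simp: far_edge_def)
  ultimately show ?thesis
    using that[of y0] unfolding y0(3) x0_def[symmetric] by blast
qed

text \<open>A short step enlarges a covering ball by 3. A far step lands within 3 of an anchor given
  by two labels seen near the current centre, so each centre adds at most \<open>K\<^sup>2\<close>
  new ones.\<close>

lemma gball_far_edge_flip:
  assumes fin: "finite (verts G)" and H: "verts H = verts G"
    and P: "partition_on (verts G) P" and hom: "homogeneous_mod G P (edges H)"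
    and S: "spread_reps H P S" "S \<subseteq> verts G" and v: "v \<in> verts G"
    and K: "\<And>u. u \<in> verts G \<Longrightarrow> card (nbhd_label G S ` gball (3 * r) H u) \<le> K"
  shows "i \<le> r \<Longrightarrow> \<exists>C. C \<subseteq> verts G \<and> card C \<le> (1 + K\<^sup>2) ^ i \<and>
    gball i (far_edge_flip G H S) v \<subseteq> (\<Union>c\<in>C. gball (3 * i) H c)"
proof (induction i)
  case 0
  have "gball 0 (far_edge_flip G H S) v \<subseteq> gball 0 H v"
  proof
    fix u assume "u \<in> gball 0 (far_edge_flip G H S) v"
    then have "u = v"
      by (auto simp: gball_def gdist_le_iff)
    then show "u \<in> gball 0 H v"
      using v H by (simp add: gball_def)
  qed
  then show ?case
    using v by (intro exI[of _ "{v}"]) auto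
next
  case (Suc i)
  let ?J = "far_edge_flip G H S" and ?lab = "nbhd_label G S"
  obtain C where C: "C \<subseteq> verts G" "card C \<le> (1 + K\<^sup>2) ^ i" "gball i ?J v \<subseteq> (\<Union>c\<in>C. gball (3 * i) H c)"
    using Suc by auto
  have finC: "finite C"
    using C(1) fin by (rule finite_subset)
  define L where "L c = ?lab ` gball (3 * i + 3) H c" for c
  have finb: "finite (gball r' H c)" for r' c
    using finite_subset[OF gball_subset_verts] fin H by metis
  have finL: "finite (L c)" for c
    unfolding L_def using finb by (rule finite_imageI)
  have cL: "card (L c) \<le> K" if "c \<in> C" for c
  proof -
    have "card (L c) \<le> card (?lab ` gball (3 * r) H c)"
      unfolding L_def using Suc.prems finb
      by (intro card_mono image_mono gball_mono finite_imageI) auto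
    then show ?thesis
      using K[of c] C(1) that by auto
  qed
  define D where "D = far_anchor G H S ` (\<Union>c\<in>C. L c \<times> L c)"
  let ?C' = "C \<union> (D \<inter> verts G)"
  have finD: "finite D"
    unfolding D_def using finC finL by auto
  have "card D \<le> card (\<Union>c\<in>C. L c \<times> L c)"
    unfolding D_def using finC finL by (intro card_image_le) auto
  also have "\<dots> \<le> (\<Sum>c\<in>C. card (L c \<times> L c))"
    using finC by (rule card_UN_le)
  also have "\<dots> \<le> (\<Sum>c\<in>C. K * K)"
    unfolding card_cartesian_product by (intro sum_mono mult_mono cL) auto
  also have "\<dots> = card C * K\<^sup>2"
    by (simp add: power2_eq_square)
  finally have cD: "card D \<le> card C * K\<^sup>2" .
  have "card ?C' \<le> card C + card (D \<inter> verts G)"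
    by (rule card_Un_le)
  also have "\<dots> \<le> card C + card D"
    using card_mono[OF finD, of "D \<inter> verts G"] by simp
  also have "\<dots> \<le> card C * (1 + K\<^sup>2)"
    using cD by simp
  also have "\<dots> \<le> (1 + K\<^sup>2) ^ Suc i"
    using mult_right_mono[OF C(2), of "1 + K\<^sup>2"] by (simp add: mult.commute)
  finally have "card ?C' \<le> (1 + K\<^sup>2) ^ Suc i" .
  moreover have "gball (Suc i) ?J v \<subseteq> (\<Union>c\<in>?C'. gball (3 * Suc i) H c)"
  proof
    fix u assume u: "u \<in> gball (Suc i) ?J v"
    then have uV: "u \<in> verts G"
      by (simp add: gball_def far_edge_flip_def)
    obtain k where k: "k \<le> Suc i" "(v, u) \<in> adj ?J ^^ k"
      using u by (auto simp: gball_def gdist_le_iff)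
    show "u \<in> (\<Union>c\<in>?C'. gball (3 * Suc i) H c)"
    proof (cases "k \<le> i")
      case True
      then have "u \<in> gball i ?J v"
        using k uV by (auto simp: gball_def gdist_le_iff far_edge_flip_def)
      then obtain c where c: "c \<in> C" "u \<in> gball (3 * i) H c"
        using C(3) by blast
      then have "u \<in> gball (3 * Suc i) H c"
        using gball_mono[of H H "3 * i" "3 * Suc i" c] by auto
      then show ?thesis using c(1) by blast
    next
      case False
      then have "k = Suc i"
        using k(1) by simp
      then obtain w where w: "(v, w) \<in> adj ?J ^^ i" "{w, u} \<in> edges ?J"
        using k(2) by (auto simp: adj_def)
      have "{w, u} \<in> [verts G]\<^bsup>2\<^esup>"
        using w(2) edges_flip_subset unfolding far_edge_flip_def by blast
      then have "w \<in> verts G" by simp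
      then have "w \<in> gball i ?J v"
        using w by (auto simp: gball_def gdist_le_iff far_edge_flip_def)
      then obtain c where c: "c \<in> C" "w \<in> gball (3 * i) H c"
        using C(3) by blast
      then have dw: "gdist H c w \<le> enat (3 * i)"
        by (simp add: gball_def)
      show ?thesis
      proof (cases "gdist H w u \<le> enat 3")
        case True
        have "gdist H c u \<le> enat (3 * i + 3)"
          by (rule gdist_triangle_le[OF dw True])
        then have "u \<in> gball (3 * Suc i) H c"
          using uV H by (simp add: gball_def add.commute)
        then show ?thesis using c(1) by blast
      next
        case False
        obtain y0 where y0: "y0 \<in> verts G" "gdist H w y0 \<le> enat 3"
          and q: "far_anchor G H S (?lab w, ?lab y0) \<in> verts G"
          "gdist H (far_anchor G H S (?lab w, ?lab y0)) u \<le> enat 3"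
          using far_edge_flip_step[OF P hom S w(2) False] .
        have "gdist H c y0 \<le> enat (3 * i + 3)"
          by (rule gdist_triangle_le[OF dw y0(2)])
        then have "?lab y0 \<in> L c"
          using y0(1) H by (simp add: L_def gball_def)
        moreover have "?lab w \<in> L c"
          using gdist_mono_radius[OF dw, of "3 * i + 3"] \<open>w \<in> verts G\<close> H by (simp add: L_def gball_def)
        ultimately have "far_anchor G H S (?lab w, ?lab y0) \<in> D"
          using c(1) unfolding D_def by blast
        then have "far_anchor G H S (?lab w, ?lab y0) \<in> ?C'"
          using q(1) by blast
        moreover have "u \<in> gball (3 * Suc i) H (far_anchor G H S (?lab w, ?lab y0))"
          using gdist_mono_radius[OF q(2), of "3 * Suc i"] uV H by (simp add: gball_def)
        ultimately show ?thesis by (rule UN_I)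
      qed
    qed
  qed
  ultimately show ?case
    using C(1) by (intro exI[of _ ?C']) auto
qed

text \<open>\<open>S\<close> governs the distances and \<open>S'\<close> the count, because an
  initial segment of the order will lie between two such sets.\<close>

lemma card_nbhd_label_pball_le:
  assumes fin: "finite (verts G)" and H: "verts H = verts G"
    and P: "partition_on (verts G) P" and hom: "homogeneous_mod G P (edges H)"
    and S: "spread_reps H P S" "S \<subseteq> S'" "S' \<subseteq> verts G" and v: "v \<in> verts G"
    and K: "\<And>u. u \<in> verts G \<Longrightarrow> card (nbhd_label G S' ` gball (3 * r) H u) \<le> K"
  shows "card (nbhd_label G S' ` pball r G (nbhd_partition G S) v) \<le> (1 + K\<^sup>2) ^ r * K"
proof -
  let ?J = "far_edge_flip G H S"
  have SV: "S \<subseteq> verts G"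
    using S by blast
  have finb: "finite (gball r' H u)" for r' u
    using finite_subset[OF gball_subset_verts] fin H by metis
  have "card (nbhd_label G S ` gball (3 * r) H u) \<le> K" if "u \<in> verts G" for u
  proof -
    have "card (nbhd_label G S ` gball (3 * r) H u) \<le> card (nbhd_label G S' ` gball (3 * r) H u)"
      using finb nbhd_label_mono[OF S(2)] by (intro card_image_le_factor)
    then show ?thesis
      using K[OF that] by simp
  qed
  then obtain C where C: "C \<subseteq> verts G" "card C \<le> (1 + K\<^sup>2) ^ r" "gball r ?J v \<subseteq> (\<Union>c\<in>C. gball (3 * r) H c)"
    using gball_far_edge_flip[OF fin H P hom S(1) SV v, of r K r] by blast
  have finC: "finite C"
    using C(1) fin by (rule finite_subset)
  have "pball r G (nbhd_partition G S) v \<subseteq> gball r ?J v"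
  proof
    fix u assume "u \<in> pball r G (nbhd_partition G S) v"
    then have "u \<in> verts G" "pdist G (nbhd_partition G S) v u \<le> enat r"
      by (auto simp: pball_def)
    moreover have "gdist ?J v u \<le> pdist G (nbhd_partition G S) v u"
      unfolding pdist_def using far_edge_flip_in_flips by (rule SUP_upper)
    ultimately show "u \<in> gball r ?J v"
      by (auto simp: gball_def far_edge_flip_def intro: order_trans)
  qed
  then have "nbhd_label G S' ` pball r G (nbhd_partition G S) v \<subseteq> (\<Union>c\<in>C. nbhd_label G S' ` gball (3 * r) H c)"
    using C(3) by blast
  then have "card (nbhd_label G S' ` pball r G (nbhd_partition G S) v) \<le> card (\<Union>c\<in>C. nbhd_label G S' ` gball (3 * r) H c)"
    using finC finb by (intro card_mono) auto
  also have "\<dots> \<le> (\<Sum>c\<in>C. card (nbhd_label G S' ` gball (3 * r) H c))"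
    using finC by (rule card_UN_le)
  also have "\<dots> \<le> (\<Sum>c\<in>C. K)"
    using C(1) by (intro sum_mono K) auto
  also have "\<dots> = card C * K"
    by simp
  also have "\<dots> \<le> (1 + K\<^sup>2) ^ r * K"
    using C(2) by (intro mult_right_mono) auto
  finally show ?thesis .
qed

text \<open>If two vertices of one part differ in their adjacency to a representative
  \<open>t\<close> other than themselves, homogeneity puts one of the two pairs into
  \<open>R\<close>, so \<open>t\<close> is one step from the ball. There are at most
  \<open>3 * k\<close> such representatives.\<close>

lemma card_nbhd_label_gball_le:
  assumes fin: "finite (verts G)" and H: "verts H = verts G" and P: "partition_on (verts G) P"
    and hom: "homogeneous_mod G P R" and R: "R \<subseteq> edges H" and S: "S \<subseteq> verts G" "\<And>A. A \<in> P \<Longrightarrow> card (A \<inter> S) \<le> 3"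
    and vc: "nbhd_vc_free d G"
    and k: "card (parts_meeting (gball (s + 1) H u) P) \<le> k"
  shows "card (nbhd_label G S ` gball s H u) \<le> 2 * (3 * (1 + k)) ^ (d + 1)"
proof -
  let ?W = "gball s H u" and ?B = "gball (s + 1) H u"
  let ?T = "S \<inter> ?B"
  have sub: "?W \<subseteq> verts G" "?B \<subseteq> verts G"
    using gball_subset_verts[of _ H] H by auto
  have WB: "?W \<subseteq> ?B"
    by (rule gball_mono) auto
  have "card (nbhd_label G S ` ?W) \<le> card ?T + card (parts_meeting ?W P) * card ((\<lambda>x. nbhd G x \<inter> ?T) ` verts G)"
  proof (rule card_image_traces_le[OF fin sub(1) P, where S = S])
    fix x x' t
    assume x: "x \<in> ?W" "x' \<in> ?W" "part_label P x = part_label P x'" and t: "t \<in> S"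
      and neq: "(t \<in> nbhd G x) \<noteq> (t \<in> nbhd G x')"
    show "t \<in> ?T"
    proof (cases "t = x \<or> t = x'")
      case True
      then show ?thesis using WB x t by auto
    next
      case False
      obtain A where A: "A \<in> P" "x \<in> A" "x' \<in> A"
        using part_label_eq_iff[OF P, of x x'] x sub by blast
      obtain B where B: "B \<in> P" "t \<in> B"
        using P t S by (meson partition_on_obtain subsetD)
      have "\<exists>z\<in>{x, x'}. {z, t} \<in> R"
        using homogeneous_modD[OF hom A(1) B(1) A(2,3) B(2,2)] False neq by (auto simp: nbhd_def)
      then obtain z where z: "z \<in> ?W" "{z, t} \<in> edges H"
        using x R by blast
      then have "gdist H u t \<le> enat (s + 1)"
        by (intro gdist_triangle_le[of H u z] gdist_edge) (auto simp: gball_def)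
      then show ?thesis
        using t S H by (auto simp: gball_def)
    qed
  qed (use WB sub in auto)
  also have "\<dots> \<le> 3 * k + k * (3 * k + 1) ^ d"
  proof (intro add_mono mult_mono)
    have "card ?T \<le> 3 * card (parts_meeting ?B P)"
      using S sub by (intro card_le_parts_meeting[OF fin P, of _ _ S]) auto
    then show T: "card ?T \<le> 3 * k"
      using k by simp
    have "card (parts_meeting ?W P) \<le> card (parts_meeting ?B P)"
      by (intro card_parts_meeting_mono[OF fin P] WB)
    then show "card (parts_meeting ?W P) \<le> k"
      using k by simp
    have "card ((\<lambda>x. nbhd G x \<inter> ?T) ` verts G) \<le> (card ?T + 1) ^ d"
      using sub by (intro card_traces_le[OF fin vc]) auto
    also have "\<dots> \<le> (3 * k + 1) ^ d"
      using T by (intro power_mono) auto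
    finally show "card ((\<lambda>x. nbhd G x \<inter> ?T) ` verts G) \<le> (3 * k + 1) ^ d" .
  qed auto
  also have "\<dots> \<le> 2 * (3 * (1 + k)) ^ (d + 1)"
  proof -
    have "3 * k \<le> (3 * (1 + k)) ^ 1"
      by simp
    also have "\<dots> \<le> (3 * (1 + k)) ^ (d + 1)"
      by (intro power_increasing) auto
    finally have 1: "3 * k \<le> (3 * (1 + k)) ^ (d + 1)" .
    have "k * (3 * k + 1) ^ d \<le> (3 * (1 + k)) * (3 * (1 + k)) ^ d"
      by (intro mult_mono power_mono) auto
    then have "k * (3 * k + 1) ^ d \<le> (3 * (1 + k)) ^ (d + 1)"
      by simp
    then show ?thesis using 1 by linarith
  qed
  finally show ?thesis .
qed

text \<open>Representatives are extended from coarse to fine, starting at the trivial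
  partition.\<close>

lemma spread_reps_chain:
  assumes fin: "finite (verts G)" and ms: "merge_sequence G m P R"
  obtains S where "\<And>t. t \<in> {1..m} \<Longrightarrow> spread_reps \<lparr>verts = verts G, edges = R t\<rparr> (P t) (S t)"
    "\<And>t. t \<in> {1..<m} \<Longrightarrow> S (t + 1) \<subseteq> S t"
proof -
  let ?H = "\<lambda>t. \<lparr>verts = verts G, edges = R t\<rparr>"
  \<comment> \<open>\<open>j\<close> counts backwards from the last partition; the guard makes the
    condition void beyond the first one, so that dependent choice can run forever.\<close>
  let ?good = "\<lambda>j S. j < m \<longrightarrow> spread_reps (?H (m - j)) (P (m - j)) S"
  have Pm: "P m = {verts G}"
    using ms by (simp add: merge_sequence_def partition_chain_def)
  have "\<exists>B. {} \<subseteq> B \<and> B \<subseteq> verts G \<and> card B \<le> 3 \<and>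
      (\<forall>a\<in>B. \<forall>b\<in>B. a \<noteq> b \<longrightarrow> \<not> gdist (?H m) a b \<le> enat 2) \<and>
      (card B = 3 \<or> (\<forall>x\<in>verts G. \<exists>a\<in>B. gdist (?H m) x a \<le> enat 2))"
    using fin by (rule extend_spread) auto
  then obtain B where "B \<subseteq> verts G" "card B \<le> 3"
      "\<forall>a\<in>B. \<forall>b\<in>B. a \<noteq> b \<longrightarrow> \<not> gdist (?H m) a b \<le> enat 2"
      "card B = 3 \<or> (\<forall>x\<in>verts G. \<exists>a\<in>B. gdist (?H m) x a \<le> enat 2)"
    by blast
  then have "?good 0 B"
    by (simp add: spread_reps_def Pm Int_absorb2)
  then have base: "\<exists>S. ?good 0 S" by blast
  have step: "\<exists>S'. ?good (Suc j) S' \<and> S \<subseteq> S'" if S: "?good j S" for S j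
  proof (cases "Suc j < m")
    case True
    define t where "t = m - Suc j"
    have t: "t \<in> {1..<m}" "m - j = t + 1"
      using True by (auto simp: t_def)
    have "\<exists>S'. S \<subseteq> S' \<and> spread_reps (?H t) (P t) S'"
    proof (rule spread_reps_refine[OF fin])
      show "refines (verts G) (P t) (P (t + 1))" "edges (?H t) \<subseteq> edges (?H (t + 1))"
        using ms t(1) by (auto simp: merge_sequence_def partition_chain_def)
      show "spread_reps (?H (t + 1)) (P (t + 1)) S"
        using S True unfolding t(2) by simp
    qed auto
    then show ?thesis
      unfolding t_def by blast
  qed auto
  obtain f where f: "\<And>j. ?good j (f j)" "\<And>j. f j \<subseteq> f (Suc j)"
    using dependent_nat_choice[of ?good "\<lambda>_ S S'. S \<subseteq> S'", OF base step] by blast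
  show ?thesis
  proof (rule that[of "\<lambda>t. f (m - t)"])
    show "spread_reps (?H t) (P t) (f (m - t))" if "t \<in> {1..m}" for t
      using f(1)[of "m - t"] that by auto
    show "f (m - (t + 1)) \<subseteq> f (m - t)" if "t \<in> {1..<m}" for t
    proof -
      have "m - t = Suc (m - (t + 1))"
        using that by auto
      then show ?thesis
        using f(2)[of "m - (t + 1)"] by simp
    qed
  qed
qed

text \<open>Sort by the number of sets missing a vertex: by nestedness a member of
  \<open>S t\<close> is missed by strictly fewer sets than a non-member, and so comes
  earlier.\<close>

lemma order_compatible_with_nested:
  fixes S :: "nat \<Rightarrow> 'a set"
  assumes fin: "finite V" and nested: "\<And>t t'. 1 \<le> t \<Longrightarrow> t \<le> t' \<Longrightarrow> t' \<le> m \<Longrightarrow> S t' \<subseteq> S t"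
  obtains xs where "distinct xs" "set xs = V"
    "\<And>n t. t \<in> {1..m} \<Longrightarrow> S t \<subseteq> V \<Longrightarrow> set (take n xs) \<subseteq> S t \<or> S t \<subseteq> set (take n xs)"
proof -
  obtain ys where ys: "set ys = V" "distinct ys"
    using finite_distinct_list[OF fin] by blast
  define g where "g v = card {t \<in> {1..m}. v \<notin> S t}" for v
  define xs where "xs = sort_key g ys"
  have xs: "distinct xs" "set xs = V"
    using ys by (simp_all add: xs_def)
  have sorted: "sorted (map g xs)"
    by (simp add: xs_def)
  have "set (take n xs) \<subseteq> S t \<or> S t \<subseteq> set (take n xs)" if t: "t \<in> {1..m}" "S t \<subseteq> V" for n t
  proof (rule ccontr)
    assume "\<not> ?thesis"
    then obtain w v where w: "w \<in> set (take n xs)" "w \<notin> S t" and v: "v \<in> S t" "v \<notin> set (take n xs)"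
      by blast
    have "v \<in> set xs"
      using v t xs by blast
    then have "v \<in> set (drop n xs)"
      using v(2) by (metis Un_iff append_take_drop_id set_append)
    moreover have "sorted (map g (take n xs) @ map g (drop n xs))"
      using sorted by (simp flip: map_append)
    ultimately have "g w \<le> g v"
      using w(1) by (auto simp: sorted_append)
    moreover have "g v < g w"
      unfolding g_def
    proof (rule psubset_card_mono)
      have "w \<notin> S t'" if "t' \<in> {1..m}" "v \<notin> S t'" for t'
      proof -
        have "\<not> t' \<le> t"
          using nested[of t' t] that v(1) t by auto
        then have "S t' \<subseteq> S t"
          using that t by (intro nested) auto
        then show ?thesis
          using w(2) by blast
      qed
      moreover have "t \<in> {t \<in> {1..m}. w \<notin> S t} - {t \<in> {1..m}. v \<notin> S t}"
        using w v t by blast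
      ultimately show "{t \<in> {1..m}. v \<notin> S t} \<subset> {t \<in> {1..m}. w \<notin> S t}"
        by blast
    qed simp
    ultimately show False by simp
  qed
  then show ?thesis
    using that xs by blast
qed

text \<open>Three singletons and at most \<open>2 ^ 3\<close> traces.\<close>

lemma card_nbhd_label_small:
  assumes fin: "finite (verts G)" and ne: "verts G \<noteq> {}" and W: "W \<subseteq> verts G" and S: "S \<subseteq> verts G" "card S \<le> 3"
  shows "card (nbhd_label G S ` W) \<le> 11"
proof -
  have P: "partition_on (verts G) {verts G}"
    using ne by (rule partition_on_space)
  have finS: "finite S"
    using S(1) fin by (rule finite_subset)
  have "card (nbhd_label G S ` W) \<le> card S + card (parts_meeting W {verts G}) * card ((\<lambda>x. nbhd G x \<inter> S) ` verts G)"
    by (rule card_image_traces_le[OF fin W P, where S = S]) (use S in auto)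
  also have "\<dots> \<le> 3 + 1 * 8"
  proof (intro add_mono mult_mono S(2))
    have "card (parts_meeting W {verts G}) \<le> card {verts G}"
      by (intro card_mono) (auto simp: parts_meeting_def)
    then show "card (parts_meeting W {verts G}) \<le> 1" by simp
    have "card ((\<lambda>x. nbhd G x \<inter> S) ` verts G) \<le> card (Pow S)"
      using finS by (intro card_mono) auto
    also have "\<dots> \<le> 2 ^ 3"
      unfolding card_Pow[OF finS] using S(2) by (intro power_increasing) auto
    finally show "card ((\<lambda>x. nbhd G x \<inter> S) ` verts G) \<le> 8"
      by simp
  qed auto
  finally show ?thesis by simp
qed

text \<open>An initial segment of the order lies between two consecutive sets of representatives or
  inside the last one, so one index of the merge sequence controls it.\<close>

lemma dmw_le_mw:
  assumes G: "simple_graph G" and ne: "verts G \<noteq> {}" and vc: "nbhd_vc_free d G"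
  shows "dmw r G \<le> (4 * 3 ^ (d + 1)) ^ (2 * r + 1) * (1 + mw (3 * r + 1) G) ^ ((d + 1) * (2 * r + 1))"
proof -
  have fin: "finite (verts G)"
    using G by (simp add: simple_graph_def)
  define k where "k = mw (3 * r + 1) G"
  from mw_attained[OF ne, of "3 * r + 1"]
  obtain m P R where ms: "merge_sequence G m P R" and w: "k = merge_sequence_width (3 * r + 1) G m P R"
    unfolding k_def .
  let ?H = "\<lambda>t. \<lparr>verts = verts G, edges = R t\<rparr>"
  define K where "K = 2 * (3 * (1 + k)) ^ (d + 1)"
  \<comment> \<open>A pure power dominating \<open>(1 + K\<^sup>2) ^ r * K\<close>, so that it
    becomes a constant times a power of \<open>1 + k\<close>; it also covers the 11 of the last
    step.\<close>
  define M where "M = (2 * K) ^ (2 * r + 1)"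
  have M: "M = (4 * 3 ^ (d + 1)) ^ (2 * r + 1) * (1 + k) ^ ((d + 1) * (2 * r + 1))"
  proof -
    have "2 * K = 4 * 3 ^ (d + 1) * (1 + k) ^ (d + 1)"
      unfolding K_def power_mult_distrib by simp
    then show ?thesis
      by (simp only: M_def power_mult_distrib power_mult)
  qed
  have K1: "6 \<le> K"
  proof -
    have "3 * 1 \<le> (3 * (1 + k)) * (3 * (1 + k)) ^ d"
      by (intro mult_mono one_le_power) auto
    then show ?thesis
      by (simp add: K_def)
  qed
  have "11 \<le> (2 * K) ^ 1"
    using K1 by simp
  also have "\<dots> \<le> M"
    unfolding M_def using K1 by (intro power_increasing) auto
  finally have M11: "11 \<le> M" .
  have KM: "(1 + K\<^sup>2) ^ r * K \<le> M"
  proof -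
    have "1 + K\<^sup>2 \<le> (2 * K)\<^sup>2"
      using K1 by (simp add: power2_eq_square)
    then have "(1 + K\<^sup>2) ^ r * K \<le> ((2 * K)\<^sup>2) ^ r * (2 * K)"
      by (intro mult_mono power_mono) auto
    then show ?thesis
      by (simp only: M_def power_add power_mult power_one_right)
  qed
  have m: "1 \<le> m" and P1: "P 1 = (\<lambda>v. {v}) ` verts G" and Pm: "P m = {verts G}"
    and Pt: "\<And>t. t \<in> {1..m} \<Longrightarrow> partition_on (verts G) (P t)"
    and Rt: "\<And>t. t \<in> {1..<m} \<Longrightarrow> R t \<subseteq> R (t + 1)"
    and hom: "\<And>t. t \<in> {1..m} \<Longrightarrow> homogeneous_mod G (P t) (R t)"
    using ms by (auto simp: merge_sequence_def partition_chain_def)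
  obtain S where S: "\<And>t. t \<in> {1..m} \<Longrightarrow> spread_reps (?H t) (P t) (S t)"
    and S_step: "\<And>t. t \<in> {1..<m} \<Longrightarrow> S (t + 1) \<subseteq> S t"
    using spread_reps_chain[OF fin ms] by metis
  have SV: "S t \<subseteq> verts G" if "t \<in> {1..m}" for t
    using S[OF that] by (simp add: spread_reps_def)
  have S3: "card (A \<inter> S t) \<le> 3" if "t \<in> {1..m}" "A \<in> P t" for t A
    using S[OF that(1)] that(2) by (simp add: spread_reps_def Int_commute)
  have nested: "S t' \<subseteq> S t" if "1 \<le> t" "t \<le> t'" "t' \<le> m" for t t'
    using that(2,3)
  proof (induction rule: dec_induct)
    case (step n)
    then have "S (n + 1) \<subseteq> S n"
      using S_step[of n] that(1) by auto
    then show ?case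
      using step by auto
  qed simp
  \<comment> \<open>A singleton part cannot contain three representatives, so its vertex must be
    near a representative in that part, which is the vertex itself.\<close>
  have "verts G \<subseteq> S 1"
  proof
    fix v assume v: "v \<in> verts G"
    have "S 1 \<inter> {v} \<noteq> {}"
    proof
      assume empty: "S 1 \<inter> {v} = {}"
      have "{v} \<in> P 1"
        unfolding P1 using v by blast
      then have "card (S 1 \<inter> {v}) = 3 \<or> (\<exists>a\<in>S 1 \<inter> {v}. gdist (?H 1) v a \<le> enat 2)"
        using S[of 1] m unfolding spread_reps_def by auto
      then show False
        unfolding empty by simp
    qed
    then show "v \<in> S 1" by blast
  qed
  then have S1: "S 1 = verts G"
    using SV[of 1] m by auto
  obtain xs where xs: "distinct xs" "set xs = verts G"
    and comparable: "\<And>n t. t \<in> {1..m} \<Longrightarrow> S t \<subseteq> verts G \<Longrightarrow> set (take n xs) \<subseteq> S t \<or> S t \<subseteq> set (take n xs)"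
    using order_compatible_with_nested[OF fin, of m S] nested by metis
  have "card (parts_meeting (pball r G (nbhd_partition G U) v) (nbhd_partition G U)) \<le> M"
    if U: "U = set (take n xs)" and v: "v \<in> verts G" for U n v
  proof -
    have UV: "U \<subseteq> verts G"
      unfolding U xs(2)[symmetric] by (rule set_take_subset)
    let ?W = "pball r G (nbhd_partition G U) v"
    have W: "?W \<subseteq> verts G" "finite ?W"
      using finite_subset[OF pball_subset_verts fin] by (auto simp: pball_subset_verts)
    have count: "card (parts_meeting ?W (nbhd_partition G U)) = card (nbhd_label G U ` ?W)"
      using card_parts_meeting_fibers[OF W(1), of "nbhd_label G U"] nbhd_partition_fibers[OF UV] by simp
    \<comment> \<open>The last index \<open>t\<close> with \<open>U \<subseteq> S t\<close> squeezes
      \<open>U\<close> between \<open>S (t + 1)\<close> and \<open>S t\<close> unless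
      \<open>t = m\<close>.\<close>
    let ?I = "{t \<in> {1..m}. U \<subseteq> S t}"
    have "1 \<in> ?I"
      using m UV S1 by simp
    then have "Max ?I \<in> ?I"
      by (intro Max_in) auto
    then obtain t where t: "t \<in> {1..m}" "U \<subseteq> S t" and tmax: "\<And>t'. t' \<in> ?I \<Longrightarrow> t' \<le> t"
      using Max_ge[of ?I] by auto
    show ?thesis
    proof (cases "t = m")
      case True
      have "card (S m) \<le> 3"
        using S3[of m "verts G"] m Pm SV[of m] by (simp add: Int_absorb1)
      moreover have "finite (S m)"
        using SV[of m] m fin by (auto intro: finite_subset)
      ultimately have "card U \<le> 3"
        using t(2) True card_mono[of "S m" U] by auto
      then show ?thesis
        unfolding count using card_nbhd_label_small[OF fin ne W(1) UV] M11 by simp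
    next
      case False
      then have t': "t \<in> {1..<m}" "t + 1 \<in> {1..m}"
        using t(1) by auto
      have "\<not> U \<subseteq> S (t + 1)"
        using tmax[of "t + 1"] t'(2) by auto
      then have SU: "S (t + 1) \<subseteq> U"
        using comparable[OF t'(2) SV[OF t'(2)], of n] U by blast
      have K: "card (nbhd_label G (S t) ` gball (3 * r) (?H (t + 1)) u) \<le> K" if "u \<in> verts G" for u
        unfolding K_def
      proof (rule card_nbhd_label_gball_le[OF fin _ Pt[OF t(1)] hom[OF t(1)] _ SV[OF t(1)] S3[OF t(1)] vc])
        show "card (parts_meeting (gball (3 * r + 1) (?H (t + 1)) u) (P t)) \<le> k"
          unfolding w by (rule merge_sequence_width_ge[OF fin t'(1) that])
      qed (use Rt[OF t'(1)] in auto)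
      \<comment> \<open>\<open>U \<subseteq> S t\<close> bounds the number of classes, and
        \<open>S (t + 1) \<subseteq> U\<close> makes the ball for \<open>U\<close> smaller.\<close>
      have "card (nbhd_label G U ` ?W) \<le> card (nbhd_label G (S t) ` ?W)"
        using W(2) nbhd_label_mono[OF t(2)] by (rule card_image_le_factor)
      also have "\<dots> \<le> card (nbhd_label G (S t) ` pball r G (nbhd_partition G (S (t + 1))) v)"
        using pball_antimono[OF refines_nbhd_partition[OF SU UV]]
          finite_subset[OF pball_subset_verts fin]
        by (intro card_mono image_mono finite_imageI) auto
      also have "\<dots> \<le> (1 + K\<^sup>2) ^ r * K"
        by (rule card_nbhd_label_pball_le[where H = "?H (t + 1)" and P = "P (t + 1)"])
          (use fin Pt[OF t'(2)] hom[OF t'(2)] S[OF t'(2)] S_step[OF t'(1)] SV[OF t(1)] v K in auto)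
      finally show ?thesis
        unfolding count using KM by simp
    qed
  qed
  then have "order_width r G xs \<le> M"
    unfolding order_width_def order_partition_def by (intro nat_Sup_le) auto
  then show ?thesis
    using dmw_le[OF xs, of r] unfolding M k_def by simp
qed

theorem theorem1p3:
  fixes C :: "'a graph set"
  assumes "\<And>G. G \<in> C \<Longrightarrow> simple_graph G"
    and "hereditary C"
  shows "(almost_bounded mw C \<longleftrightarrow> almost_bounded tmw C) \<and>
         (almost_bounded tmw C \<longleftrightarrow> almost_bounded pmw C) \<and>
         (almost_bounded pmw C \<longleftrightarrow> almost_bounded dmw C)"
proof -
  have fin: "finite (verts G)" if "G \<in> C" for G
    using assms(1)[OF that] by (simp add: simple_graph_def)
  have 12: "almost_bounded tmw C" if "almost_bounded mw C"
  proof (rule almost_bounded_transfer[OF that])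
    have "tmw r G \<le> 1 * (1 + mw r G) ^ 1" if "G \<in> C" "verts G \<noteq> {}" for r G
      using tmw_le_mw[OF fin[OF that(1)] that(2), of r] by simp
    then show "\<exists>r' c e. \<forall>G\<in>C. verts G \<noteq> {} \<longrightarrow> tmw r G \<le> c * (1 + mw r' G) ^ e" for r
      by meson
  qed
  have 23: "almost_bounded pmw C" if "almost_bounded tmw C"
  proof (rule almost_bounded_transfer[OF that])
    have "pmw r G \<le> 1 * (1 + tmw r G) ^ 1" if "G \<in> C" "verts G \<noteq> {}" for r G
      using pmw_le_tmw[OF fin[OF that(1)] that(2), of r] by simp
    then show "\<exists>r' c e. \<forall>G\<in>C. verts G \<noteq> {} \<longrightarrow> pmw r G \<le> c * (1 + tmw r' G) ^ e" for r
      by meson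
  qed
  have 43: "almost_bounded pmw C" if "almost_bounded dmw C"
  proof (rule almost_bounded_transfer[OF that])
    have "pmw r G \<le> 3 * (1 + dmw r G) ^ 1" if "G \<in> C" "verts G \<noteq> {}" for r G
      using pmw_le_dmw[OF fin[OF that(1)] that(2), of r] by simp
    then show "\<exists>r' c e. \<forall>G\<in>C. verts G \<noteq> {} \<longrightarrow> pmw r G \<le> c * (1 + dmw r' G) ^ e" for r
      by meson
  qed
  have 31: "almost_bounded mw C" if pmw: "almost_bounded pmw C"
  proof -
    obtain d where d: "\<And>G. G \<in> C \<Longrightarrow> nbhd_vc_free d G"
      using nbhd_vc_bounded[OF assms pmw] by blast
    have "mw r G \<le> 3 * (1 + pmw (9 * r + 1) G) ^ (d + 1)" if "G \<in> C" "verts G \<noteq> {}" for r G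
      using mw_le_pmw[OF assms(1)[OF that(1)] that(2) d[OF that(1)]] .
    then show ?thesis
      by (intro almost_bounded_transfer[OF pmw]) meson
  qed
  have 14: "almost_bounded dmw C" if mw: "almost_bounded mw C"
  proof -
    \<comment> \<open>The VC bound is derived from partition merge-width, which is reached here
      through transient merge-width.\<close>
    obtain d where d: "\<And>G. G \<in> C \<Longrightarrow> nbhd_vc_free d G"
      using nbhd_vc_bounded[OF assms 23[OF 12[OF mw]]] by blast
    have "dmw r G \<le> (4 * 3 ^ (d + 1)) ^ (2 * r + 1) * (1 + mw (3 * r + 1) G) ^ ((d + 1) * (2 * r + 1))"
      if "G \<in> C" "verts G \<noteq> {}" for r G
      using dmw_le_mw[OF assms(1)[OF that(1)] that(2) d[OF that(1)]] .
    then show ?thesis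
      by (intro almost_bounded_transfer[OF mw]) meson
  qed
  show ?thesis
    using 12 23 31 14 43 by blast
qed

end
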